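(* Let $G$ be a finite group and let $\{U_g\}_{g\in G}$ be a unitary projective representation of $G$ on a nonzero finite-dimensional complex Hilbert space $H_Q$, with all prior probabilities equal to $1/|G|$. Let $H_R$ be a finite-dimensional complex Hilbert space of dimension $|R|\ge1$. Let $\sigma$ run over the (equivalence classes of) irreducible unitary projective representations of $G$ with the same factor set, let $d_\sigma$ be the dimension of $\sigma$ and $m_\sigma$ its multiplicity in $\{U_g\}$. Define $$\kappa:=\sum_\sigma\frac{\min(m_\sigma,d_\sigma)d_\sigma}{|G|},\qquad \kappa':=\sum_\sigma\frac{\min(m_\sigma|R|,d_\sigma)d_\sigma}{|G|},\qquad \kappa^{\mathrm A}:=\sum_{\sigma:\,m_\sigma\ge1}\frac{d_\sigma^2}{|G|}.$$ Then for every error margin $m\in[0,1]$, the maximum success probability of discriminating $\{U_g\otimes 1_R\}_{g\in G}$ on $H_Q\otimes H_R$ is $$P_{\max}(m)=\begin{cases}\kappa' & \text{if } 1-\kappa'\le m\le1,\\[1mm] \dfrac{\kappa'}{1-\kappa'}\,m&\text{if } 0\le m<1-\kappa',\end{cases}$$ and for $|R|$ sufficiently large one has $\kappa'=\kappa^{\mathrm A}$. Moreover $\kappa\le\kappa'\le\kappa^{\mathrm A}$, and $\kappa=\kappa^{\mathrm A}$ (so that no ancilla improves the success probability) if all irreducible representations $\sigma$ are one-dimensional.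
   Context: A unitary projective representation of a finite group $G$ on $H$ is a family of unitary operators $\{U_g\}_{g\in G}$ on $H$ with $U_gU_h=c_{g,h}U_{gh}$ for all $g,h\in G$, where the $c_{g,h}$ are complex numbers with $|c_{g,h}|=1$; $\{c_{g,h}\}$ is called the factor set. For a fixed factor set, equivalence, irreducibility and decomposition into irreducibles (with multiplicities) are defined as for ordinary representations. Discrimination with error margin and equal priors, for a family $\{V_g\}_{g\in G}$ of unitaries on a finite-dimensional space $H$: a strategy consists of a density operator $\rho$ on $H$ (input state) and a POVM $\{E_0\}\cup\{E_g\}_{g\in G}$ on $H$ (positive semidefinite operators with $E_0+\sum_{g\in G}E_g=1$; outcome $g$ means "guess $V_g$", and $E_0$ gives the inconclusive result). The success and mean error probabilities are $$P_\circ=\frac1{|G|}\sum_{g\in G}\mathrm{tr}(E_gV_g\rho V_g^\dagger),\qquad P_\times=\frac1{|G|}\sum_{g\ne h}\mathrm{tr}(E_gV_h\rho V_h^\dagger).$$ For $m\in[0,1]$, $P_{\max}(m)$ is the maximum of $P_\circ$ over all strategies with $P_\times\le m$. *)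

theory Defs
  imports
    "Jordan_Normal_Form.Schur_Decomposition"
    "Jordan_Normal_Form.VS_Connect"
begin

text \<open>A finite-dimensional Hilbert space of dimension \<open>n\<close> is represented by \<open>\<complex>\<^sup>n\<close>, and its operators
  by \<open>n \<times> n\<close> complex matrices.\<close>

section \<open>Unitary projective representations\<close>

definition unitary_mat :: "nat \<Rightarrow> complex mat \<Rightarrow> bool" where
  "unitary_mat n A \<longleftrightarrow>
     A \<in> carrier_mat n n \<and> A * mat_adjoint A = 1\<^sub>m n \<and> mat_adjoint A * A = 1\<^sub>m n"

definition proj_rep ::
  "('g, 'b) monoid_scheme \<Rightarrow> ('g \<Rightarrow> 'g \<Rightarrow> complex) \<Rightarrow> nat \<Rightarrow> ('g \<Rightarrow> complex mat) \<Rightarrow> bool" where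
  "proj_rep G c n U \<longleftrightarrow>
     (\<forall>g\<in>carrier G. unitary_mat n (U g)) \<and>
     (\<forall>g\<in>carrier G. \<forall>h\<in>carrier G.
        cmod (c g h) = 1 \<and> U g * U h = c g h \<cdot>\<^sub>m U (g \<otimes>\<^bsub>G\<^esub> h))"

definition irreps ::
  "('g, 'b) monoid_scheme \<Rightarrow> ('g \<Rightarrow> 'g \<Rightarrow> complex) \<Rightarrow> ('g \<Rightarrow> complex mat) set" where
  "irreps G c = {V. \<exists>d>0. proj_rep G c d V \<and>
     (\<forall>W. VectorSpace.subspace class_ring W (module_vec TYPE(complex) d) \<longrightarrow>
          (\<forall>g\<in>carrier G. \<forall>w\<in>W. V g *\<^sub>v w \<in> W) \<longrightarrow>
          W = {0\<^sub>v d} \<or> W = carrier_vec d)}"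

text \<open>Equivalence as for ordinary representations: one invertible matrix \<open>P\<close> (with inverse \<open>Q\<close>)
  satisfies \<open>U g = P * V g * Q\<close> for all group elements \<open>g\<close> simultaneously.\<close>

definition rep_equiv ::
  "('g, 'b) monoid_scheme \<Rightarrow> ('g \<Rightarrow> complex mat) \<Rightarrow> ('g \<Rightarrow> complex mat) \<Rightarrow> bool" where
  "rep_equiv G U V \<longleftrightarrow> (\<exists>P Q. \<forall>g\<in>carrier G. similar_mat_wit (U g) (V g) P Q)"

definition irrep_classes ::
  "('g, 'b) monoid_scheme \<Rightarrow> ('g \<Rightarrow> 'g \<Rightarrow> complex) \<Rightarrow> ('g \<Rightarrow> complex mat) set set" where
  "irrep_classes G c =
     irreps G c // {(V, W). V \<in> irreps G c \<and> W \<in> irreps G c \<and> rep_equiv G V W}"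

definition rep_dim :: "('g, 'b) monoid_scheme \<Rightarrow> ('g \<Rightarrow> complex mat) \<Rightarrow> nat" where
  "rep_dim G V = dim_row (V \<one>\<^bsub>G\<^esub>)"

text \<open>All members of a class have the same dimension, so the image below is a singleton.\<close>

definition class_dim :: "('g, 'b) monoid_scheme \<Rightarrow> ('g \<Rightarrow> complex mat) set \<Rightarrow> nat" where
  "class_dim G \<sigma> = the_elem (rep_dim G ` \<sigma>)"

definition direct_sum :: "('g \<Rightarrow> complex mat) list \<Rightarrow> 'g \<Rightarrow> complex mat" where
  "direct_sum Vs g = diag_block_mat (map (\<lambda>V. V g) Vs)"

text \<open>The multiplicity of a class \<open>\<sigma>\<close> in \<open>U\<close>: the number of summands belonging to \<open>\<sigma>\<close> in a
  decomposition of \<open>U\<close> into irreducibles with factor set \<open>c\<close>. A decomposition exists and the number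
  does not depend on it.\<close>

definition multiplicity_in ::
  "('g, 'b) monoid_scheme \<Rightarrow> ('g \<Rightarrow> 'g \<Rightarrow> complex) \<Rightarrow> ('g \<Rightarrow> complex mat) \<Rightarrow>
   ('g \<Rightarrow> complex mat) set \<Rightarrow> nat" where
  "multiplicity_in G c U \<sigma> =
     (THE k. \<exists>Vs. set Vs \<subseteq> irreps G c \<and> rep_equiv G U (direct_sum Vs) \<and>
                  k = length (filter (\<lambda>V. V \<in> \<sigma>) Vs))"

definition kappa ::
  "('g, 'b) monoid_scheme \<Rightarrow> ('g \<Rightarrow> 'g \<Rightarrow> complex) \<Rightarrow> ('g \<Rightarrow> complex mat) \<Rightarrow> real" where
  "kappa G c U = (\<Sum>\<sigma>\<in>irrep_classes G c.
     real (min (multiplicity_in G c U \<sigma>) (class_dim G \<sigma>) * class_dim G \<sigma>) / real (card (carrier G)))"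

definition kappa' ::
  "('g, 'b) monoid_scheme \<Rightarrow> ('g \<Rightarrow> 'g \<Rightarrow> complex) \<Rightarrow> ('g \<Rightarrow> complex mat) \<Rightarrow> nat \<Rightarrow> real" where
  "kappa' G c U r = (\<Sum>\<sigma>\<in>irrep_classes G c.
     real (min (multiplicity_in G c U \<sigma> * r) (class_dim G \<sigma>) * class_dim G \<sigma>) / real (card (carrier G)))"

definition kappa_A ::
  "('g, 'b) monoid_scheme \<Rightarrow> ('g \<Rightarrow> 'g \<Rightarrow> complex) \<Rightarrow> ('g \<Rightarrow> complex mat) \<Rightarrow> real" where
  "kappa_A G c U = (\<Sum>\<sigma>\<in>{\<sigma> \<in> irrep_classes G c. multiplicity_in G c U \<sigma> \<ge> 1}.
     real ((class_dim G \<sigma>)\<^sup>2) / real (card (carrier G)))"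

section \<open>Discrimination of unitaries with error margin\<close>

text \<open>The order on \<^typ>\<open>complex\<close> is the one of \<^theory>\<open>HOL-Library.Complex_Order\<close>: \<open>0 \<le> z\<close> means that
  \<open>z\<close> is real and nonnegative.\<close>

definition psd :: "nat \<Rightarrow> complex mat \<Rightarrow> bool" where
  "psd n A \<longleftrightarrow> A \<in> carrier_mat n n \<and> (\<forall>v\<in>carrier_vec n. 0 \<le> (A *\<^sub>v v) \<bullet>c v)"

definition mat_trace :: "complex mat \<Rightarrow> complex" where
  "mat_trace A = (\<Sum>i<dim_row A. A $$ (i, i))"

definition density_op :: "nat \<Rightarrow> complex mat \<Rightarrow> bool" where
  "density_op n \<rho> \<longleftrightarrow> psd n \<rho> \<and> mat_trace \<rho> = 1"

text \<open>\<open>E0\<close> is the inconclusive outcome.\<close>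

definition povm ::
  "('g, 'b) monoid_scheme \<Rightarrow> nat \<Rightarrow> complex mat \<Rightarrow> ('g \<Rightarrow> complex mat) \<Rightarrow> bool" where
  "povm G n E0 E \<longleftrightarrow> psd n E0 \<and> (\<forall>g\<in>carrier G. psd n (E g)) \<and>
     E0 + finsum (module_mat TYPE(complex) n n) E (carrier G) = 1\<^sub>m n"

text \<open>The traces below are real for every strategy, so \<^const>\<open>Re\<close> only adjusts the type.\<close>

definition success_prob ::
  "('g, 'b) monoid_scheme \<Rightarrow> ('g \<Rightarrow> complex mat) \<Rightarrow> complex mat \<Rightarrow> ('g \<Rightarrow> complex mat) \<Rightarrow> real" where
  "success_prob G V \<rho> E = 1 / real (card (carrier G)) *
     (\<Sum>g\<in>carrier G. Re (mat_trace (E g * V g * \<rho> * mat_adjoint (V g))))"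

definition error_prob ::
  "('g, 'b) monoid_scheme \<Rightarrow> ('g \<Rightarrow> complex mat) \<Rightarrow> complex mat \<Rightarrow> ('g \<Rightarrow> complex mat) \<Rightarrow> real" where
  "error_prob G V \<rho> E = 1 / real (card (carrier G)) *
     (\<Sum>g\<in>carrier G. \<Sum>h\<in>carrier G - {g}. Re (mat_trace (E g * V h * \<rho> * mat_adjoint (V h))))"

definition achievable_probs ::
  "('g, 'b) monoid_scheme \<Rightarrow> nat \<Rightarrow> ('g \<Rightarrow> complex mat) \<Rightarrow> real \<Rightarrow> real set" where
  "achievable_probs G n V m =
     {success_prob G V \<rho> E | \<rho> E0 E. density_op n \<rho> \<and> povm G n E0 E \<and> error_prob G V \<rho> E \<le> m}"

text \<open>\<open>p\<close> is the maximum, so in particular it is attained.\<close>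

definition is_P_max ::
  "('g, 'b) monoid_scheme \<Rightarrow> nat \<Rightarrow> ('g \<Rightarrow> complex mat) \<Rightarrow> real \<Rightarrow> real \<Rightarrow> bool" where
  "is_P_max G n V m p \<longleftrightarrow>
     p \<in> achievable_probs G n V m \<and> (\<forall>q\<in>achievable_probs G n V m. q \<le> p)"

text \<open>The Kronecker product, i.e. the matrix of the tensor product operator in the basis
  \<open>e\<^sub>i \<otimes> f\<^sub>j\<close> ordered lexicographically.\<close>

definition tensor_mat :: "complex mat \<Rightarrow> complex mat \<Rightarrow> complex mat" where
  "tensor_mat A B = mat (dim_row A * dim_row B) (dim_col A * dim_col B)
     (\<lambda>(i, j). A $$ (i div dim_row B, j div dim_col B) * B $$ (i mod dim_row B, j mod dim_col B))"

definition with_ancilla :: "('g \<Rightarrow> complex mat) \<Rightarrow> nat \<Rightarrow> 'g \<Rightarrow> complex mat" where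
  "with_ancilla U r g = tensor_mat (U g) (1\<^sub>m r)"

end

theory Submission
  imports Defs "HOL-Analysis.L2_Norm" "Jordan_Normal_Form.Spectral_Radius"
begin

text \<open>Both bounds come from the orbit sum \<open>F x y = (\<Sum>g. \<bar>\<langle>x, U\<^sub>g y\<rangle>\<bar>\<^sup>2)\<close>. In coordinates adapted to a
  decomposition into irreducibles, Schur orthogonality turns \<open>F x y\<close> into a weighted sum of the
  squared Frobenius norms of the matrices \<open>M\<^sub>\<sigma> = Y\<^sub>\<sigma> X\<^sub>\<sigma>\<^sup>*\<close>, where \<open>X\<^sub>\<sigma>\<close> and \<open>Y\<^sub>\<sigma>\<close>
  have one column of coordinates for each copy of \<open>\<sigma>\<close>, while \<open>\<langle>x, y\<rangle>\<close> is the sum of their traces.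
  Since \<open>M\<^sub>\<sigma>\<close> has rank at most \<open>min m\<^sub>\<sigma> d\<^sub>\<sigma>\<close>, Cauchy--Schwarz gives \<open>\<bar>\<langle>x, y\<rangle>\<bar>\<^sup>2 \<le> \<kappa> F x y\<close>, which for positive
  operators says \<open>P\<^sub>\<circ> \<le> \<kappa> (P\<^sub>\<circ> + P\<^sub>\<times>)\<close>. Conversely some unit vector \<open>y\<close> satisfies
  \<open>\<kappa> F x y \<le> \<bar>x\<bar>\<^sup>2\<close> for all \<open>x\<close>, so that the operators \<open>t \<kappa> U\<^sub>g y y\<^sup>* U\<^sub>g\<^sup>*\<close> with \<open>0 \<le> t \<le> 1\<close> complete to a
  POVM that attains equality. An ancilla of dimension \<open>r\<close> multiplies every multiplicity by \<open>r\<close>, as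
  one sees on characters.\<close>

section \<open>Orthonormal systems of functions\<close>

text \<open>Success plus error is at most 1, so the bound by \<kappa> leaves a linear program in the
  pair (success, error). Its vertex is (\<kappa>, 1 - \<kappa>), and the factor t of the POVM moves
  from the origin towards that vertex as far as the error margin allows. The two bounds share one
  constant because the optimal vector is read off from equality in the upper bound: with x = y, each
  M_\<sigma> is a projection of rank min(m_\<sigma>, d_\<sigma>) times a factor proportional to
  d_\<sigma>, the inverse of the Schur constant |G| / d_\<sigma>. Factor sets are harmless since
  every group sum pairs a representation with the conjugate of one having the same phases, or takes
  absolute values. The definitions force some preparation: \<kappa> sums over a set of equivalence
  classes and the multiplicity is a definite description, so finiteness of that set and independence
  of the decomposition must be known before either can be evaluated; both follow from Schur
  orthogonality. The bounds hold for any projective representation, and the ancilla problem is the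
  instance U \<otimes> 1.\<close>

lemma cauchy_schwarz_sum:
  fixes f g :: "'i \<Rightarrow> real"
  assumes "\<And>i. i \<in> X \<Longrightarrow> 0 \<le> f i" "\<And>i. i \<in> X \<Longrightarrow> 0 \<le> g i"
  shows "(\<Sum>i\<in>X. sqrt (f i * g i))\<^sup>2 \<le> (\<Sum>i\<in>X. f i) * (\<Sum>i\<in>X. g i)"
proof -
  have "(\<Sum>i\<in>X. sqrt (f i * g i)) = (\<Sum>i\<in>X. \<bar>sqrt (f i)\<bar> * \<bar>sqrt (g i)\<bar>)"
    using assms by (intro sum.cong) (auto simp: real_sqrt_mult)
  also have "\<dots> \<le> L2_set (\<lambda>i. sqrt (f i)) X * L2_set (\<lambda>i. sqrt (g i)) X"
    by (rule L2_set_mult_ineq)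
  also have "\<dots> = sqrt (\<Sum>i\<in>X. f i) * sqrt (\<Sum>i\<in>X. g i)"
    unfolding L2_set_def using assms by (simp cong: sum.cong)
  finally have "(\<Sum>i\<in>X. sqrt (f i * g i))\<^sup>2 \<le> (sqrt (\<Sum>i\<in>X. f i) * sqrt (\<Sum>i\<in>X. g i))\<^sup>2"
    using assms by (intro power_mono sum_nonneg) auto
  then show ?thesis
    using assms by (simp add: power_mult_distrib sum_nonneg)
qed

lemma norm_sum_squared_le:
  fixes z :: "'i \<Rightarrow> complex"
  shows "(cmod (\<Sum>i\<in>X. z i))\<^sup>2 \<le> real (card X) * (\<Sum>i\<in>X. (cmod (z i))\<^sup>2)"
proof -
  have "(cmod (\<Sum>i\<in>X. z i))\<^sup>2 \<le> (\<Sum>i\<in>X. sqrt (1 * (cmod (z i))\<^sup>2))\<^sup>2"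
    by (intro power_mono) (auto intro: norm_sum)
  also have "\<dots> \<le> (\<Sum>i\<in>X. 1) * (\<Sum>i\<in>X. (cmod (z i))\<^sup>2)"
    by (rule cauchy_schwarz_sum) auto
  finally show ?thesis by simp
qed

text \<open>Linear in the first argument, like \<open>\<bullet>c\<close>. One notion covers
  coordinate vectors, where \<open>X\<close> is an initial segment of the naturals, and functions on
  the group, where \<open>X\<close> is \<open>carrier G\<close>. The first use serves the
  decomposition of a representation, the second the counting of irreducible classes.\<close>

definition inner_on :: "'i set \<Rightarrow> ('i \<Rightarrow> complex) \<Rightarrow> ('i \<Rightarrow> complex) \<Rightarrow> complex" where
  "inner_on X x y = (\<Sum>i\<in>X. x i * cnj (y i))"

lemma inner_on_self: "inner_on X x x = of_real (\<Sum>i\<in>X. (cmod (x i))\<^sup>2)"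
  by (simp add: inner_on_def complex_norm_square del: of_real_power)

lemma inner_on_cnj: "cnj (inner_on X x y) = inner_on X y x"
  by (simp add: inner_on_def mult.commute)

lemma inner_on_diff_left: "inner_on X (\<lambda>i. x i - y i) z = inner_on X x z - inner_on X y z"
  by (simp add: inner_on_def algebra_simps sum_subtractf)

lemma inner_on_scale_left: "inner_on X (\<lambda>i. c * x i) z = c * inner_on X x z"
  by (simp add: inner_on_def algebra_simps sum_distrib_left)

lemma inner_on_scale_right: "inner_on X x (\<lambda>i. c * z i) = cnj c * inner_on X x z"
  by (simp add: inner_on_def algebra_simps sum_distrib_left)

lemma inner_on_sum_left:
  "inner_on X (\<lambda>i. \<Sum>l\<in>L. c l * q l i) z = (\<Sum>l\<in>L. c l * inner_on X (q l) z)"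
  unfolding inner_on_def sum_distrib_right sum_distrib_left
  by (subst sum.swap) (simp add: algebra_simps)

lemma norm_inner_on_squared_le:
  "(cmod (inner_on X x y))\<^sup>2 \<le> (\<Sum>i\<in>X. (cmod (x i))\<^sup>2) * (\<Sum>i\<in>X. (cmod (y i))\<^sup>2)"
proof -
  have "cmod (inner_on X x y) \<le> (\<Sum>i\<in>X. sqrt ((cmod (x i))\<^sup>2 * (cmod (y i))\<^sup>2))"
    unfolding inner_on_def
    by (rule order.trans[OF norm_sum]) (simp add: norm_mult real_sqrt_mult)
  then have "(cmod (inner_on X x y))\<^sup>2 \<le> (\<Sum>i\<in>X. sqrt ((cmod (x i))\<^sup>2 * (cmod (y i))\<^sup>2))\<^sup>2"
    by (intro power_mono) auto
  also have "\<dots> \<le> (\<Sum>i\<in>X. (cmod (x i))\<^sup>2) * (\<Sum>i\<in>X. (cmod (y i))\<^sup>2)"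
    by (rule cauchy_schwarz_sum) auto
  finally show ?thesis .
qed

text \<open>The weights \<open>w\<close> are kept because matrix entries of an irreducible
  representation are orthogonal but have squared norm |G| / d, and this constant must survive into
  the formula for the orbit sum.\<close>

lemma parseval_orthogonal:
  assumes "finite L"
    and orth: "\<And>k l. k \<in> L \<Longrightarrow> l \<in> L \<Longrightarrow> inner_on X (q k) (q l) = (if k = l then of_real (w k) else 0)"
  shows "(\<Sum>i\<in>X. (cmod (\<Sum>l\<in>L. c l * q l i))\<^sup>2) = (\<Sum>l\<in>L. w l * (cmod (c l))\<^sup>2)"
proof -
  let ?s = "\<lambda>i. \<Sum>l\<in>L. c l * q l i"
  have "complex_of_real (\<Sum>i\<in>X. (cmod (?s i))\<^sup>2) = (\<Sum>k\<in>L. c k * inner_on X (q k) ?s)"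
    unfolding inner_on_self[symmetric] by (rule inner_on_sum_left)
  also have "\<dots> = (\<Sum>k\<in>L. c k * cnj (\<Sum>l\<in>L. c l * inner_on X (q l) (q k)))"
    by (simp only: inner_on_sum_left[symmetric] inner_on_cnj)
  also have "\<dots> = (\<Sum>k\<in>L. c k * cnj (c k * of_real (w k)))"
    using assms(1) by (intro sum.cong refl arg_cong2[where f = "(*)"] arg_cong[where f = cnj])
      (simp add: orth if_distrib sum.delta cong: if_cong)
  also have "\<dots> = of_real (\<Sum>l\<in>L. w l * (cmod (c l))\<^sup>2)"
    by (simp add: complex_norm_square mult_ac del: of_real_power)
  finally show ?thesis by (simp only: of_real_eq_iff)
qed

definition orthonormal_on :: "'i set \<Rightarrow> 'l set \<Rightarrow> ('l \<Rightarrow> 'i \<Rightarrow> complex) \<Rightarrow> bool" where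
  "orthonormal_on X L q \<longleftrightarrow> (\<forall>k\<in>L. \<forall>l\<in>L. inner_on X (q k) (q l) = of_bool (k = l))"

lemma orthonormal_onD:
  "orthonormal_on X L q \<Longrightarrow> k \<in> L \<Longrightarrow> l \<in> L \<Longrightarrow> inner_on X (q k) (q l) = of_bool (k = l)"
  by (auto simp: orthonormal_on_def)

lemma parseval:
  assumes "finite L" "orthonormal_on X L q"
  shows "(\<Sum>i\<in>X. (cmod (\<Sum>l\<in>L. c l * q l i))\<^sup>2) = (\<Sum>l\<in>L. (cmod (c l))\<^sup>2)"
  using parseval_orthogonal[of L X q "\<lambda>_. 1" c] assms by (auto simp: orthonormal_on_def)

definition residual ::
  "'i set \<Rightarrow> 'l set \<Rightarrow> ('l \<Rightarrow> 'i \<Rightarrow> complex) \<Rightarrow> ('i \<Rightarrow> complex) \<Rightarrow> 'i \<Rightarrow> complex" where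
  "residual X L q x i = x i - (\<Sum>l\<in>L. inner_on X x (q l) * q l i)"

lemma inner_residual:
  assumes "finite L" "orthonormal_on X L q" "k \<in> L"
  shows "inner_on X (residual X L q x) (q k) = 0"
proof -
  have "inner_on X (residual X L q x) (q k) =
      inner_on X x (q k) - (\<Sum>l\<in>L. inner_on X x (q l) * inner_on X (q l) (q k))"
    unfolding residual_def by (simp only: inner_on_diff_left inner_on_sum_left)
  also have "(\<Sum>l\<in>L. inner_on X x (q l) * inner_on X (q l) (q k)) =
      (\<Sum>l\<in>L. inner_on X x (q l) * of_bool (l = k))"
    using assms by (intro sum.cong) (auto simp: orthonormal_onD)
  also have "\<dots> = inner_on X x (q k)"
    using assms by (simp add: of_bool_def if_distrib sum.delta cong: if_cong)
  finally show ?thesis by simp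
qed

lemma bessel:
  assumes "finite L" "orthonormal_on X L q"
  shows "(\<Sum>l\<in>L. (cmod (inner_on X x (q l)))\<^sup>2) \<le> (\<Sum>i\<in>X. (cmod (x i))\<^sup>2)"
proof -
  let ?r = "residual X L q x" and ?p = "\<lambda>i. \<Sum>l\<in>L. inner_on X x (q l) * q l i"
  have split: "inner_on X ?r z = inner_on X x z - inner_on X ?p z" for z
    unfolding residual_def by (simp only: inner_on_diff_left)
  have "inner_on X ?r ?r = inner_on X x ?r - inner_on X ?p ?r" by (rule split)
  also have "inner_on X ?p ?r = (\<Sum>l\<in>L. inner_on X x (q l) * cnj (inner_on X ?r (q l)))"
    by (simp only: inner_on_sum_left inner_on_cnj)
  also have "\<dots> = 0"
    using assms by (simp add: inner_residual)
  also have "inner_on X x ?r = cnj (inner_on X ?r x)"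
    by (simp only: inner_on_cnj)
  also have "inner_on X ?r x = inner_on X x x - (\<Sum>l\<in>L. inner_on X x (q l) * cnj (inner_on X x (q l)))"
    by (simp only: split inner_on_sum_left inner_on_cnj)
  also have "\<dots> = of_real ((\<Sum>i\<in>X. (cmod (x i))\<^sup>2) - (\<Sum>l\<in>L. (cmod (inner_on X x (q l)))\<^sup>2))"
    by (simp add: inner_on_self complex_norm_square del: of_real_power)
  finally have "(\<Sum>i\<in>X. (cmod (?r i))\<^sup>2) =
      (\<Sum>i\<in>X. (cmod (x i))\<^sup>2) - (\<Sum>l\<in>L. (cmod (inner_on X x (q l)))\<^sup>2)"
    unfolding inner_on_self by (simp only: complex_cnj_complex_of_real diff_zero of_real_eq_iff)
  moreover have "(\<Sum>i\<in>X. (cmod (?r i))\<^sup>2) \<ge> 0" by (intro sum_nonneg) auto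
  ultimately show ?thesis by simp
qed

text \<open>The sum of all \<open>(cmod (q l i))\<^sup>2\<close> is counted twice: for each
  \<open>l\<close> it gives 1 by normalisation, for each \<open>i\<close> at most 1 by Bessel's
  inequality applied to the indicator function of \<open>i\<close>.\<close>

lemma orthonormal_card_le:
  assumes "finite X" "finite L" "orthonormal_on X L q"
  shows "card L \<le> card X"
proof -
  have one: "(\<Sum>i\<in>X. (cmod (q l i))\<^sup>2) = 1" if "l \<in> L" for l
    using orthonormal_onD[OF assms(3) that that] inner_on_self[of X "q l"]
    by (metis of_bool_eq(2) of_real_eq_1_iff)
  have le: "(\<Sum>l\<in>L. (cmod (q l i))\<^sup>2) \<le> 1" if "i \<in> X" for i
  proof -
    have "inner_on X (\<lambda>j. of_bool (j = i)) (q l) = cnj (q l i)" for l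
      using that assms(1) by (simp add: inner_on_def of_bool_def if_distribR if_distrib sum.delta cong: if_cong)
    moreover have "(\<Sum>j\<in>X. (cmod (of_bool (j = i)))\<^sup>2) = (\<Sum>j\<in>X. if j = i then 1 else 0::real)"
      by (intro sum.cong) auto
    moreover have "\<dots> = 1" using that assms(1) by simp
    ultimately show ?thesis
      using bessel[OF assms(2,3), of "\<lambda>j. of_bool (j = i)"] by simp
  qed
  have "real (card L) = (\<Sum>l\<in>L. \<Sum>i\<in>X. (cmod (q l i))\<^sup>2)" by (simp add: one)
  also have "\<dots> = (\<Sum>i\<in>X. \<Sum>l\<in>L. (cmod (q l i))\<^sup>2)" by (rule sum.swap)
  also have "\<dots> \<le> (\<Sum>i\<in>X. 1)" by (intro sum_mono le)
  finally show ?thesis by simp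
qed

text \<open>The Gram--Schmidt step; \<open>s\<close> is the inverse norm of the residual. Only
  \<open>s \<noteq> 0\<close> is exported, because a caller solves for \<open>x\<close> with the
  coefficient \<open>1 / s\<close> on the new member.\<close>

lemma orthonormal_extend:
  fixes q :: "nat \<Rightarrow> 'i \<Rightarrow> complex"
  assumes "orthonormal_on X {..<L} q" "finite X" "i \<in> X" "residual X {..<L} q x i \<noteq> 0"
  obtains s where "s \<noteq> 0" "orthonormal_on X {..<Suc L} (q(L := \<lambda>i. s * residual X {..<L} q x i))"
proof -
  let ?r = "residual X {..<L} q x"
  let ?N = "\<Sum>i\<in>X. (cmod (?r i))\<^sup>2"
  let ?s = "complex_of_real (1 / sqrt ?N)"
  have N: "?N > 0"
    using assms(2-4) by (intro sum_pos2[of X i]) auto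
  then have s0: "?s \<noteq> 0" by simp
  have 1: "inner_on X (\<lambda>i. ?s * ?r i) (\<lambda>i. ?s * ?r i) = 1"
  proof -
    have "inner_on X (\<lambda>i. ?s * ?r i) (\<lambda>i. ?s * ?r i) = ?s * (cnj ?s * inner_on X ?r ?r)"
      by (simp only: inner_on_scale_left inner_on_scale_right)
    also have "\<dots> = of_real (1 / sqrt ?N * (1 / sqrt ?N * ?N))"
      unfolding inner_on_self by (simp only: complex_cnj_complex_of_real of_real_mult)
    also have "1 / sqrt ?N * (1 / sqrt ?N * ?N) = 1"
      using N by (simp add: field_simps)
    finally show ?thesis by simp
  qed
  have z1: "inner_on X (\<lambda>i. ?s * ?r i) (q k) = 0" if "k < L" for k
    using inner_residual[OF _ assms(1), of k x] that by (simp add: inner_on_scale_left del: of_real_divide)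
  have z2: "inner_on X (q k) (\<lambda>i. ?s * ?r i) = 0" if "k < L" for k
    using z1[OF that] inner_on_cnj[of X "\<lambda>i. ?s * ?r i" "q k"] by simp
  have "orthonormal_on X {..<Suc L} (q(L := \<lambda>i. ?s * ?r i))"
    unfolding orthonormal_on_def
    using assms(1) by (auto simp: less_Suc_eq z1 z2 1 orthonormal_onD simp del: of_real_divide)
  with s0 show thesis by (rule that)
qed

text \<open>Gram--Schmidt that skips dependent vectors, hence \<open>L \<le> card K\<close> instead
  of equality. This inequality is where a number of summands becomes a bound on a rank.\<close>

lemma orthonormal_spanning:
  assumes "finite X" "finite K"
  shows "\<exists>L q. L \<le> card K \<and> orthonormal_on X {..<L::nat} q \<and>
    (\<forall>k\<in>K. \<exists>c. \<forall>i\<in>X. v k i = (\<Sum>l<L. c l * q l i))"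
  using assms(2)
proof (induction K rule: finite_induct)
  case empty
  show ?case by (intro exI[of _ 0]) (auto simp: orthonormal_on_def)
next
  case (insert k K)
  then obtain L q where L: "L \<le> card K" "orthonormal_on X {..<L::nat} q"
    and sp: "\<And>k. k \<in> K \<Longrightarrow> \<exists>c. \<forall>i\<in>X. v k i = (\<Sum>l<L. c l * q l i)" by blast
  show ?case
  proof (cases "\<forall>i\<in>X. residual X {..<L} q (v k) i = 0")
    case True
    then have "\<exists>c. \<forall>i\<in>X. v k i = (\<Sum>l<L. c l * q l i)"
      by (intro exI[of _ "\<lambda>l. inner_on X (v k) (q l)"]) (auto simp: residual_def)
    with sp L insert show ?thesis by (intro exI[of _ L] exI[of _ q]) auto
  next
    case False
    then obtain s where s: "s \<noteq> 0"
      and o: "orthonormal_on X {..<Suc L} (q(L := \<lambda>i. s * residual X {..<L} q (v k) i))"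
      (is "orthonormal_on X _ ?q")
      using orthonormal_extend[OF L(2) assms(1)] by blast
    have "\<exists>c. \<forall>i\<in>X. v k i = (\<Sum>l<Suc L. c l * ?q l i)"
      using s by (intro exI[of _ "(\<lambda>l. inner_on X (v k) (q l))(L := 1 / s)"]) (auto simp: residual_def)
    moreover have "\<exists>c. \<forall>i\<in>X. v j i = (\<Sum>l<Suc L. c l * ?q l i)" if j: "j \<in> K" for j
    proof -
      from sp[OF j] obtain c where "\<forall>i\<in>X. v j i = (\<Sum>l<L. c l * q l i)" by blast
      then show ?thesis by (intro exI[of _ "c(L := 0)"]) auto
    qed
    ultimately show ?thesis
      using o L(1) insert.hyps by (intro exI[of _ "Suc L"] exI[of _ ?q] conjI ballI) (auto simp del: fun_upd_apply sum.lessThan_Suc)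
  qed
qed

text \<open>Gram--Schmidt steps inside \<open>S\<close> must stop because an orthonormal system has
  at most \<open>card X\<close> members, hence the induction on \<open>card X - L\<close>. There are
  two uses: from the empty system inside a given subspace, and from the columns of an isometry
  inside the whole space.\<close>

lemma orthonormal_complete:
  fixes q :: "nat \<Rightarrow> 'i \<Rightarrow> complex"
  assumes "finite X" "orthonormal_on X {..<L} q" "\<And>l. l < L \<Longrightarrow> q l \<in> S"
    and S: "\<And>x y. x \<in> S \<Longrightarrow> y \<in> S \<Longrightarrow> (\<lambda>i. x i + y i) \<in> S"
           "\<And>x c. x \<in> S \<Longrightarrow> (\<lambda>i. c * x i) \<in> S" "(\<lambda>_. 0) \<in> S"
  shows "\<exists>L' q'. L \<le> L' \<and> (\<forall>l<L. q' l = q l) \<and> orthonormal_on X {..<L'} q' \<and> (\<forall>l<L'. q' l \<in> S) \<and>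
    (\<forall>x\<in>S. \<forall>i\<in>X. x i = (\<Sum>l<L'. inner_on X x (q' l) * q' l i))"
  using assms(2,3)
proof (induction "card X - L" arbitrary: L q rule: less_induct)
  case less
  show ?case
  proof (cases "\<forall>x\<in>S. \<forall>i\<in>X. residual X {..<L} q x i = 0")
    case True
    then show ?thesis
      using less.prems by (intro exI[of _ L] exI[of _ q]) (auto simp: residual_def)
  next
    case False
    then obtain x i s where x: "x \<in> S" and s: "s \<noteq> 0"
      and o: "orthonormal_on X {..<Suc L} (q(L := \<lambda>i. s * residual X {..<L} q x i))"
        (is "orthonormal_on X _ ?q")
      using orthonormal_extend[OF less.prems(1) assms(1)] by metis
    have sum: "(\<lambda>i. \<Sum>l<k. c l * q l i) \<in> S" if "k \<le> L" for k and c :: "nat \<Rightarrow> complex"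
      using that
    proof (induction k)
      case 0
      then show ?case using S(3) by simp
    next
      case (Suc k)
      then show ?case using S(1)[OF _ S(2)[OF less.prems(2)[of k]], of _ "c k"] by simp
    qed
    have "(\<lambda>i. x i + (-1) * (\<Sum>l<L. inner_on X x (q l) * q l i)) \<in> S"
      by (intro S(1)[OF x] S(2)[of _ "-1"] sum) simp
    then have "residual X {..<L} q x \<in> S" by (simp add: residual_def[abs_def])
    then have q: "?q l \<in> S" if "l < Suc L" for l
      using that less.prems(2) S(2) by (auto simp: less_Suc_eq)
    have "Suc L \<le> card X" using orthonormal_card_le[OF assms(1) _ o] by simp
    then have "card X - Suc L < card X - L" by simp
    from less.hyps[OF this o q] obtain L' q' where L': "Suc L \<le> L'" "\<forall>l<Suc L. q' l = ?q l"
      and rest: "orthonormal_on X {..<L'} q' \<and> (\<forall>l<L'. q' l \<in> S) \<and>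
        (\<forall>x\<in>S. \<forall>i\<in>X. x i = (\<Sum>l<L'. inner_on X x (q' l) * q' l i))" by blast
    from L' have "L \<le> L'" "\<forall>l<L. q' l = q l" by auto
    with rest show ?thesis by blast
  qed
qed

text \<open>The double count behind \<open>orthonormal_card_le\<close> with equality: expanding the
  indicator function of \<open>i\<close> and evaluating at \<open>i\<close> shows that each
  \<open>i\<close> contributes exactly 1.\<close>

lemma complete_orthonormal_card:
  assumes "finite X" "finite L" "orthonormal_on X L q"
    and c: "\<And>x i. i \<in> X \<Longrightarrow> x i = (\<Sum>l\<in>L. inner_on X x (q l) * q l i)"
  shows "card L = card X"
proof -
  have one: "(\<Sum>i\<in>X. q l i * cnj (q l i)) = 1" if "l \<in> L" for l
    using orthonormal_onD[OF assms(3) that that] by (simp add: inner_on_def)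
  have e: "(\<Sum>l\<in>L. q l i * cnj (q l i)) = 1" if "i \<in> X" for i
  proof -
    have "inner_on X (\<lambda>j. of_bool (j = i)) (q l) = cnj (q l i)" for l
      using that assms(1) by (simp add: inner_on_def of_bool_def if_distribR if_distrib sum.delta cong: if_cong)
    then show ?thesis
      using c[OF that, of "\<lambda>j. of_bool (j = i)"] by (simp add: mult.commute)
  qed
  have "complex_of_nat (card L) = (\<Sum>l\<in>L. \<Sum>i\<in>X. q l i * cnj (q l i))" by (simp add: one)
  also have "\<dots> = (\<Sum>i\<in>X. \<Sum>l\<in>L. q l i * cnj (q l i))" by (rule sum.swap)
  also have "\<dots> = of_nat (card X)" by (simp add: e)
  finally show ?thesis by (simp only: of_nat_eq_iff)
qed

section \<open>Trace and Frobenius norm of a matrix of bounded rank\<close>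

text \<open>If \<open>card X \<le> card K\<close>, Cauchy--Schwarz on the diagonal suffices.
  Otherwise the \<open>v k\<close> are expanded in an orthonormal system of length
  \<open>L \<le> card K\<close>, so that M is the sum over l of w_l times q_l. The squared Frobenius
  norm is then the sum of the squared norms of the w_l, and the trace is a sum of only
  \<open>L\<close> inner products of some w_l with a unit vector.\<close>

lemma trace_rank_bound:
  fixes u v :: "'k \<Rightarrow> 'i \<Rightarrow> complex"
  assumes "finite X" "finite K"
  defines "M \<equiv> \<lambda>a b. \<Sum>k\<in>K. u k a * v k b"
  shows "(cmod (\<Sum>a\<in>X. M a a))\<^sup>2 \<le>
    real (min (card K) (card X)) * (\<Sum>a\<in>X. \<Sum>b\<in>X. (cmod (M a b))\<^sup>2)"
proof (cases "card X \<le> card K")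
  case True
  have "(cmod (\<Sum>a\<in>X. M a a))\<^sup>2 \<le> real (card X) * (\<Sum>a\<in>X. (cmod (M a a))\<^sup>2)"
    by (rule norm_sum_squared_le)
  also have "\<dots> \<le> real (card X) * (\<Sum>a\<in>X. \<Sum>b\<in>X. (cmod (M a b))\<^sup>2)"
    by (intro mult_left_mono sum_mono member_le_sum[of _ X "\<lambda>b. (cmod (M _ b))\<^sup>2"] assms) auto
  finally show ?thesis using True by (simp add: min_absorb2)
next
  case False
  obtain L :: nat and q where L: "L \<le> card K" "orthonormal_on X {..<L} q"
    and "\<forall>k\<in>K. \<exists>c. \<forall>i\<in>X. v k i = (\<Sum>l<L. c l * q l i)"
    using orthonormal_spanning[OF assms(1,2)] by metis
  then obtain c where c: "\<And>k i. k \<in> K \<Longrightarrow> i \<in> X \<Longrightarrow> v k i = (\<Sum>l<L. c k l * q l i)" by metis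
  define w where "w l a = (\<Sum>k\<in>K. u k a * c k l)" for l a
  have M: "M a b = (\<Sum>l<L. w l a * q l b)" if "b \<in> X" for a b
  proof -
    have "M a b = (\<Sum>k\<in>K. \<Sum>l<L. u k a * c k l * q l b)"
      unfolding M_def using that by (intro sum.cong refl) (simp add: c sum_distrib_left mult_ac)
    also have "\<dots> = (\<Sum>l<L. w l a * q l b)"
      unfolding w_def sum_distrib_right by (rule sum.swap)
    finally show ?thesis .
  qed
  have F: "(\<Sum>a\<in>X. \<Sum>b\<in>X. (cmod (M a b))\<^sup>2) = (\<Sum>l<L. \<Sum>a\<in>X. (cmod (w l a))\<^sup>2)"
  proof -
    have "(\<Sum>b\<in>X. (cmod (M a b))\<^sup>2) = (\<Sum>l<L. (cmod (w l a))\<^sup>2)" for a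
      using parseval[OF _ L(2), of "\<lambda>l. w l a"] by (simp add: M)
    then show ?thesis by (simp add: sum.swap[of _ X])
  qed
  have "(\<Sum>a\<in>X. M a a) = (\<Sum>a\<in>X. \<Sum>l<L. w l a * q l a)" by (simp add: M)
  also have "\<dots> = (\<Sum>l<L. inner_on X (w l) (\<lambda>a. cnj (q l a)))"
    unfolding inner_on_def by (subst sum.swap) simp
  finally have "(cmod (\<Sum>a\<in>X. M a a))\<^sup>2 \<le>
      real (card {..<L}) * (\<Sum>l<L. (cmod (inner_on X (w l) (\<lambda>a. cnj (q l a))))\<^sup>2)"
    using norm_sum_squared_le[of _ "{..<L}"] by simp
  also have "\<dots> \<le> real (card {..<L}) * (\<Sum>l<L. \<Sum>a\<in>X. (cmod (w l a))\<^sup>2)"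
  proof (intro mult_left_mono sum_mono)
    fix l assume "l \<in> {..<L}"
    then have "(\<Sum>a\<in>X. (cmod (q l a))\<^sup>2) = 1"
      using orthonormal_onD[OF L(2), of l l] inner_on_self[of X "q l"]
      by (metis of_bool_eq(2) of_real_eq_1_iff)
    then show "(cmod (inner_on X (w l) (\<lambda>a. cnj (q l a))))\<^sup>2 \<le> (\<Sum>a\<in>X. (cmod (w l a))\<^sup>2)"
      using norm_inner_on_squared_le[of X "w l" "\<lambda>a. cnj (q l a)"] by simp
  qed simp
  also have "\<dots> \<le> real (card K) * (\<Sum>l<L. \<Sum>a\<in>X. (cmod (w l a))\<^sup>2)"
    using L(1) by (intro mult_right_mono) (auto intro!: sum_nonneg)
  finally show ?thesis using False F by simp
qed

section \<open>Positive semidefinite kernels\<close>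

text \<open>Here the first argument is the conjugated one, opposite to \<open>inner_on\<close>.
  Kernels on the naturals are used in place of matrices so that elimination and shifts of block
  indices need no dimension bookkeeping.\<close>

definition quad :: "nat \<Rightarrow> (nat \<Rightarrow> nat \<Rightarrow> complex) \<Rightarrow> (nat \<Rightarrow> complex) \<Rightarrow> (nat \<Rightarrow> complex) \<Rightarrow> complex" where
  "quad n a x y = (\<Sum>i<n. \<Sum>j<n. cnj (x i) * a i j * y j)"

text \<open>All information about a positive semidefinite kernel is extracted by perturbing a single
  coordinate: the diagonal entries, Hermitian symmetry, and the completion of the square in the
  elimination step.\<close>

lemma quad_shift:
  assumes "p < n"
  shows "quad n a (\<lambda>i. x i + t * of_bool (i = p)) (\<lambda>i. x i + t * of_bool (i = p)) =
    quad n a x x + cnj t * (\<Sum>j<n. a p j * x j) + t * (\<Sum>i<n. cnj (x i) * a i p) + cnj t * t * a p p"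
proof -
  have 1: "(\<Sum>j<n. f j * of_bool (j = p)) = f p" for f :: "nat \<Rightarrow> complex"
    using assms by (simp add: of_bool_def if_distrib cong: if_cong)
  have complex_cnj_of_bool: "cnj (of_bool P) = of_bool P" for P by simp
  have expand: "(\<Sum>j<n. cnj (x i + t * of_bool (i = p)) * a i j * (x j + t * of_bool (j = p))) =
      (\<Sum>j<n. cnj (x i) * a i j * x j) + cnj (x i) * t * (\<Sum>j<n. a i j * of_bool (j = p))
      + (cnj t * (\<Sum>j<n. a i j * x j)) * of_bool (i = p)
      + (cnj t * t * (\<Sum>j<n. a i j * of_bool (j = p))) * of_bool (i = p)" for i
  proof -
    have "(\<Sum>j<n. (X + T * B) * a i j * (x j + t * b j)) =
      (\<Sum>j<n. X * a i j * x j) + X * t * (\<Sum>j<n. a i j * b j)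
      + (T * (\<Sum>j<n. a i j * x j)) * B + (T * t * (\<Sum>j<n. a i j * b j)) * B" for X T B and b :: "nat \<Rightarrow> complex"
      by (simp add: algebra_simps sum.distrib sum_distrib_left)
    from this[of "cnj (x i)" "cnj t" "of_bool (i = p)" "\<lambda>j. of_bool (j = p)"] show ?thesis
      by (simp only: complex_cnj_add complex_cnj_mult complex_cnj_of_bool)
  qed
  have "quad n a (\<lambda>i. x i + t * of_bool (i = p)) (\<lambda>i. x i + t * of_bool (i = p)) =
    (\<Sum>i<n. (\<Sum>j<n. cnj (x i) * a i j * x j) + cnj (x i) * t * (\<Sum>j<n. a i j * of_bool (j = p))
      + (cnj t * (\<Sum>j<n. a i j * x j)) * of_bool (i = p)
      + (cnj t * t * (\<Sum>j<n. a i j * of_bool (j = p))) * of_bool (i = p))"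
    unfolding quad_def
    by (rule sum.cong[OF refl], simp only: expand)
  also have "\<dots> = quad n a x x + (\<Sum>i<n. cnj (x i) * t * a i p) + cnj t * (\<Sum>j<n. a p j * x j) + cnj t * t * a p p"
    unfolding sum.distrib 1 quad_def by simp
  finally show ?thesis by (simp add: sum_distrib_left mult_ac)
qed

lemma psd_kernel_diag:
  assumes "\<And>x. 0 \<le> quad n a x x" "i < n"
  shows "0 \<le> a i i"
proof -
  have "quad n a (\<lambda>_. 0) (\<lambda>_. 0) = 0" by (simp add: quad_def)
  then show ?thesis
    using assms(1)[of "\<lambda>k. 0 + 1 * of_bool (k = i)"] unfolding quad_shift[OF assms(2)] by simp
qed

text \<open>The test vector is e_j + t e_i. The choices t = 1 and t = \<open>\<i>\<close> give
  Hermitian symmetry; t = \<open>- a i j\<close> forces an off-diagonal entry to vanish once both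
  diagonal entries do.\<close>

lemma psd_kernel_two_points:
  assumes "\<And>x. 0 \<le> quad n a x x" "i < n" "j < n"
  shows "0 \<le> a j j + cnj t * a i j + t * a j i + cnj t * t * a i i"
proof -
  have 0: "quad n a (\<lambda>_. 0) (\<lambda>_. 0) = 0" by (simp add: quad_def)
  have 1: "(\<Sum>k<n. f k * of_bool (k = j)) = f j" "(\<Sum>k<n. cnj (of_bool (k = j)) * f k) = f j" for f :: "nat \<Rightarrow> complex"
    using assms(3) by (simp_all add: of_bool_def if_distrib if_distribR cong: if_cong)
  have "quad n a (\<lambda>k. of_bool (k = j)) (\<lambda>k. of_bool (k = j)) = a j j"
    using quad_shift[OF assms(3), of a "\<lambda>_. 0" 1] 0 by simp
  then show ?thesis
    using assms(1)[of "\<lambda>k. of_bool (k = j) + t * of_bool (k = i)"]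
    unfolding quad_shift[OF assms(2)] by (simp add: 1)
qed

lemma psd_kernel_hermitian:
  assumes "\<And>x. 0 \<le> quad n a x x" "i < n" "j < n"
  shows "a j i = cnj (a i j)"
proof -
  note t = psd_kernel_two_points[OF assms]
  have d: "Im (a i i) = 0" "Im (a j j) = 0"
    using psd_kernel_diag[OF assms(1)] assms(2,3) by (auto simp: less_eq_complex_def)
  have "Im (a i j) + Im (a j i) = 0"
    using t[of 1] d by (simp add: less_eq_complex_def)
  moreover have "Re (a j i) = Re (a i j)"
    using t[of \<i>] d by (simp add: less_eq_complex_def)
  ultimately show ?thesis by (simp add: complex_eq_iff)
qed

text \<open>Cholesky elimination: subtracting the rank-one kernel through a nonzero diagonal entry keeps
  the kernel positive semidefinite and kills that entry.\<close>

lemma psd_kernel_rank_one_sum: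
  assumes "\<And>x. 0 \<le> quad n a x x"
  shows "\<exists>m v. \<forall>i<n. \<forall>j<n. a i j = (\<Sum>k<(m::nat). v k i * cnj (v k j))"
  using assms
proof (induction "card {i. i < n \<and> a i i \<noteq> 0}" arbitrary: a rule: less_induct)
  case less
  note psd = less.prems
  show ?case
  proof (cases "\<forall>p<n. a p p = 0")
    case True
    have "a i j = 0" if ij: "i < n" "j < n" for i j
    proof -
      have "0 \<le> - (cnj (a i j) * a i j) - a i j * cnj (a i j)"
        using psd_kernel_two_points[OF psd ij, of "- a i j"] psd_kernel_hermitian[OF psd ij] True ij by simp
      also have "\<dots> = - of_real (2 * (cmod (a i j))\<^sup>2)"
        by (simp add: complex_norm_square mult_ac del: of_real_power)
      finally show ?thesis by (simp add: less_eq_complex_def)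
    qed
    then show ?thesis by (intro exI[of _ 0]) auto
  next
    case False
    then obtain p where p: "p < n" "a p p \<noteq> 0" by blast
    define s where "s = Re (a p p)"
    have s: "a p p = of_real s" "s > 0"
      using psd_kernel_diag[OF psd p(1)] p(2) unfolding s_def less_eq_complex_def
      by (auto simp: complex_eq_iff)
    define a' where "a' i j = a i j - a i p * a p j / a p p" for i j
    have psd': "0 \<le> quad n a' x x" for x
    proof -
      let ?b = "\<Sum>j<n. a p j * x j"
      have cb: "(\<Sum>i<n. cnj (x i) * a i p) = cnj ?b"
        by (auto simp: psd_kernel_hermitian[OF psd p(1)] mult.commute intro!: sum.cong)
      have "quad n a' x x = quad n a x x - (\<Sum>i<n. cnj (x i) * a i p) * ?b / a p p"
        unfolding quad_def a'_def sum_product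
        by (simp add: algebra_simps sum_subtractf sum_divide_distrib diff_divide_distrib)
      \<comment> \<open>Completing the square: the reduced form at \<open>x\<close> is the original
        form at the point obtained by moving coordinate \<open>p\<close> of \<open>x\<close> to the
        minimiser.\<close>
      also have "\<dots> = quad n a (\<lambda>i. x i + (- ?b / a p p) * of_bool (i = p))
                       (\<lambda>i. x i + (- ?b / a p p) * of_bool (i = p))"
        unfolding quad_shift[OF p(1)] cb s(1) using s(2) by (simp add: field_simps)
      finally show ?thesis using psd by simp
    qed
    \<comment> \<open>A diagonal entry that was eliminated cannot reappear: it could only become
      minus a nonnegative number, and positivity of the reduced kernel makes that number 0. Hence
      the number of nonzero diagonal entries drops strictly.\<close>
    have zero: "a' i i = 0" if "i < n" "a i i = 0" for i
    proof -
      have "a' i i = - (cnj (a p i) * a p i / of_real s)"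
        using that psd_kernel_hermitian[OF psd p(1) that(1)] s by (simp add: a'_def)
      also have "\<dots> = - of_real ((cmod (a p i))\<^sup>2 / s)"
        by (simp add: complex_norm_square mult_ac del: of_real_power)
      finally have e: "a' i i = - of_real ((cmod (a p i))\<^sup>2 / s)" .
      with psd_kernel_diag[OF psd' that(1)] have "(cmod (a p i))\<^sup>2 / s \<le> 0"
        by (simp add: less_eq_complex_def)
      then have "(cmod (a p i))\<^sup>2 / s = 0"
        using s(2) by (intro antisym) auto
      with e show ?thesis by simp
    qed
    have "a' p p = 0" using p by (simp add: a'_def)
    then have "{i. i < n \<and> a' i i \<noteq> 0} \<subset> {i. i < n \<and> a i i \<noteq> 0}"
      using zero p by auto
    then have "card {i. i < n \<and> a' i i \<noteq> 0} < card {i. i < n \<and> a i i \<noteq> 0}"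
      by (intro psubset_card_mono) auto
    from less.hyps[OF this psd'] obtain m v
      where v: "\<forall>i<n. \<forall>j<n. a' i j = (\<Sum>k<(m::nat). v k i * cnj (v k j))" by blast
    show ?thesis
    proof (intro exI allI impI)
      fix i j assume ij: "i < n" "j < n"
      let ?u = "\<lambda>i. a i p / of_real (sqrt s)"
      have "?u i * cnj (?u j) = a i p * a p j / (of_real (sqrt s) * of_real (sqrt s))"
        using psd_kernel_hermitian[OF psd ij(2) p(1)] by simp
      also have "complex_of_real (sqrt s) * of_real (sqrt s) = a p p"
        using s by (simp flip: of_real_mult)
      finally have "a i j = a' i j + ?u i * cnj (?u j)" by (simp add: a'_def)
      then show "a i j = (\<Sum>k<Suc m. (v(m := ?u)) k i * cnj ((v(m := ?u)) k j))"
        using v ij by simp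
    qed
  qed
qed

section \<open>Adjoints and traces\<close>

lemma mult_index:
  assumes "A \<in> carrier_mat n m" "B \<in> carrier_mat m p" "i < n" "j < p"
  shows "(A * B) $$ (i, j) = (\<Sum>k<m. A $$ (i, k) * B $$ (k, j))"
  using assms by (simp add: scalar_prod_def lessThan_atLeast0)

lemma dim_mat_adjoint [simp]:
  "dim_row (mat_adjoint A) = dim_col A" "dim_col (mat_adjoint A) = dim_row A"
  by (auto simp: mat_adjoint_def)

lemma mat_adjoint_carrier [simp]:
  "mat_adjoint A \<in> carrier_mat m n \<longleftrightarrow> A \<in> carrier_mat n m"
  unfolding carrier_mat_def by auto

lemma index_mat_adjoint [simp]:
  fixes A :: "complex mat"
  assumes "i < dim_col A" "j < dim_row A"
  shows "mat_adjoint A $$ (i, j) = cnj (A $$ (j, i))"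
  using assms by (simp add: mat_adjoint_def mat_of_rows_def)

lemma mat_adjoint_adjoint [simp]: "mat_adjoint (mat_adjoint A) = (A :: complex mat)"
  by (intro eq_matI) auto

lemma mat_adjoint_one [simp]: "mat_adjoint (1\<^sub>m n :: complex mat) = 1\<^sub>m n"
  by (intro eq_matI) auto

lemma mat_adjoint_mult:
  fixes A B :: "complex mat"
  assumes "A \<in> carrier_mat n m" "B \<in> carrier_mat m p"
  shows "mat_adjoint (A * B) = mat_adjoint B * mat_adjoint A"
proof (rule eq_matI)
  fix i j assume "i < dim_row (mat_adjoint B * mat_adjoint A)" "j < dim_col (mat_adjoint B * mat_adjoint A)"
  then have ij: "i < p" "j < n" using assms by auto
  have "mat_adjoint (A * B) $$ (i, j) = cnj ((A * B) $$ (j, i))"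
    using assms ij by simp
  also have "\<dots> = (\<Sum>k<m. cnj (B $$ (k, i)) * cnj (A $$ (j, k)))"
    by (subst mult_index[OF assms ij(2,1)]) (simp add: mult.commute)
  also have "\<dots> = (mat_adjoint B * mat_adjoint A) $$ (i, j)"
    using assms ij by (subst mult_index[of _ p m _ n]) (auto intro!: sum.cong)
  finally show "mat_adjoint (A * B) $$ (i, j) = (mat_adjoint B * mat_adjoint A) $$ (i, j)" .
qed (use assms in auto)

lemma mat_adjoint_smult: "mat_adjoint (k \<cdot>\<^sub>m A) = cnj k \<cdot>\<^sub>m mat_adjoint A"
  by (intro eq_matI) auto

lemma smult_smult_mat: "a \<cdot>\<^sub>m (b \<cdot>\<^sub>m A) = (a * b :: complex) \<cdot>\<^sub>m A"
  by (intro eq_matI) auto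

lemma mat_trace_mult:
  assumes "A \<in> carrier_mat n m" "B \<in> carrier_mat m n"
  shows "mat_trace (A * B) = (\<Sum>i<n. \<Sum>k<m. A $$ (i, k) * B $$ (k, i))"
  unfolding mat_trace_def using assms
  by (auto intro!: sum.cong simp: mult_index[OF assms] simp del: index_mult_mat(1))

lemma mat_trace_commute:
  assumes "A \<in> carrier_mat n m" "B \<in> carrier_mat m n"
  shows "mat_trace (A * B) = mat_trace (B * A)"
  unfolding mat_trace_mult[OF assms] mat_trace_mult[OF assms(2,1)]
  by (subst sum.swap) (simp add: mult.commute)

lemma mat_trace_smult_one: "mat_trace (k \<cdot>\<^sub>m 1\<^sub>m n) = k * of_nat n"
  by (simp add: mat_trace_def)

lemma mat_trace_adjoint_mult:
  assumes "A \<in> carrier_mat n m"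
  shows "mat_trace (mat_adjoint A * A) = of_real (\<Sum>i<m. \<Sum>k<n. (cmod (A $$ (k, i)))\<^sup>2)"
proof -
  have "mat_trace (mat_adjoint A * A) = (\<Sum>i<m. \<Sum>k<n. cnj (A $$ (k, i)) * A $$ (k, i))"
    using assms by (subst mat_trace_mult[of _ m n]) auto
  also have "\<dots> = of_real (\<Sum>i<m. \<Sum>k<n. (cmod (A $$ (k, i)))\<^sup>2)"
    by (simp add: complex_norm_square mult.commute del: of_real_power)
  finally show ?thesis .
qed

lemma mat_trace_similar:
  assumes "similar_mat_wit A B P Q"
  shows "mat_trace A = mat_trace B"
proof -
  obtain n where "n = dim_row A" by blast
  note w = similar_mat_witD[OF this assms]
  have "mat_trace A = mat_trace (P * (B * Q))"
    unfolding w(3) using w(5-7) by simp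
  also have "\<dots> = mat_trace (B * Q * P)"
    using w(5-7) by (intro mat_trace_commute[of _ n n]) auto
  also have "\<dots> = mat_trace B" using w(2,5-7) by simp
  finally show ?thesis .
qed

lemma sum_lessThan_add:
  fixes f :: "nat \<Rightarrow> 'a::comm_monoid_add"
  shows "(\<Sum>i<n + m. f i) = (\<Sum>i<n. f i) + (\<Sum>i<m. f (n + i))"
  by (induction m) (auto simp: add.assoc)

lemma mat_trace_four_block:
  assumes "A \<in> carrier_mat n n" "D \<in> carrier_mat m m"
  shows "mat_trace (four_block_mat A B C D) = mat_trace A + mat_trace D"
proof -
  have "mat_trace (four_block_mat A B C D) = (\<Sum>i<n + m. if i < n then A $$ (i, i) else D $$ (i - n, i - n))"
    unfolding mat_trace_def using assms by (intro sum.cong) auto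
  also have "\<dots> = (\<Sum>i<n. A $$ (i, i)) + (\<Sum>i<m. D $$ (i, i))"
    unfolding sum_lessThan_add by simp
  finally show ?thesis using assms by (simp add: mat_trace_def)
qed

lemma mat_trace_diag_block:
  assumes "\<And>A. A \<in> set As \<Longrightarrow> square_mat A"
  shows "mat_trace (diag_block_mat As) = sum_list (map mat_trace As)"
  using assms
proof (induction As)
  case Nil
  show ?case by (simp add: mat_trace_def)
next
  case (Cons A As)
  let ?B = "diag_block_mat As"
  have "square_mat ?B" by (rule diag_block_mat_square) (use Cons.prems in auto)
  then have B: "?B \<in> carrier_mat (dim_row ?B) (dim_row ?B)" by (intro carrier_matI) auto
  have A: "A \<in> carrier_mat (dim_row A) (dim_row A)"
    using Cons.prems[of A] by (intro carrier_matI) auto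
  have "mat_trace (diag_block_mat (A # As)) = mat_trace A + mat_trace ?B"
    unfolding diag_block_mat.simps Let_def by (rule mat_trace_four_block[OF A B])
  then show ?case using Cons by simp
qed

lemma unitary_matD:
  assumes "unitary_mat n A"
  shows "A \<in> carrier_mat n n" "A * mat_adjoint A = 1\<^sub>m n" "mat_adjoint A * A = 1\<^sub>m n"
  using assms by (auto simp: unitary_mat_def)

lemma unitary_mat_mult:
  assumes "unitary_mat n A" "unitary_mat n B"
  shows "unitary_mat n (A * B)"
proof -
  note A = unitary_matD[OF assms(1)] and B = unitary_matD[OF assms(2)]
  have "A * B * (mat_adjoint B * mat_adjoint A) = A * (B * mat_adjoint B) * mat_adjoint A"
    using A(1) B(1) by (simp add: assoc_mult_mat[of _ n n _ n _ n])
  also have "\<dots> = 1\<^sub>m n" using A B(2) by simp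
  finally have 1: "A * B * (mat_adjoint B * mat_adjoint A) = 1\<^sub>m n" .
  have "mat_adjoint B * mat_adjoint A * (A * B) = mat_adjoint B * (mat_adjoint A * A) * B"
    using A(1) B(1) by (simp add: assoc_mult_mat[of _ n n _ n _ n])
  also have "\<dots> = 1\<^sub>m n" using A(3) B by simp
  finally have 2: "mat_adjoint B * mat_adjoint A * (A * B) = 1\<^sub>m n" .
  have "A * B \<in> carrier_mat n n" using A(1) B(1) by simp
  with 1 2 show ?thesis
    unfolding unitary_mat_def mat_adjoint_mult[OF A(1) B(1)] by simp
qed

section \<open>Schur's lemma for irreducible projective representations\<close>

lemma subspace_vecI:
  assumes "W \<subseteq> carrier_vec d" "0\<^sub>v d \<in> W" "\<And>v w. v \<in> W \<Longrightarrow> w \<in> W \<Longrightarrow> v + w \<in> W"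
    "\<And>k v. v \<in> W \<Longrightarrow> k \<cdot>\<^sub>v v \<in> W"
  shows "VectorSpace.subspace class_ring W (module_vec TYPE(complex) d)"
  unfolding VectorSpace.subspace_def submodule_def
  using vec_vs[of d, where 'a = complex] assms
  by (auto simp: module_vec_simps vectorspace_def)

lemma subspace_vecD:
  assumes "VectorSpace.subspace class_ring W (module_vec TYPE(complex) d)"
  shows "W \<subseteq> carrier_vec d" "0\<^sub>v d \<in> W" "\<And>v w. v \<in> W \<Longrightarrow> w \<in> W \<Longrightarrow> v + w \<in> W"
    "\<And>k v. v \<in> W \<Longrightarrow> k \<cdot>\<^sub>v v \<in> W"
  using assms unfolding VectorSpace.subspace_def submodule_def
  by (auto simp: module_vec_simps)

text \<open>Representations stay arguments while \<open>c\<close> is fixed, since the proof compares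
  representations of different dimensions with one factor set. The condition that \<open>c\<close>
  has modulus 1 is taken from whichever \<open>proj_rep\<close> is at hand.\<close>

locale factor_system = group G for G :: "('g, 'b) monoid_scheme" (structure) +
  fixes c :: "'g \<Rightarrow> 'g \<Rightarrow> complex"
  assumes finite_carrier: "finite (carrier G)"
begin

abbreviation "ord_G \<equiv> card (carrier G)"

lemma ord_G_pos: "0 < ord_G"
  using finite_carrier one_closed by (auto simp: card_gt_0_iff)

lemma proj_repD:
  assumes "proj_rep G c d V"
  shows "g \<in> carrier G \<Longrightarrow> unitary_mat d (V g)" "g \<in> carrier G \<Longrightarrow> V g \<in> carrier_mat d d"
    "g \<in> carrier G \<Longrightarrow> h \<in> carrier G \<Longrightarrow> V g * V h = c g h \<cdot>\<^sub>m V (g \<otimes> h)"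
    "g \<in> carrier G \<Longrightarrow> h \<in> carrier G \<Longrightarrow> cmod (c g h) = 1"
  using assms by (auto simp: proj_rep_def unitary_mat_def)

lemma rep_dim_eq: "proj_rep G c d V \<Longrightarrow> rep_dim G V = d"
  using proj_repD(2)[of d V \<one>] by (simp add: rep_dim_def)

lemma irreps_proj_rep:
  assumes "V \<in> irreps G c"
  shows "proj_rep G c (rep_dim G V) V" "0 < rep_dim G V"
  using assms rep_dim_eq by (auto simp: irreps_def)

lemma irreps_subspace:
  assumes "V \<in> irreps G c" "VectorSpace.subspace class_ring W (module_vec TYPE(complex) (rep_dim G V))"
    "\<And>g w. g \<in> carrier G \<Longrightarrow> w \<in> W \<Longrightarrow> V g *\<^sub>v w \<in> W"
  shows "W = {0\<^sub>v (rep_dim G V)} \<or> W = carrier_vec (rep_dim G V)"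
proof -
  from assms(1) obtain d where "proj_rep G c d V" and
    *: "\<forall>W. VectorSpace.subspace class_ring W (module_vec TYPE(complex) d) \<longrightarrow>
          (\<forall>g\<in>carrier G. \<forall>w\<in>W. V g *\<^sub>v w \<in> W) \<longrightarrow> W = {0\<^sub>v d} \<or> W = carrier_vec d"
    by (auto simp: irreps_def)
  then have d: "rep_dim G V = d" by (simp add: rep_dim_eq)
  show ?thesis using * assms(2,3) unfolding d by blast
qed

text \<open>An eigenspace of \<open>A\<close> is invariant because \<open>A\<close> commutes with
  the representation. It is nonzero, so irreducibility makes it the whole space. An eigenvalue
  exists because the dimension is positive and the field is algebraically closed.\<close>

lemma schur_scalar:
  assumes V: "V \<in> irreps G c" and A: "A \<in> carrier_mat (rep_dim G V) (rep_dim G V)"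
    and comm: "\<And>g. g \<in> carrier G \<Longrightarrow> A * V g = V g * A"
  shows "\<exists>k. A = k \<cdot>\<^sub>m 1\<^sub>m (rep_dim G V)"
proof -
  let ?d = "rep_dim G V"
  note Vg = proj_repD(2)[OF irreps_proj_rep(1)[OF V]]
  obtain k v where v: "v \<in> carrier_vec ?d" "v \<noteq> 0\<^sub>v ?d" "A *\<^sub>v v = k \<cdot>\<^sub>v v"
    using spectrum_non_empty[OF A] irreps_proj_rep(2)[OF V] A
    by (auto simp: spectrum_def eigenvalue_def eigenvector_def)
  define W where "W = {w \<in> carrier_vec ?d. A *\<^sub>v w = k \<cdot>\<^sub>v w}"
  have sub: "VectorSpace.subspace class_ring W (module_vec TYPE(complex) ?d)"
  proof (rule subspace_vecI)
    show "0\<^sub>v ?d \<in> W" using A by (auto simp: W_def)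
    show "v + w \<in> W" if "v \<in> W" "w \<in> W" for v w
      using that A by (auto simp: W_def mult_add_distrib_mat_vec smult_add_distrib_vec[of _ ?d])
    show "a \<cdot>\<^sub>v w \<in> W" if "w \<in> W" for a w
      using that A by (auto simp: W_def mult_mat_vec smult_smult_assoc mult.commute)
  qed (auto simp: W_def)
  have "V g *\<^sub>v w \<in> W" if g: "g \<in> carrier G" and "w \<in> W" for g w
  proof -
    from that have w: "w \<in> carrier_vec ?d" "A *\<^sub>v w = k \<cdot>\<^sub>v w" by (auto simp: W_def)
    have "A *\<^sub>v (V g *\<^sub>v w) = V g *\<^sub>v (A *\<^sub>v w)"
      using comm[OF g] assoc_mult_mat_vec[OF A Vg[OF g] w(1)] assoc_mult_mat_vec[OF Vg[OF g] A w(1)]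
      by simp
    then show ?thesis using w Vg[OF g] by (auto simp: W_def mult_mat_vec)
  qed
  from irreps_subspace[OF V sub this] v have W: "W = carrier_vec ?d"
    by (auto simp: W_def)
  have "A = k \<cdot>\<^sub>m 1\<^sub>m ?d"
  proof (rule eq_matI)
    fix i j assume "i < dim_row (k \<cdot>\<^sub>m 1\<^sub>m ?d)" "j < dim_col (k \<cdot>\<^sub>m 1\<^sub>m ?d)"
    then have ij: "i < ?d" "j < ?d" by auto
    have "unit_vec ?d j \<in> W" unfolding W by simp
    then have "(A *\<^sub>v unit_vec ?d j) $ i = (k \<cdot>\<^sub>v unit_vec ?d j) $ i" by (simp add: W_def)
    then show "A $$ (i, j) = (k \<cdot>\<^sub>m 1\<^sub>m ?d) $$ (i, j)"
      using ij A by auto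
  qed (use A in auto)
  then show ?thesis by blast
qed

text \<open>Unitarity makes the adjoint of \<open>T\<close> an intertwiner in the opposite
  direction, so both products of \<open>T\<close> with its adjoint commute with an irreducible
  representation and are scalar. Associativity identifies the two scalars, and traces then compare
  the dimensions; kernel and image of \<open>T\<close> need no separate discussion.\<close>

lemma intertwiner_dichotomy:
  assumes V: "V \<in> irreps G c" and W: "W \<in> irreps G c"
    and T: "T \<in> carrier_mat (rep_dim G W) (rep_dim G V)"
    and tw: "\<And>g. g \<in> carrier G \<Longrightarrow> W g * T = T * V g"
  shows "T = 0\<^sub>m (rep_dim G W) (rep_dim G V) \<or> (rep_dim G W = rep_dim G V \<and>
    (\<exists>k>0. mat_adjoint T * T = of_real k \<cdot>\<^sub>m 1\<^sub>m (rep_dim G V) \<and>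
           T * mat_adjoint T = of_real k \<cdot>\<^sub>m 1\<^sub>m (rep_dim G V)))"
proof -
  let ?d = "rep_dim G V" and ?e = "rep_dim G W"
  note Vu = unitary_matD[OF proj_repD(1)[OF irreps_proj_rep(1)[OF V]]]
  note Wu = unitary_matD[OF proj_repD(1)[OF irreps_proj_rep(1)[OF W]]]
  have Ta: "mat_adjoint T \<in> carrier_mat ?d ?e" using T by simp
  have tw': "V g * mat_adjoint T = mat_adjoint T * W g" if g: "g \<in> carrier G" for g
  proof -
    note [simp] = assoc_mult_mat[of _ ?d ?d _ ?e _ ?e] assoc_mult_mat[of _ ?d ?d _ ?d _ ?e]
      assoc_mult_mat[of _ ?d ?e _ ?e _ ?e]
    have "mat_adjoint T * mat_adjoint (W g) = mat_adjoint (V g) * mat_adjoint T"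
      using tw[OF g] mat_adjoint_mult[OF Wu(1)[OF g] T] mat_adjoint_mult[OF T Vu(1)[OF g]] by simp
    note eq = this
    have "V g * mat_adjoint T = V g * (mat_adjoint T * (mat_adjoint (W g) * W g))"
      using Vu(1)[OF g] Wu(1,3)[OF g] T Ta by simp
    also have "\<dots> = V g * (mat_adjoint T * mat_adjoint (W g)) * W g"
      using Vu(1)[OF g] Wu(1)[OF g] Ta by simp
    also have "\<dots> = V g * (mat_adjoint (V g) * mat_adjoint T) * W g" by (simp only: eq)
    also have "\<dots> = (V g * mat_adjoint (V g)) * mat_adjoint T * W g"
      using Vu(1)[OF g] Wu(1)[OF g] Ta by simp
    also have "\<dots> = mat_adjoint T * W g"
      using Vu[OF g] Wu(1)[OF g] T Ta by simp
    finally show ?thesis .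
  qed
  have "\<exists>k. mat_adjoint T * T = k \<cdot>\<^sub>m 1\<^sub>m ?d"
  proof (rule schur_scalar[OF V])
    fix g assume g: "g \<in> carrier G"
    have "mat_adjoint T * T * V g = mat_adjoint T * (T * V g)"
      using T Ta Vu(1)[OF g] by simp
    also have "\<dots> = mat_adjoint T * (W g * T)" by (simp only: tw[OF g])
    also have "\<dots> = mat_adjoint T * W g * T" using T Ta Wu(1)[OF g] by simp
    also have "\<dots> = V g * mat_adjoint T * T" by (simp only: tw'[OF g])
    also have "\<dots> = V g * (mat_adjoint T * T)"
      using T Ta Vu(1)[OF g] by simp
    finally show "mat_adjoint T * T * V g = V g * (mat_adjoint T * T)" .
  qed (use T Ta in auto)
  then obtain a where a: "mat_adjoint T * T = a \<cdot>\<^sub>m 1\<^sub>m ?d" by blast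
  have "\<exists>k. T * mat_adjoint T = k \<cdot>\<^sub>m 1\<^sub>m ?e"
  proof (rule schur_scalar[OF W])
    fix g assume g: "g \<in> carrier G"
    have "T * mat_adjoint T * W g = T * (mat_adjoint T * W g)"
      using T Ta Wu(1)[OF g] by simp
    also have "\<dots> = T * (V g * mat_adjoint T)" by (simp only: tw'[OF g])
    also have "\<dots> = T * V g * mat_adjoint T" using T Ta Vu(1)[OF g] by simp
    also have "\<dots> = W g * T * mat_adjoint T" by (simp only: tw[OF g])
    also have "\<dots> = W g * (T * mat_adjoint T)"
      using T Ta Wu(1)[OF g] by simp
    finally show "T * mat_adjoint T * W g = W g * (T * mat_adjoint T)" .
  qed (use T Ta in auto)
  then obtain b where b: "T * mat_adjoint T = b \<cdot>\<^sub>m 1\<^sub>m ?e" by blast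
  \<comment> \<open>The squared Frobenius norm of \<open>T\<close> is the common trace of the two
    products, hence equal to both \<open>a * ?d\<close> and \<open>b * ?e\<close>.\<close>
  define s where "s = (\<Sum>i<?d. \<Sum>k<?e. (cmod (T $$ (k, i)))\<^sup>2)"
  show ?thesis
  proof (cases "T = 0\<^sub>m ?e ?d")
    case False
    then obtain i j where ij: "i < ?d" "j < ?e" "T $$ (j, i) \<noteq> 0"
      using T by (metis (no_types, lifting) carrier_matD eq_matI index_zero_mat)
    then have "s > 0" unfolding s_def
      by (intro sum_pos2[of _ i] sum_pos2[of _ j] sum_nonneg) auto
    have s1: "of_real s = a * of_nat ?d"
      using mat_trace_adjoint_mult[OF T] unfolding a mat_trace_smult_one s_def by simp
    have s2: "of_real s = b * of_nat ?e"
      using mat_trace_adjoint_mult[OF T] mat_trace_commute[OF Ta T]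
      unfolding b mat_trace_smult_one s_def by simp
    have "T * (mat_adjoint T * T) = T * mat_adjoint T * T" using T Ta by simp
    then have "a \<cdot>\<^sub>m T = b \<cdot>\<^sub>m T"
      unfolding a b using T by (simp add: mult_smult_distrib[of _ ?e ?d _ ?d] mult_smult_assoc_mat[of _ ?e ?e _ ?d])
    then have "(a \<cdot>\<^sub>m T) $$ (j, i) = (b \<cdot>\<^sub>m T) $$ (j, i)" by simp
    then have ab: "a = b" using ij T by simp
    have "a \<noteq> 0" using s1 \<open>s > 0\<close> by auto
    with s1 s2 ab have de: "?d = ?e" by (metis mult_cancel_left of_nat_eq_iff)
    have "?d > 0" by (rule irreps_proj_rep[OF V])
    then have "a = of_real (s / real ?d)" using s1 by (simp add: field_simps)
    with \<open>s > 0\<close> \<open>?d > 0\<close> a b ab de show ?thesis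
      by (intro disjI2 conjI exI[of _ "s / real ?d"]) auto
  qed simp
qed

text \<open>Dividing a nonzero intertwiner by the square root of its scalar \<open>k\<close> makes
  it unitary.\<close>

lemma intertwiner_rep_equiv:
  assumes V: "V \<in> irreps G c" and W: "W \<in> irreps G c"
    and T: "T \<in> carrier_mat (rep_dim G W) (rep_dim G V)"
    and tw: "\<And>g. g \<in> carrier G \<Longrightarrow> W g * T = T * V g"
    and "T \<noteq> 0\<^sub>m (rep_dim G W) (rep_dim G V)"
  shows "\<exists>P. unitary_mat (rep_dim G V) P \<and> rep_dim G W = rep_dim G V \<and>
    (\<forall>g\<in>carrier G. W g = P * V g * mat_adjoint P)"
proof -
  let ?d = "rep_dim G V"
  obtain k where d: "rep_dim G W = ?d" and k: "k > 0"
    "mat_adjoint T * T = of_real k \<cdot>\<^sub>m 1\<^sub>m ?d" "T * mat_adjoint T = of_real k \<cdot>\<^sub>m 1\<^sub>m ?d"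
    using intertwiner_dichotomy[OF V W T tw] assms(5) by blast
  have T: "T \<in> carrier_mat ?d ?d" using T d by simp
  note Vg = proj_repD(2)[OF irreps_proj_rep(1)[OF V]]
  have Wg: "\<And>g. g \<in> carrier G \<Longrightarrow> W g \<in> carrier_mat ?d ?d"
    using proj_repD(2)[OF irreps_proj_rep(1)[OF W]] d by simp
  define P where "P = complex_of_real (1 / sqrt k) \<cdot>\<^sub>m T"
  have P: "P \<in> carrier_mat ?d ?d" using T by (simp add: P_def)
  have kk: "complex_of_real (1 / sqrt k) * (complex_of_real (1 / sqrt k) * complex_of_real k) = 1"
    using k(1) unfolding of_real_mult[symmetric] by (simp add: field_simps)
  have PP: "P * mat_adjoint P = 1\<^sub>m ?d" "mat_adjoint P * P = 1\<^sub>m ?d"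
    using T kk unfolding P_def mat_adjoint_smult
    by (simp_all add: mult_smult_distrib[of _ ?d ?d _ ?d] mult_smult_assoc_mat[of _ ?d ?d _ ?d] k(2,3)
        smult_smult_mat del: of_real_divide)
       (auto intro!: eq_matI)
  have "W g = P * V g * mat_adjoint P" if g: "g \<in> carrier G" for g
  proof -
    have "P * V g = W g * P"
      using tw[OF g] T Vg[OF g] Wg[OF g] unfolding P_def
      by (simp add: mult_smult_distrib[of _ ?d ?d _ ?d] mult_smult_assoc_mat[of _ ?d ?d _ ?d])
    then have "P * V g * mat_adjoint P = W g * (P * mat_adjoint P)"
      using P Wg[OF g] by (simp add: assoc_mult_mat[of _ ?d ?d _ ?d _ ?d])
    then show ?thesis using PP Wg[OF g] by simp
  qed
  moreover have "unitary_mat ?d P" using P PP unfolding unitary_mat_def by blast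
  ultimately show ?thesis using d by blast
qed


lemma rep_equivI_unitary:
  assumes "unitary_mat d P" "\<And>g. g \<in> carrier G \<Longrightarrow> V g \<in> carrier_mat d d"
    "\<And>g. g \<in> carrier G \<Longrightarrow> W g = P * V g * mat_adjoint P"
  shows "rep_equiv G W V"
  unfolding rep_equiv_def
proof (intro exI ballI)
  note P = unitary_matD[OF assms(1)]
  fix g assume g: "g \<in> carrier G"
  show "similar_mat_wit (W g) (V g) P (mat_adjoint P)"
    by (rule similar_mat_witI[OF P(2,3) assms(3)[OF g] _ assms(2)[OF g] P(1)])
      (use P(1) assms(2)[OF g] assms(3)[OF g] in simp_all)
qed

text \<open>\<open>rep_equiv\<close> allows any invertible matrix, whereas norms and positivity
  survive only a unitary change of basis. The given similarity matrix is a nonzero intertwiner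
  between irreducibles, so a rescaled copy of it is unitary.\<close>

lemma rep_equiv_imp_unitary:
  assumes V: "V \<in> irreps G c" and W: "W \<in> irreps G c" and eq: "rep_equiv G W V"
  shows "\<exists>P. unitary_mat (rep_dim G V) P \<and> rep_dim G W = rep_dim G V \<and>
    (\<forall>g\<in>carrier G. W g = P * V g * mat_adjoint P)"
proof -
  obtain P Q where w: "\<And>g. g \<in> carrier G \<Longrightarrow> similar_mat_wit (W g) (V g) P Q"
    using eq by (auto simp: rep_equiv_def)
  let ?d = "rep_dim G V"
  note Vg = proj_repD(2)[OF irreps_proj_rep(1)[OF V]]
  have d: "rep_dim G W = ?d"
    using similar_mat_witD(5)[OF refl w[OF one_closed]] Vg[OF one_closed] by (auto simp: rep_dim_def)
  note Wg = proj_repD(2)[OF irreps_proj_rep(1)[OF W], unfolded d]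
  note w2 = similar_mat_witD2[OF Wg w]
  have P: "P \<in> carrier_mat ?d ?d" "Q \<in> carrier_mat ?d ?d" "P * Q = 1\<^sub>m ?d" "Q * P = 1\<^sub>m ?d"
    using w2[OF one_closed one_closed] by auto
  have "W g * P = P * V g" if g: "g \<in> carrier G" for g
  proof -
    have "W g * P = P * V g * (Q * P)"
      using w2(3)[OF g g] P(1,2) Vg[OF g] by (simp add: assoc_mult_mat[of _ ?d ?d _ ?d _ ?d])
    then show ?thesis using P Vg[OF g] by simp
  qed
  moreover have "P \<noteq> 0\<^sub>m ?d ?d"
  proof
    assume "P = 0\<^sub>m ?d ?d"
    then have "1\<^sub>m ?d $$ (0, 0) = (0\<^sub>m ?d ?d :: complex mat) $$ (0, 0)" using P by auto
    then show False using irreps_proj_rep(2)[OF V] by simp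
  qed
  ultimately show ?thesis
    using intertwiner_rep_equiv[OF V W, of P] P d by simp
qed

section \<open>Group averages and Schur orthogonality\<close>

lemma sum_left_translate:
  assumes "h \<in> carrier G"
  shows "(\<Sum>g\<in>carrier G. f (h \<otimes> g)) = (\<Sum>g\<in>carrier G. f g)"
  by (rule sum.reindex_bij_betw) (simp add: bij_betw_def inj_on_cmult surj_const_mult assms)

lemma sum_right_translate:
  assumes "h \<in> carrier G"
  shows "(\<Sum>g\<in>carrier G. f (g \<otimes> h)) = (\<Sum>g\<in>carrier G. f g)"
  by (rule sum.reindex_bij_betw, rule bij_betw_byWitness[of _ "\<lambda>g. g \<otimes> inv h"])
    (auto simp: m_assoc assms)

text \<open>The sum over g of W_g E V_g^*, where E is the matrix unit with its 1 at position (j, l).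
  Its entries are exactly the sums that the orthogonality relations evaluate.\<close>

definition averaged :: "('g \<Rightarrow> complex mat) \<Rightarrow> ('g \<Rightarrow> complex mat) \<Rightarrow> nat \<Rightarrow> nat \<Rightarrow> complex mat" where
  "averaged W V j l = mat (rep_dim G W) (rep_dim G V)
     (\<lambda>(i, k). \<Sum>g\<in>carrier G. W g $$ (i, j) * cnj (V g $$ (k, l)))"

text \<open>Conjugation by \<open>h\<close> only translates the summation variable: the phase
  \<open>c h g\<close> produced by \<open>W\<close> meets the conjugate phase produced by
  \<open>V\<close>, and the two cancel because both representations have the factor set
  \<open>c\<close>.\<close>

lemma averaged_intertwines:
  assumes V: "V \<in> irreps G c" and W: "W \<in> irreps G c"
    and jl: "j < rep_dim G W" "l < rep_dim G V" and h: "h \<in> carrier G"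
  shows "W h * averaged W V j l = averaged W V j l * V h"
proof -
  let ?d = "rep_dim G V" and ?e = "rep_dim G W" and ?T = "averaged W V j l"
  note Vp = irreps_proj_rep(1)[OF V] and Wp = irreps_proj_rep(1)[OF W]
  note Vu = unitary_matD[OF proj_repD(1)[OF Vp]] and Wu = unitary_matD[OF proj_repD(1)[OF Wp]]
  have T: "?T \<in> carrier_mat ?e ?d" by (simp add: averaged_def)
  have fixed: "W h * ?T * mat_adjoint (V h) = ?T"
  proof (rule eq_matI)
    fix i k assume "i < dim_row ?T" "k < dim_col ?T"
    then have ik: "i < ?e" "k < ?d" using T by auto
    have "(W h * ?T * mat_adjoint (V h)) $$ (i, k) = (\<Sum>b<?d. (W h * ?T) $$ (i, b) * mat_adjoint (V h) $$ (b, k))"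
      using T Wu(1)[OF h] Vu(1)[OF h] ik by (intro mult_index[of _ ?e ?d _ ?d]) simp_all
    also have "\<dots> = (\<Sum>b<?d. (\<Sum>a<?e. W h $$ (i, a) * ?T $$ (a, b)) * cnj (V h $$ (k, b)))"
    proof (intro sum.cong refl)
      fix b assume b: "b \<in> {..<?d}"
      then have "(W h * ?T) $$ (i, b) = (\<Sum>a<?e. W h $$ (i, a) * ?T $$ (a, b))"
        using T Wu(1)[OF h] ik by (intro mult_index[of _ ?e ?e _ ?d]) simp_all
      then show "(W h * ?T) $$ (i, b) * mat_adjoint (V h) $$ (b, k) =
          (\<Sum>a<?e. W h $$ (i, a) * ?T $$ (a, b)) * cnj (V h $$ (k, b))"
        using b ik Vu(1)[OF h] by simp
    qed
    also have "\<dots> = (\<Sum>b<?d. \<Sum>a<?e. \<Sum>g\<in>carrier G.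
        (W h $$ (i, a) * W g $$ (a, j)) * cnj (V h $$ (k, b) * V g $$ (b, l)))"
      unfolding sum_distrib_right
      by (intro sum.cong refl) (simp add: averaged_def sum_distrib_left sum_distrib_right mult_ac)
    also have "\<dots> = (\<Sum>b<?d. \<Sum>g\<in>carrier G. \<Sum>a<?e.
        (W h $$ (i, a) * W g $$ (a, j)) * cnj (V h $$ (k, b) * V g $$ (b, l)))"
      by (intro sum.cong refl sum.swap)
    also have "\<dots> = (\<Sum>g\<in>carrier G. \<Sum>b<?d. \<Sum>a<?e.
        (W h $$ (i, a) * W g $$ (a, j)) * cnj (V h $$ (k, b) * V g $$ (b, l)))"
      by (rule sum.swap)
    also have "\<dots> = (\<Sum>g\<in>carrier G. (W h * W g) $$ (i, j) * cnj ((V h * V g) $$ (k, l)))"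
    proof (intro sum.cong refl)
      fix g assume g: "g \<in> carrier G"
      show "(\<Sum>b<?d. \<Sum>a<?e. (W h $$ (i, a) * W g $$ (a, j)) * cnj (V h $$ (k, b) * V g $$ (b, l))) =
          (W h * W g) $$ (i, j) * cnj ((V h * V g) $$ (k, l))"
        unfolding mult_index[OF Wu(1)[OF h] Wu(1)[OF g] ik(1) jl(1)]
          mult_index[OF Vu(1)[OF h] Vu(1)[OF g] ik(2) jl(2)] cnj_sum sum_product
        by (rule sum.swap)
    qed
    also have "\<dots> = (\<Sum>g\<in>carrier G. W (h \<otimes> g) $$ (i, j) * cnj (V (h \<otimes> g) $$ (k, l)))"
    proof (intro sum.cong refl)
      fix g assume g: "g \<in> carrier G"
      have "c h g * cnj (c h g) = 1"
        using proj_repD(4)[OF Vp h g] by (simp flip: complex_norm_square)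
      then show "(W h * W g) $$ (i, j) * cnj ((V h * V g) $$ (k, l)) =
          W (h \<otimes> g) $$ (i, j) * cnj (V (h \<otimes> g) $$ (k, l))"
        unfolding proj_repD(3)[OF Wp h g] proj_repD(3)[OF Vp h g]
        using ik jl carrier_matD[OF Wu(1)[OF m_closed[OF h g]]] carrier_matD[OF Vu(1)[OF m_closed[OF h g]]]
        by simp
    qed
    also have "\<dots> = (\<Sum>g\<in>carrier G. W g $$ (i, j) * cnj (V g $$ (k, l)))"
      by (rule sum_left_translate[OF h])
    finally show "(W h * ?T * mat_adjoint (V h)) $$ (i, k) = ?T $$ (i, k)"
      using ik by (simp add: averaged_def)
  qed (use T Wu(1)[OF h] Vu(1)[OF h] in auto)
  have "?T * V h = W h * ?T * (mat_adjoint (V h) * V h)"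
    using T Wu(1)[OF h] Vu(1)[OF h]
    by (subst (1) fixed[symmetric]) (simp add: assoc_mult_mat[of "W h * ?T" ?e ?d _ ?d _ ?d] del: assoc_mult_mat)
  then show ?thesis using Vu(3)[OF h] T Wu(1)[OF h] by simp
qed

lemma schur_orthogonality_inequivalent:
  assumes V: "V \<in> irreps G c" and W: "W \<in> irreps G c" and "\<not> rep_equiv G W V"
    and ijkl: "i < rep_dim G W" "j < rep_dim G W" "k < rep_dim G V" "l < rep_dim G V"
  shows "(\<Sum>g\<in>carrier G. W g $$ (i, j) * cnj (V g $$ (k, l))) = 0"
proof -
  let ?T = "averaged W V j l"
  have "?T = 0\<^sub>m (rep_dim G W) (rep_dim G V)"
  proof (rule ccontr)
    assume "?T \<noteq> 0\<^sub>m (rep_dim G W) (rep_dim G V)"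
    then obtain P where "unitary_mat (rep_dim G V) P" "\<forall>g\<in>carrier G. W g = P * V g * mat_adjoint P"
      using intertwiner_rep_equiv[OF V W, of ?T] averaged_intertwines[OF V W ijkl(2,4)]
      by (auto simp: averaged_def)
    then have "rep_equiv G W V"
      using proj_repD(2)[OF irreps_proj_rep(1)[OF V]] by (intro rep_equivI_unitary) auto
    with assms(3) show False by simp
  qed
  then have "?T $$ (i, k) = 0" using ijkl by simp
  then show ?thesis using ijkl by (simp add: averaged_def)
qed

text \<open>The constant comes from a trace: the averaged matrix is a scalar \<open>s\<close>, while
  unitarity of each \<open>V g\<close> makes its trace |G| for \<open>j = l\<close> and 0 otherwise,
  so \<open>s\<close> is |G| / d or 0.\<close>

lemma schur_orthogonality:
  assumes V: "V \<in> irreps G c"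
    and ijkl: "i < rep_dim G V" "j < rep_dim G V" "k < rep_dim G V" "l < rep_dim G V"
  shows "(\<Sum>g\<in>carrier G. V g $$ (i, j) * cnj (V g $$ (k, l))) =
    (if i = k \<and> j = l then of_real (real ord_G / real (rep_dim G V)) else 0)"
proof -
  let ?T = "averaged V V j l" and ?d = "rep_dim G V"
  note Vu = unitary_matD[OF proj_repD(1)[OF irreps_proj_rep(1)[OF V]]]
  have "\<exists>s. ?T = s \<cdot>\<^sub>m 1\<^sub>m ?d"
    by (intro schur_scalar[OF V] averaged_intertwines[OF V V ijkl(2,4), symmetric])
      (simp_all add: averaged_def)
  then obtain s where s: "?T = s \<cdot>\<^sub>m 1\<^sub>m ?d" by blast
  have "s * of_nat ?d = mat_trace ?T" by (simp add: s mat_trace_smult_one)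
  also have "\<dots> = (\<Sum>g\<in>carrier G. \<Sum>a<?d. V g $$ (a, j) * cnj (V g $$ (a, l)))"
    by (simp add: mat_trace_def averaged_def sum.swap[of _ "carrier G"])
  also have "\<dots> = (\<Sum>g\<in>carrier G. (mat_adjoint (V g) * V g) $$ (l, j))"
  proof (intro sum.cong refl)
    fix g assume g: "g \<in> carrier G"
    show "(\<Sum>a<?d. V g $$ (a, j) * cnj (V g $$ (a, l))) = (mat_adjoint (V g) * V g) $$ (l, j)"
      using Vu(1)[OF g] ijkl by (subst mult_index[of _ ?d ?d _ ?d]) (auto simp: mult.commute)
  qed
  also have "\<dots> = (\<Sum>g\<in>carrier G. of_bool (j = l))"
    using ijkl by (intro sum.cong refl) (simp add: Vu(3))
  also have "\<dots> = of_nat ord_G * of_bool (j = l)" by simp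
  finally have "s = of_nat ord_G * of_bool (j = l) / of_nat ?d"
    using irreps_proj_rep(2)[OF V] by (simp add: field_simps)
  moreover have "(\<Sum>g\<in>carrier G. V g $$ (i, j) * cnj (V g $$ (k, l))) = ?T $$ (i, k)"
    using ijkl by (simp add: averaged_def)
  ultimately show ?thesis
    using ijkl by (auto simp: s)
qed

end

section \<open>Decomposition into irreducible representations\<close>

text \<open>Irreducibility is defined through subspaces, but the decomposition works with matrices.
  This is the passage between them: the columns of \<open>B\<close> are an orthonormal basis of
  \<open>W\<close>, and the zero subspace appears as \<open>e = 0\<close>.\<close>

lemma subspace_isometry:
  assumes "VectorSpace.subspace class_ring W (module_vec TYPE(complex) d)"
  shows "\<exists>e B. B \<in> carrier_mat d e \<and> mat_adjoint B * B = 1\<^sub>m e \<and> W = (\<lambda>v. B *\<^sub>v v) ` carrier_vec e"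
proof -
  note W = subspace_vecD[OF assms]
  \<comment> \<open>Vectors become functions on the naturals of which only the first
    \<open>d\<close> values matter, so that orthonormal completion inside \<open>S\<close>
    applies.\<close>
  define S where "S = {x. vec d x \<in> W}"
  have add: "(\<lambda>i. x i + y i) \<in> S" if "x \<in> S" "y \<in> S" for x y
  proof -
    have "vec d x + vec d y = vec d (\<lambda>i. x i + y i)" by auto
    then show ?thesis using W(3)[of "vec d x" "vec d y"] that by (simp add: S_def)
  qed
  have smult: "(\<lambda>i. k * x i) \<in> S" if "x \<in> S" for x k
  proof -
    have "k \<cdot>\<^sub>v vec d x = vec d (\<lambda>i. k * x i)" by auto
    then show ?thesis using W(4)[of "vec d x" k] that by (simp add: S_def)
  qed
  have zero: "(\<lambda>_. 0) \<in> S"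
  proof -
    have "0\<^sub>v d = vec d (\<lambda>_. 0 :: complex)" by auto
    then show ?thesis using W(2) by (simp add: S_def)
  qed
  have "orthonormal_on {..<d} {..<0::nat} (\<lambda>_ _. 0)" by (simp add: orthonormal_on_def)
  from orthonormal_complete[OF finite_lessThan this _ add smult zero]
  obtain e and q :: "nat \<Rightarrow> nat \<Rightarrow> complex" where *: "orthonormal_on {..<d} {..<e} q" "\<forall>l<e. q l \<in> S"
    "\<forall>x\<in>S. \<forall>i\<in>{..<d}. x i = (\<Sum>l<e. inner_on {..<d} x (q l) * q l i)" by blast
  then have q: "orthonormal_on {..<d} {..<e} q" "\<And>l. l < e \<Longrightarrow> q l \<in> S"
    and ex: "\<And>x i. x \<in> S \<Longrightarrow> i < d \<Longrightarrow> x i = (\<Sum>l<e. inner_on {..<d} x (q l) * q l i)" by blast+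
  define B where "B = mat d e (\<lambda>(i, l). q l i)"
  have B: "B \<in> carrier_mat d e" by (simp add: B_def)
  have BB: "mat_adjoint B * B = 1\<^sub>m e"
  proof (rule eq_matI)
    fix k l assume "k < dim_row (1\<^sub>m e :: complex mat)" "l < dim_col (1\<^sub>m e :: complex mat)"
    then have kl: "k < e" "l < e" by auto
    have "(mat_adjoint B * B) $$ (k, l) = (\<Sum>i<d. mat_adjoint B $$ (k, i) * B $$ (i, l))"
      using kl B by (intro mult_index[of _ e d _ e]) simp_all
    also have "\<dots> = inner_on {..<d} (q l) (q k)"
      unfolding inner_on_def using kl by (intro sum.cong refl) (simp add: B_def mult.commute)
    also have "\<dots> = 1\<^sub>m e $$ (k, l)"
      using orthonormal_onD[OF q(1), of l k] kl by simp
    finally show "(mat_adjoint B * B) $$ (k, l) = 1\<^sub>m e $$ (k, l)" .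
  qed (use B in simp_all)
  have lin: "(\<lambda>i. \<Sum>l<k. v l * q l i) \<in> S" if "k \<le> e" for k and v :: "nat \<Rightarrow> complex"
    using that
  proof (induction k)
    case 0
    then show ?case using zero by simp
  next
    case (Suc k)
    then show ?case using add[OF _ smult[OF q(2)[of k]], of _ "v k"] by simp
  qed
  have Bv: "B *\<^sub>v v = vec d (\<lambda>i. \<Sum>l<e. v $ l * q l i)" if "v \<in> carrier_vec e" for v
    using that by (intro eq_vecI)
      (auto simp: B_def scalar_prod_def lessThan_atLeast0 mult.commute intro!: sum.cong)
  have "W = (\<lambda>v. B *\<^sub>v v) ` carrier_vec e"
  proof (intro equalityI subsetI)
    fix w assume w: "w \<in> W"
    then have wc: "w \<in> carrier_vec d" using W(1) by auto
    let ?v = "vec e (\<lambda>l. inner_on {..<d} (\<lambda>i. w $ i) (q l))"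
    have "vec d (\<lambda>i. w $ i) = w" using wc by auto
    then have "(\<lambda>i. w $ i) \<in> S" using w by (simp add: S_def)
    note e = ex[OF this]
    have "B *\<^sub>v ?v = w"
    proof (rule eq_vecI)
      fix i assume "i < dim_vec w"
      then have i: "i < d" using wc by simp
      then have "(B *\<^sub>v ?v) $ i = (\<Sum>l<e. inner_on {..<d} (\<lambda>i. w $ i) (q l) * q l i)"
        by (simp add: Bv)
      also have "\<dots> = w $ i" by (rule e[OF i, symmetric])
      finally show "(B *\<^sub>v ?v) $ i = w $ i" .
    qed (use wc B in simp)
    then have "w = B *\<^sub>v ?v" by simp
    then show "w \<in> (\<lambda>v. B *\<^sub>v v) ` carrier_vec e" by (rule image_eqI) simp
  next
    fix w assume "w \<in> (\<lambda>v. B *\<^sub>v v) ` carrier_vec e"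
    then obtain v where v: "v \<in> carrier_vec e" "w = B *\<^sub>v v" by blast
    then show "w \<in> W" using lin[of e "\<lambda>l. v $ l"] by (simp add: Bv S_def)
  qed
  with B BB show ?thesis by (intro exI[of _ e] exI[of _ B] conjI)
qed

lemma isometry_columns_orthonormal:
  fixes B :: "complex mat"
  assumes "B \<in> carrier_mat n d" "mat_adjoint B * B = 1\<^sub>m d"
  shows "orthonormal_on {..<n} {..<d} (\<lambda>l i. B $$ (i, l))"
  unfolding orthonormal_on_def
proof (intro ballI)
  fix k l assume "k \<in> {..<d}" "l \<in> {..<d}"
  then have kl: "k < d" "l < d" by auto
  have "(mat_adjoint B * B) $$ (l, k) = (\<Sum>i<n. mat_adjoint B $$ (l, i) * B $$ (i, k))"
    using kl assms(1) by (intro mult_index[of _ d n _ d]) simp_all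
  also have "\<dots> = inner_on {..<n} (\<lambda>i. B $$ (i, k)) (\<lambda>i. B $$ (i, l))"
    unfolding inner_on_def using kl assms(1) by (intro sum.cong refl) (simp add: mult.commute)
  finally have "inner_on {..<n} (\<lambda>i. B $$ (i, k)) (\<lambda>i. B $$ (i, l)) = 1\<^sub>m d $$ (l, k)"
    by (simp only: assms(2))
  then show "inner_on {..<n} (\<lambda>i. B $$ (i, k)) (\<lambda>i. B $$ (i, l)) = of_bool (k = l)"
    using kl by simp
qed

lemma isometry_dim_le:
  fixes B :: "complex mat"
  assumes "B \<in> carrier_mat n d" "mat_adjoint B * B = 1\<^sub>m d"
  shows "d \<le> n"
  using orthonormal_card_le[OF _ _ isometry_columns_orthonormal[OF assms]] by simp

lemma isometry_completion:
  fixes B :: "complex mat"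
  assumes "B \<in> carrier_mat n d" "mat_adjoint B * B = 1\<^sub>m d"
  shows "\<exists>Q. unitary_mat n Q \<and> (\<forall>i<n. \<forall>j<d. Q $$ (i, j) = B $$ (i, j))"
proof -
  obtain e q where q: "\<And>l. l < d \<Longrightarrow> q l = (\<lambda>i. B $$ (i, l))" "orthonormal_on {..<n} {..<e} q" "d \<le> e"
    and ex: "\<And>x i. i < n \<Longrightarrow> x i = (\<Sum>l<e. inner_on {..<n} x (q l) * q l i)"
  proof -
    obtain e and q :: "nat \<Rightarrow> nat \<Rightarrow> complex" where *: "d \<le> e" "\<forall>l<d. q l = (\<lambda>i. B $$ (i, l))"
      "orthonormal_on {..<n} {..<e} q"
      "\<forall>x\<in>UNIV. \<forall>i\<in>{..<n}. x i = (\<Sum>l<e. inner_on {..<n} x (q l) * q l i)"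
      using orthonormal_complete[OF finite_lessThan isometry_columns_orthonormal[OF assms], of UNIV] by blast
    show thesis by (rule that[of q e]) (use * in blast)+
  qed
  have "e = n" using complete_orthonormal_card[OF _ _ q(2) ex] by simp
  define Q where "Q = mat n n (\<lambda>(i, l). q l i)"
  have Q: "Q \<in> carrier_mat n n" by (simp add: Q_def)
  have QQ: "mat_adjoint Q * Q = 1\<^sub>m n"
  proof (rule eq_matI)
    fix k l assume "k < dim_row (1\<^sub>m n :: complex mat)" "l < dim_col (1\<^sub>m n :: complex mat)"
    then have kl: "k < n" "l < n" by auto
    have "(mat_adjoint Q * Q) $$ (k, l) = (\<Sum>i<n. mat_adjoint Q $$ (k, i) * Q $$ (i, l))"
      using kl Q by (intro mult_index[of _ n n _ n]) simp_all
    also have "\<dots> = inner_on {..<n} (q l) (q k)"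
      unfolding inner_on_def using kl by (intro sum.cong refl) (simp add: Q_def mult.commute)
    also have "\<dots> = 1\<^sub>m n $$ (k, l)"
      using orthonormal_onD[OF q(2), of l k] kl \<open>e = n\<close> by simp
    finally show "(mat_adjoint Q * Q) $$ (k, l) = 1\<^sub>m n $$ (k, l)" .
  qed (use Q in simp_all)
  have "Q * mat_adjoint Q = 1\<^sub>m n"
    using Q by (intro mat_mult_left_right_inverse[OF _ Q QQ]) simp
  then have "unitary_mat n Q" using Q QQ by (simp add: unitary_mat_def)
  moreover have "\<forall>i<n. \<forall>j<d. Q $$ (i, j) = B $$ (i, j)"
    using q(1,3) \<open>e = n\<close> by (auto simp: Q_def)
  ultimately show ?thesis by (intro exI[of _ Q] conjI)
qed

section \<open>Block-diagonal matrices\<close>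

definition upper_block :: "nat \<Rightarrow> complex mat \<Rightarrow> complex mat" where
  "upper_block d A = mat d d (\<lambda>(i, j). A $$ (i, j))"

definition lower_block :: "nat \<Rightarrow> nat \<Rightarrow> complex mat \<Rightarrow> complex mat" where
  "lower_block d e A = mat e e (\<lambda>(i, j). A $$ (d + i, d + j))"

definition block_diagonal :: "nat \<Rightarrow> nat \<Rightarrow> complex mat \<Rightarrow> bool" where
  "block_diagonal d e A \<longleftrightarrow> A \<in> carrier_mat (d + e) (d + e) \<and>
     (\<forall>i<d. \<forall>j<e. A $$ (i, d + j) = 0 \<and> A $$ (d + j, i) = 0)"

lemma block_carrier [simp]:
  "upper_block d A \<in> carrier_mat d d" "lower_block d e A \<in> carrier_mat e e"
  by (simp_all add: upper_block_def lower_block_def)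

lemma block_diagonal_mult:
  assumes "block_diagonal d e A" "block_diagonal d e B"
  shows "upper_block d (A * B) = upper_block d A * upper_block d B"
    "lower_block d e (A * B) = lower_block d e A * lower_block d e B"
proof -
  have A: "A \<in> carrier_mat (d + e) (d + e)" and B: "B \<in> carrier_mat (d + e) (d + e)"
    using assms by (auto simp: block_diagonal_def)
  show "upper_block d (A * B) = upper_block d A * upper_block d B"
  proof (rule eq_matI)
    fix i j assume "i < dim_row (upper_block d A * upper_block d B)" "j < dim_col (upper_block d A * upper_block d B)"
    then have ij: "i < d" "j < d" by (auto simp: upper_block_def)
    have "upper_block d (A * B) $$ (i, j) = (\<Sum>k<d + e. A $$ (i, k) * B $$ (k, j))"
      using ij mult_index[OF A B, of i j] by (simp add: upper_block_def)
    also have "\<dots> = (\<Sum>k<d. A $$ (i, k) * B $$ (k, j))"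
      unfolding sum_lessThan_add using assms ij by (simp add: block_diagonal_def)
    also have "\<dots> = (upper_block d A * upper_block d B) $$ (i, j)"
      using ij by (subst mult_index[of _ d d _ d]) (auto simp: upper_block_def)
    finally show "upper_block d (A * B) $$ (i, j) = (upper_block d A * upper_block d B) $$ (i, j)" .
  qed (auto simp: upper_block_def)
  show "lower_block d e (A * B) = lower_block d e A * lower_block d e B"
  proof (rule eq_matI)
    fix i j assume "i < dim_row (lower_block d e A * lower_block d e B)" "j < dim_col (lower_block d e A * lower_block d e B)"
    then have ij: "i < e" "j < e" by (auto simp: lower_block_def)
    have "lower_block d e (A * B) $$ (i, j) = (\<Sum>k<d + e. A $$ (d + i, k) * B $$ (k, d + j))"
      using ij mult_index[OF A B, of "d + i" "d + j"] by (simp add: lower_block_def)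
    also have "\<dots> = (\<Sum>k<e. A $$ (d + i, d + k) * B $$ (d + k, d + j))"
      unfolding sum_lessThan_add using assms ij by (simp add: block_diagonal_def)
    also have "\<dots> = (lower_block d e A * lower_block d e B) $$ (i, j)"
      using ij by (subst mult_index[of _ e e _ e]) (auto simp: lower_block_def)
    finally show "lower_block d e (A * B) $$ (i, j) = (lower_block d e A * lower_block d e B) $$ (i, j)" .
  qed (auto simp: lower_block_def)
qed

lemma block_diagonal_adjoint:
  assumes "block_diagonal d e A"
  shows "block_diagonal d e (mat_adjoint A)"
    "upper_block d (mat_adjoint A) = mat_adjoint (upper_block d A)"
    "lower_block d e (mat_adjoint A) = mat_adjoint (lower_block d e A)"
  using assms by (auto simp: block_diagonal_def upper_block_def lower_block_def intro!: eq_matI)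

lemma block_one: "upper_block d (1\<^sub>m (d + e)) = 1\<^sub>m d" "lower_block d e (1\<^sub>m (d + e)) = 1\<^sub>m e"
  by (auto simp: upper_block_def lower_block_def intro!: eq_matI)

lemma block_smult:
  assumes "A \<in> carrier_mat (d + e) (d + e)"
  shows "upper_block d (k \<cdot>\<^sub>m A) = k \<cdot>\<^sub>m upper_block d A"
    "lower_block d e (k \<cdot>\<^sub>m A) = k \<cdot>\<^sub>m lower_block d e A"
  using assms by (auto simp: upper_block_def lower_block_def intro!: eq_matI)

lemma block_diagonal_four_block:
  assumes "block_diagonal d e A"
  shows "A = four_block_mat (upper_block d A) (0\<^sub>m d e) (0\<^sub>m e d) (lower_block d e A)"
proof (rule eq_matI)
  fix i j
  assume "i < dim_row (four_block_mat (upper_block d A) (0\<^sub>m d e) (0\<^sub>m e d) (lower_block d e A))"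
    "j < dim_col (four_block_mat (upper_block d A) (0\<^sub>m d e) (0\<^sub>m e d) (lower_block d e A))"
  then have ij: "i < d + e" "j < d + e" by (auto simp: upper_block_def lower_block_def)
  have z: "\<And>i j. i < d \<Longrightarrow> j < e \<Longrightarrow> A $$ (i, d + j) = 0 \<and> A $$ (d + j, i) = 0"
    using assms by (auto simp: block_diagonal_def)
  show "A $$ (i, j) = four_block_mat (upper_block d A) (0\<^sub>m d e) (0\<^sub>m e d) (lower_block d e A) $$ (i, j)"
    using ij z[of i "j - d"] z[of j "i - d"]
    by (cases "i < d"; cases "j < d") (auto simp: upper_block_def lower_block_def)
qed (use assms in \<open>auto simp: block_diagonal_def upper_block_def lower_block_def\<close>)

lemma block_diagonal_unitary:
  assumes "block_diagonal d e A" "unitary_mat (d + e) A"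
  shows "unitary_mat d (upper_block d A)" "unitary_mat e (lower_block d e A)"
  using unitary_matD[OF assms(2)] block_diagonal_mult[OF assms(1) block_diagonal_adjoint(1)[OF assms(1)]]
    block_diagonal_mult[OF block_diagonal_adjoint(1)[OF assms(1)] assms(1)]
  by (simp_all add: unitary_mat_def block_diagonal_adjoint[OF assms(1)] block_one)

context factor_system
begin

section \<open>Invariant subspaces and complete reducibility\<close>

text \<open>The identity element is represented by the scalar \<open>c \<one> \<one>\<close>, so an
  inverse is represented by the adjoint only up to a factor. The factor is left unspecified because
  it is used only to carry over vanishing entries.\<close>

lemma proj_rep_inv:
  assumes "proj_rep G c n U" "g \<in> carrier G"
  shows "\<exists>k. U (inv g) = k \<cdot>\<^sub>m mat_adjoint (U g)"
proof -
  note u = unitary_matD[OF proj_repD(1)[OF assms(1)]]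
  have g': "inv g \<in> carrier G" using assms(2) by simp
  have one: "U \<one> = c \<one> \<one> \<cdot>\<^sub>m 1\<^sub>m n"
  proof -
    have "U \<one> = U \<one> * U \<one> * mat_adjoint (U \<one>)"
      using u[OF one_closed] by simp
    also have "\<dots> = c \<one> \<one> \<cdot>\<^sub>m U \<one> * mat_adjoint (U \<one>)"
      using proj_repD(3)[OF assms(1) one_closed one_closed] by simp
    also have "\<dots> = c \<one> \<one> \<cdot>\<^sub>m 1\<^sub>m n"
      using u(1,2)[OF one_closed] by (simp add: mult_smult_assoc_mat[of _ n n _ n])
    finally show ?thesis .
  qed
  have gg: "U g * U (inv g) = c g (inv g) \<cdot>\<^sub>m (c \<one> \<one> \<cdot>\<^sub>m 1\<^sub>m n)"
    using proj_repD(3)[OF assms g'] assms(2) one by simp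
  have "U (inv g) = mat_adjoint (U g) * U g * U (inv g)"
    using u(3)[OF assms(2)] u(1)[OF g'] by simp
  also have "\<dots> = mat_adjoint (U g) * (c g (inv g) \<cdot>\<^sub>m (c \<one> \<one> \<cdot>\<^sub>m 1\<^sub>m n))"
    using u(1)[OF assms(2)] u(1)[OF g'] gg by simp
  also have "\<dots> = (c g (inv g) * c \<one> \<one>) \<cdot>\<^sub>m mat_adjoint (U g)"
    using u(1)[OF assms(2)] by (simp add: smult_smult_mat mult_smult_distrib[of _ n n _ n])
  finally show ?thesis by blast
qed

lemma proj_rep_conj:
  assumes "proj_rep G c n U" "unitary_mat n Q"
  shows "proj_rep G c n (\<lambda>g. mat_adjoint Q * U g * Q)"
proof -
  note q = unitary_matD[OF assms(2)] and u = proj_repD[OF assms(1)]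
  have qa: "unitary_mat n (mat_adjoint Q)" using q by (simp add: unitary_mat_def)
  have "mat_adjoint Q * U g * Q * (mat_adjoint Q * U h * Q) = c g h \<cdot>\<^sub>m (mat_adjoint Q * U (g \<otimes> h) * Q)"
    if g: "g \<in> carrier G" and h: "h \<in> carrier G" for g h
  proof -
    have "mat_adjoint Q * U g * Q * (mat_adjoint Q * U h * Q) =
        mat_adjoint Q * U g * (Q * mat_adjoint Q) * U h * Q"
      using q(1) u(2)[OF g] u(2)[OF h]
      by (simp add: assoc_mult_mat[of _ n n _ n _ n] mult_carrier_mat[of _ n n _ n])
    also have "\<dots> = mat_adjoint Q * U g * U h * Q"
      using q(1,2) u(2)[OF g] by simp
    also have "\<dots> = mat_adjoint Q * (U g * U h) * Q"
      using q(1) u(2)[OF g] u(2)[OF h]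
      by (simp add: assoc_mult_mat[of _ n n _ n _ n] mult_carrier_mat[of _ n n _ n])
    also have "\<dots> = c g h \<cdot>\<^sub>m (mat_adjoint Q * U (g \<otimes> h) * Q)"
      unfolding u(3)[OF g h] using q(1) u(2)[OF m_closed[OF g h]]
      by (simp add: mult_smult_distrib[of _ n n _ n] mult_smult_assoc_mat[of _ n n _ n])
    finally show ?thesis .
  qed
  moreover have "unitary_mat n (mat_adjoint Q * U g * Q)" if "g \<in> carrier G" for g
    by (intro unitary_mat_mult qa assms(2) u(1) that)
  ultimately show ?thesis using u(4) unfolding proj_rep_def by blast
qed

text \<open>The orthogonal complement of an invariant subspace is invariant: up to a scalar, the
  upper right block at \<open>g\<close> is the adjoint of the lower left block at
  \<open>inv g\<close>, which vanishes as well.\<close>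

lemma lower_zero_block_diagonal:
  assumes "proj_rep G c (d + e) M"
    and z: "\<And>g i j. g \<in> carrier G \<Longrightarrow> i < d \<Longrightarrow> j < e \<Longrightarrow> M g $$ (d + j, i) = 0"
    and g: "g \<in> carrier G"
  shows "block_diagonal d e (M g)"
proof -
  note Mg = proj_repD(2)[OF assms(1) g]
  have g': "inv (inv g) = g" "inv g \<in> carrier G" using g by auto
  obtain k where k: "M g = k \<cdot>\<^sub>m mat_adjoint (M (inv g))"
    using proj_rep_inv[OF assms(1) g'(2)] unfolding g' by blast
  note Mg' = proj_repD(2)[OF assms(1) g'(2)]
  have "M g $$ (i, d + j) = 0" if "i < d" "j < e" for i j
    using z[OF g'(2) that] that Mg' by (subst k) simp
  with z[OF g] Mg show ?thesis by (simp add: block_diagonal_def)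
qed

lemma proj_rep_blocks:
  assumes "proj_rep G c (d + e) M" and bd: "\<And>g. g \<in> carrier G \<Longrightarrow> block_diagonal d e (M g)"
  shows "proj_rep G c d (\<lambda>g. upper_block d (M g))" "proj_rep G c e (\<lambda>g. lower_block d e (M g))"
proof -
  note M = proj_repD[OF assms(1)]
  have "upper_block d (M g) * upper_block d (M h) = c g h \<cdot>\<^sub>m upper_block d (M (g \<otimes> h))"
       "lower_block d e (M g) * lower_block d e (M h) = c g h \<cdot>\<^sub>m lower_block d e (M (g \<otimes> h))"
    if "g \<in> carrier G" "h \<in> carrier G" for g h
    using that by (simp_all add: block_diagonal_mult[OF bd bd, symmetric] M(3) block_smult[OF M(2)])
  then show "proj_rep G c d (\<lambda>g. upper_block d (M g))" "proj_rep G c e (\<lambda>g. lower_block d e (M g))"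
    unfolding proj_rep_def using block_diagonal_unitary[OF bd M(1)] M(4) by auto
qed

text \<open>An invariant subspace given by an orthonormal basis, the columns of \<open>B\<close>;
  the matrix \<open>X\<close> is the restriction of \<open>U g\<close> in that basis.\<close>

definition invariant_isometry :: "nat \<Rightarrow> ('g \<Rightarrow> complex mat) \<Rightarrow> nat \<Rightarrow> complex mat \<Rightarrow> bool" where
  "invariant_isometry n U d B \<longleftrightarrow> B \<in> carrier_mat n d \<and> mat_adjoint B * B = 1\<^sub>m d \<and>
     (\<forall>g\<in>carrier G. \<exists>X\<in>carrier_mat d d. U g * B = B * X)"

text \<open>In a unitary \<open>Q\<close> that extends the columns of \<open>B\<close>, the product
  of the adjoint of \<open>Q\<close> with \<open>B\<close> consists of the first \<open>d\<close>
  unit vectors. The first \<open>d\<close> columns of the conjugated matrix are therefore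
  \<open>X g\<close> above a zero block, and \<open>lower_zero_block_diagonal\<close> removes the
  other off-diagonal block.\<close>

lemma invariant_isometry_splits:
  assumes U: "proj_rep G c n U" and B: "invariant_isometry n U d B"
  shows "\<exists>Q X Y. unitary_mat n Q \<and> d \<le> n \<and> proj_rep G c d X \<and> proj_rep G c (n - d) Y \<and>
    (\<forall>g\<in>carrier G. U g * B = B * X g \<and>
      mat_adjoint Q * U g * Q = four_block_mat (X g) (0\<^sub>m d (n - d)) (0\<^sub>m (n - d) d) (Y g))"
proof -
  have Bc: "B \<in> carrier_mat n d" and BB: "mat_adjoint B * B = 1\<^sub>m d"
    using B by (auto simp: invariant_isometry_def)
  obtain X where X: "\<And>g. g \<in> carrier G \<Longrightarrow> X g \<in> carrier_mat d d"
      "\<And>g. g \<in> carrier G \<Longrightarrow> U g * B = B * X g"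
    using B unfolding invariant_isometry_def by metis
  have dn: "d \<le> n" by (rule isometry_dim_le[OF Bc BB])
  define e where "e = n - d"
  have n: "n = d + e" using dn by (simp add: e_def)
  obtain Q where Q: "unitary_mat n Q" and QB: "\<And>i j. i < n \<Longrightarrow> j < d \<Longrightarrow> Q $$ (i, j) = B $$ (i, j)"
    using isometry_completion[OF Bc BB] by auto
  note q = unitary_matD[OF Q]
  define M where "M g = mat_adjoint Q * U g * Q" for g
  have M: "proj_rep G c n M" unfolding M_def by (rule proj_rep_conj[OF U Q])
  have col: "M g $$ (i, j) = (if i < d then X g $$ (i, j) else 0)"
    if g: "g \<in> carrier G" and i: "i < n" and j: "j < d" for g i j
  proof -
    have Ug: "U g \<in> carrier_mat n n" by (rule proj_repD(2)[OF U g])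
    have jn: "j < n" using j dn by simp
    have QB1: "(mat_adjoint Q * B) $$ (i, k) = of_bool (i = k)" if k: "k < d" for k
    proof -
      have "(mat_adjoint Q * B) $$ (i, k) = (\<Sum>a<n. mat_adjoint Q $$ (i, a) * B $$ (a, k))"
        using i k q(1) Bc by (intro mult_index[of _ n n _ d]) simp_all
      also have "\<dots> = (\<Sum>a<n. mat_adjoint Q $$ (i, a) * Q $$ (a, k))"
        using k by (intro sum.cong refl) (simp add: QB)
      also have "\<dots> = (mat_adjoint Q * Q) $$ (i, k)"
        using i k q(1) dn by (intro mult_index[symmetric, of _ n n _ n]) simp_all
      finally show ?thesis using i k dn by (simp add: q(3))
    qed
    have "M g $$ (i, j) = (\<Sum>a<n. (mat_adjoint Q * U g) $$ (i, a) * Q $$ (a, j))"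
      unfolding M_def using i jn q(1) Ug by (intro mult_index[of _ n n _ n]) simp_all
    also have "\<dots> = (\<Sum>a<n. (mat_adjoint Q * U g) $$ (i, a) * B $$ (a, j))"
      using j by (intro sum.cong refl) (simp add: QB)
    also have "\<dots> = (mat_adjoint Q * U g * B) $$ (i, j)"
      using i j q(1) Ug Bc by (intro mult_index[symmetric, of _ n n _ d]) simp_all
    also have "mat_adjoint Q * U g * B = mat_adjoint Q * B * X g"
      using q(1) Ug Bc X(1)[OF g] by (simp add: X(2)[OF g])
    also have "\<dots> $$ (i, j) = (\<Sum>k<d. (mat_adjoint Q * B) $$ (i, k) * X g $$ (k, j))"
      using i j q(1) Bc X(1)[OF g] by (intro mult_index[of _ n d _ d]) simp_all
    also have "\<dots> = (\<Sum>k<d. if k = i then X g $$ (k, j) else 0)"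
      by (intro sum.cong refl) (auto simp: QB1 simp del: index_mult_mat(1))
    finally show ?thesis by simp
  qed
  have bd: "block_diagonal d e (M g)" if g: "g \<in> carrier G" for g
    by (rule lower_zero_block_diagonal[OF M[unfolded n] _ g]) (auto simp: col n)
  have ul: "upper_block d (M g) = X g" if g: "g \<in> carrier G" for g
    using X(1)[OF g] by (intro eq_matI) (auto simp: upper_block_def col[OF g] n)
  note bl = proj_rep_blocks[OF M[unfolded n] bd]
  show ?thesis
  proof (intro exI conjI ballI)
    show "proj_rep G c d (\<lambda>g. upper_block d (M g))" by (rule bl)
    show "proj_rep G c (n - d) (\<lambda>g. lower_block d e (M g))" using bl by (simp add: n)
    fix g assume g: "g \<in> carrier G"
    show "U g * B = B * upper_block d (M g)" using X ul g by simp
    show "mat_adjoint Q * U g * Q =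
        four_block_mat (upper_block d (M g)) (0\<^sub>m d (n - d)) (0\<^sub>m (n - d) d) (lower_block d e (M g))"
      using block_diagonal_four_block[OF bd[OF g]] by (simp add: M_def n)
  qed (use Q dn in auto)
qed

text \<open>An invariant isometry of least positive dimension carries an irreducible subrepresentation.\<close>

lemma irreducible_summand:
  assumes U: "proj_rep G c n U" and n: "0 < n"
  shows "\<exists>d Q X Y. unitary_mat n Q \<and> 0 < d \<and> d \<le> n \<and> X \<in> irreps G c \<and> rep_dim G X = d \<and>
    proj_rep G c (n - d) Y \<and> (\<forall>g\<in>carrier G.
      mat_adjoint Q * U g * Q = four_block_mat (X g) (0\<^sub>m d (n - d)) (0\<^sub>m (n - d) d) (Y g))"
proof -
  note u = proj_repD(2)[OF U]
  let ?P = "\<lambda>d. 0 < d \<and> (\<exists>B. invariant_isometry n U d B)"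
  have "invariant_isometry n U n (1\<^sub>m n)"
    unfolding invariant_isometry_def
  proof (intro conjI ballI)
    fix g assume "g \<in> carrier G"
    from u[OF this] show "\<exists>X\<in>carrier_mat n n. U g * 1\<^sub>m n = 1\<^sub>m n * X"
      by (intro bexI[of _ "U g"]) simp_all
  qed simp_all
  then have ex: "?P n" using n by blast
  define d where "d = (LEAST d. ?P d)"
  have "?P d" unfolding d_def by (rule LeastI[of ?P, OF ex])
  then obtain B where d: "0 < d" and B: "invariant_isometry n U d B" by blast
  have least: "d \<le> e" if "?P e" for e unfolding d_def by (rule Least_le[of ?P, OF that])
  obtain Q X Y where Q: "unitary_mat n Q" "d \<le> n" and X: "proj_rep G c d X" and Y: "proj_rep G c (n - d) Y"
    and UB: "\<And>g. g \<in> carrier G \<Longrightarrow> U g * B = B * X g"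
    and split: "\<And>g. g \<in> carrier G \<Longrightarrow>
      mat_adjoint Q * U g * Q = four_block_mat (X g) (0\<^sub>m d (n - d)) (0\<^sub>m (n - d) d) (Y g)"
    using invariant_isometry_splits[OF U B] by blast
  have Bc: "B \<in> carrier_mat n d" and BB: "mat_adjoint B * B = 1\<^sub>m d"
    using B by (auto simp: invariant_isometry_def)
  note x = proj_repD(2)[OF X]
  have "W = {0\<^sub>v d} \<or> W = carrier_vec d"
    if sub: "VectorSpace.subspace class_ring W (module_vec TYPE(complex) d)"
      and inv: "\<forall>g\<in>carrier G. \<forall>w\<in>W. X g *\<^sub>v w \<in> W" for W
  proof -
    obtain e C where C: "C \<in> carrier_mat d e" "mat_adjoint C * C = 1\<^sub>m e"
      and W: "W = (\<lambda>v. C *\<^sub>v v) ` carrier_vec e"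
      using subspace_isometry[OF sub] by blast
    have ed: "e \<le> d" by (rule isometry_dim_le[OF C])
    \<comment> \<open>\<open>C * mat_adjoint C\<close> is the projection onto \<open>W\<close>; it
      fixes the columns of \<open>X g * C\<close> because they lie in \<open>W\<close>.\<close>
    have XC: "X g * C = C * (mat_adjoint C * (X g * C))" if g: "g \<in> carrier G" for g
    proof (rule mat_col_eqI)
      fix j assume "j < dim_col (C * (mat_adjoint C * (X g * C)))"
      then have j: "j < e" using C by simp
      have "C *\<^sub>v unit_vec e j = col C j" using C(1) j by (intro eq_vecI) auto
      then have cc: "col C j \<in> W" unfolding W by (metis image_eqI unit_vec_carrier)
      have XCc: "X g * C \<in> carrier_mat d e" using x[OF g] C by simp
      have "col (X g * C) j = X g *\<^sub>v col C j" by (rule col_mult2[OF x[OF g] C(1) j])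
      also have "\<dots> \<in> W" using inv g cc by blast
      finally obtain v where v: "v \<in> carrier_vec e" "col (X g * C) j = C *\<^sub>v v" unfolding W by blast
      have "col (C * (mat_adjoint C * (X g * C))) j = C *\<^sub>v col (mat_adjoint C * (X g * C)) j"
        using C(1) XCc j by (intro col_mult2[of _ d e _ e] mult_carrier_mat[of _ e d]) simp_all
      also have "col (mat_adjoint C * (X g * C)) j = mat_adjoint C *\<^sub>v col (X g * C) j"
        using C(1) XCc j by (intro col_mult2[of _ e d _ e]) simp_all
      finally have "col (C * (mat_adjoint C * (X g * C))) j = C *\<^sub>v (mat_adjoint C *\<^sub>v col (X g * C) j)" .
      also have "\<dots> = C *\<^sub>v (mat_adjoint C *\<^sub>v (C *\<^sub>v v))" by (simp only: v(2))
      also have "mat_adjoint C *\<^sub>v (C *\<^sub>v v) = (mat_adjoint C * C) *\<^sub>v v"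
        using C(1) v(1) by (intro assoc_mult_mat_vec[symmetric, of _ e d _ e]) simp_all
      also have "\<dots> = v" using C(2) v(1) by simp
      finally show "col (X g * C) j = col (C * (mat_adjoint C * (X g * C))) j" using v(2) by simp
    qed (use x[OF g] C in auto)
    \<comment> \<open>An invariant subspace of the restriction lifts to the whole space through
      \<open>B\<close>, so minimality of \<open>d\<close> leaves only \<open>e = 0\<close> and
      \<open>e = d\<close>.\<close>
    have BC: "invariant_isometry n U e (B * C)"
      unfolding invariant_isometry_def
    proof (intro conjI ballI)
      show "B * C \<in> carrier_mat n e" using Bc C by simp
      have "mat_adjoint (B * C) * (B * C) = mat_adjoint C * (mat_adjoint B * (B * C))"
        unfolding mat_adjoint_mult[OF Bc C(1)]
        using Bc C(1) by (intro assoc_mult_mat[of _ e d _ n _ e]) simp_all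
      also have "mat_adjoint B * (B * C) = mat_adjoint B * B * C"
        using Bc C(1) by (intro assoc_mult_mat[symmetric, of _ d n _ d _ e]) simp_all
      also have "mat_adjoint C * \<dots> = 1\<^sub>m e" using C by (simp add: BB)
      finally show "mat_adjoint (B * C) * (B * C) = 1\<^sub>m e" .
      fix g assume g: "g \<in> carrier G"
      have "U g * (B * C) = U g * B * C" using u[OF g] Bc C(1) by simp
      also have "\<dots> = B * (X g * C)" using UB[OF g] Bc x[OF g] C(1) by simp
      also have "\<dots> = B * C * (mat_adjoint C * (X g * C))"
      proof (subst XC[OF g], rule assoc_mult_mat[symmetric])
        show "mat_adjoint C * (X g * C) \<in> carrier_mat e e"
          using x[OF g] C(1) by (intro mult_carrier_mat[of _ e d]) simp_all
      qed (rule Bc C(1))+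
      finally show "\<exists>Z\<in>carrier_mat e e. U g * (B * C) = B * C * Z"
        using x[OF g] C(1) by (intro bexI[of _ "mat_adjoint C * (X g * C)"]) simp_all
    qed
    show ?thesis
    proof (cases "e = 0")
      case True
      have "C *\<^sub>v v = 0\<^sub>v d" if "v \<in> carrier_vec e" for v
        using that C(1) True by (intro eq_vecI) (auto simp: scalar_prod_def)
      then have "W \<subseteq> {0\<^sub>v d}" unfolding W by auto
      then show ?thesis using subspace_vecD(2)[OF sub] by blast
    next
      case False
      then have "e = d" using least[of e] BC ed by auto
      then have C: "C \<in> carrier_mat d d" "mat_adjoint C * C = 1\<^sub>m d" using C by auto
      have CC: "C * mat_adjoint C = 1\<^sub>m d"
        using C by (intro mat_mult_left_right_inverse[OF _ C]) simp
      have "v \<in> W" if v: "v \<in> carrier_vec d" for v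
      proof -
        have "v = (C * mat_adjoint C) *\<^sub>v v" using CC v by simp
        also have "\<dots> = C *\<^sub>v (mat_adjoint C *\<^sub>v v)"
          using C(1) v by (intro assoc_mult_mat_vec[of _ d d _ d]) simp_all
        finally have "v = C *\<^sub>v (mat_adjoint C *\<^sub>v v)" .
        moreover have "mat_adjoint C *\<^sub>v v \<in> carrier_vec e"
          using C(1) v \<open>e = d\<close> by (intro mult_mat_vec_carrier[of _ e d]) simp_all
        ultimately show ?thesis unfolding W by blast
      qed
      then show ?thesis using subspace_vecD(1)[OF sub] by blast
    qed
  qed
  then have "X \<in> irreps G c" using X d unfolding irreps_def by blast
  then show ?thesis using Q X Y d split rep_dim_eq[OF X] by blast
qed

lemma direct_sum_Cons:
  "direct_sum (V # Vs) g = four_block_mat (V g)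
     (0\<^sub>m (dim_row (V g)) (dim_col (direct_sum Vs g)))
     (0\<^sub>m (dim_row (direct_sum Vs g)) (dim_col (V g))) (direct_sum Vs g)"
  by (simp add: direct_sum_def Let_def)

text \<open>Irreducible summands are split off one at a time and the unitaries are assembled
  blockwise. The summands are taken from a prescribed set \<open>R\<close> of representatives, so
  that copies of one class appear with literally the same matrices and their forms can be
  added.\<close>

lemma unitary_decomposition:
  assumes "proj_rep G c n U"
    and R: "R \<subseteq> irreps G c" "\<And>X. X \<in> irreps G c \<Longrightarrow> \<exists>V\<in>R. rep_equiv G X V"
  shows "\<exists>Vs P. set Vs \<subseteq> R \<and> (\<forall>g\<in>carrier G. similar_mat_wit (U g) (direct_sum Vs g) P (mat_adjoint P))"
  using assms(1)
proof (induction n arbitrary: U rule: less_induct)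
  case (less n)
  note U = less.prems
  show ?case
  proof (cases "n = 0")
    case True
    have "similar_mat_wit (U g) (direct_sum [] g) (1\<^sub>m 0) (mat_adjoint (1\<^sub>m 0))" if "g \<in> carrier G" for g
      using proj_repD(2)[OF U that] True
      by (intro similar_mat_witI[of _ _ 0]) (auto simp: direct_sum_def)
    then show ?thesis by (intro exI[of _ "[]"] exI[of _ "1\<^sub>m 0"]) auto
  next
    case False
    then obtain d Q X Y where Q: "unitary_mat n Q" and d: "0 < d" "d \<le> n" and X: "X \<in> irreps G c" "rep_dim G X = d"
      and Y: "proj_rep G c (n - d) Y"
      and split: "\<And>g. g \<in> carrier G \<Longrightarrow>
        mat_adjoint Q * U g * Q = four_block_mat (X g) (0\<^sub>m d (n - d)) (0\<^sub>m (n - d) d) (Y g)"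
      using irreducible_summand[OF U] by blast
    note q = unitary_matD[OF Q]
    obtain V where V: "V \<in> R" "rep_equiv G X V" using R(2)[OF X(1)] by blast
    have Vi: "V \<in> irreps G c" using V(1) R(1) by blast
    obtain P1 where P1: "unitary_mat (rep_dim G V) P1" "rep_dim G V = d"
      "\<And>g. g \<in> carrier G \<Longrightarrow> X g = P1 * V g * mat_adjoint P1"
      using rep_equiv_imp_unitary[OF Vi X(1) V(2)] X(2) by metis
    note p1 = unitary_matD[OF P1(1), unfolded P1(2)]
    have Vg: "V g \<in> carrier_mat d d" if "g \<in> carrier G" for g
      using proj_repD(2)[OF irreps_proj_rep(1)[OF Vi] that] P1(2) by simp
    obtain Vs P2 where Vs: "set Vs \<subseteq> R"
      and P2: "\<And>g. g \<in> carrier G \<Longrightarrow> similar_mat_wit (Y g) (direct_sum Vs g) P2 (mat_adjoint P2)"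
      using less.IH[OF _ Y] d False by auto
    note y = proj_repD(2)[OF Y]
    note p2 = similar_mat_witD2[OF y P2]
    have P2c: "P2 \<in> carrier_mat (n - d) (n - d)" by (rule p2(6)[OF one_closed one_closed])
    let ?F = "four_block_mat P1 (0\<^sub>m d (n - d)) (0\<^sub>m (n - d) d) P2"
    have F: "?F \<in> carrier_mat n n" using p1(1) P2c d by auto
    have Fadj: "mat_adjoint ?F = four_block_mat (mat_adjoint P1) (0\<^sub>m d (n - d)) (0\<^sub>m (n - d) d) (mat_adjoint P2)"
      using p1(1) P2c by (intro eq_matI) auto
    have "similar_mat_wit (U g) (direct_sum (V # Vs) g) (Q * ?F) (mat_adjoint (Q * ?F))"
      if g: "g \<in> carrier G" for g
    proof -
      have Ug: "U g \<in> carrier_mat n n" by (rule proj_repD(2)[OF U g])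
      have Xg: "X g \<in> carrier_mat d d" using P1(3)[OF g] p1(1) Vg[OF g] by simp
      have Dg: "direct_sum Vs g \<in> carrier_mat (n - d) (n - d)" by (rule p2(5)[OF g g])
      let ?M = "mat_adjoint Q * U g * Q"
      have 1: "similar_mat_wit (U g) ?M Q (mat_adjoint Q)"
      proof (rule similar_mat_witI[OF q(2,3)])
        have "Q * ?M * mat_adjoint Q = (Q * mat_adjoint Q) * U g * (Q * mat_adjoint Q)"
          using q(1) Ug by (simp add: assoc_mult_mat[of _ n n _ n _ n] mult_carrier_mat[of _ n n _ n])
        also have "\<dots> = U g" using q(2) Ug by simp
        finally show "U g = Q * ?M * mat_adjoint Q" by simp
      qed (use q(1) Ug in simp_all)
      have w1: "similar_mat_wit (X g) (V g) P1 (mat_adjoint P1)"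
        by (rule similar_mat_witI[OF p1(2,3) P1(3)[OF g] Xg Vg[OF g] p1(1)]) (use p1(1) in simp)
      have z: "0\<^sub>m d (n - d) = P1 * 0\<^sub>m d (n - d) * mat_adjoint P2"
        "0\<^sub>m (n - d) d = P2 * 0\<^sub>m (n - d) d * mat_adjoint P1"
        using p1(1) P2c
        by (simp_all add: right_mult_zero_mat[of _ d d] right_mult_zero_mat[of _ "n - d" "n - d"]
            left_mult_zero_mat[of _ d d] left_mult_zero_mat[of _ "n - d" "n - d"])
      have 2: "similar_mat_wit ?M (direct_sum (V # Vs) g) ?F (mat_adjoint ?F)"
        unfolding split[OF g] direct_sum_Cons Fadj
        by (rule similar_mat_wit_four_block[OF w1 P2[OF g] _ _ Xg y[OF g]])
          (use Vg[OF g] Dg z in simp_all)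
      have "similar_mat_wit (U g) (direct_sum (V # Vs) g) (Q * ?F) (mat_adjoint ?F * mat_adjoint Q)"
        by (rule similar_mat_wit_trans[OF 1 2])
      then show ?thesis by (simp only: mat_adjoint_mult[OF q(1) F])
    qed
    then show ?thesis using Vs V(1)
      by (intro exI[of _ "V # Vs"] exI[of _ "Q * ?F"]) auto
  qed
qed

end

section \<open>Block coordinates\<close>

definition block_offset :: "nat list \<Rightarrow> nat \<Rightarrow> nat" where
  "block_offset ds k = sum_list (take k ds)"

lemma block_offset_Cons [simp]:
  "block_offset (d # ds) 0 = 0" "block_offset (d # ds) (Suc k) = d + block_offset ds k"
  by (simp_all add: block_offset_def)

lemma sum_blocks:
  fixes f :: "nat \<Rightarrow> 'a::comm_monoid_add"
  shows "(\<Sum>p<sum_list ds. f p) = (\<Sum>k<length ds. \<Sum>a<ds ! k. f (block_offset ds k + a))"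
proof (induction ds arbitrary: f)
  case (Cons d ds)
  show ?case
    using Cons.IH[of "\<lambda>p. f (d + p)"]
    by (simp add: sum_lessThan_add sum.lessThan_Suc_shift add.assoc del: sum.lessThan_Suc)
qed simp

text \<open>Allows a vector to be prescribed through its block coordinates, which is how the optimal
  input is built.\<close>

lemma block_function_exists: "\<exists>w. \<forall>k<length ds. \<forall>a<ds ! k. w (block_offset ds k + a) = z k a"
proof (induction ds arbitrary: z)
  case (Cons d ds)
  from Cons.IH[of "\<lambda>k. z (Suc k)"] obtain w
    where w: "\<forall>k<length ds. \<forall>a<ds ! k. w (block_offset ds k + a) = z (Suc k) a" by blast
  show ?case
  proof (intro exI allI impI)
    fix k a assume ka: "k < length (d # ds)" "a < (d # ds) ! k"
    show "(\<lambda>p. if p < d then z 0 p else w (p - d)) (block_offset (d # ds) k + a) = z k a"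
      using ka w by (cases k) (auto simp: add.assoc)
  qed
qed simp

lemma quad_block_diagonal:
  assumes "\<And>i j. i < d \<Longrightarrow> j < e \<Longrightarrow> M i (d + j) = 0 \<and> M (d + j) i = 0"
  shows "quad (d + e) M x y =
    quad d M x y + quad e (\<lambda>i j. M (d + i) (d + j)) (\<lambda>i. x (d + i)) (\<lambda>i. y (d + i))"
  unfolding quad_def sum_lessThan_add using assms by (simp add: sum.distrib)

lemma quad_cong:
  assumes "\<And>i j. i < n \<Longrightarrow> j < n \<Longrightarrow> a i j = b i j"
  shows "quad n a x y = quad n b x y"
  unfolding quad_def using assms by (intro sum.cong refl) auto

lemma quad_diag_block:
  assumes "\<And>A. A \<in> set As \<Longrightarrow> dim_col A = dim_row A"
  defines "ds \<equiv> map dim_row As"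
  shows "quad (sum_list ds) (\<lambda>i j. diag_block_mat As $$ (i, j)) x y =
    (\<Sum>k<length As. quad (ds ! k) (\<lambda>a b. As ! k $$ (a, b))
       (\<lambda>a. x (block_offset ds k + a)) (\<lambda>a. y (block_offset ds k + a)))"
  using assms(1) unfolding ds_def
proof (induction As arbitrary: x y)
  case Nil
  show ?case by (simp add: quad_def)
next
  case (Cons A As)
  let ?d = "dim_row A" and ?e = "sum_list (map dim_row As)"
  let ?B = "diag_block_mat As" and ?M = "\<lambda>i j. diag_block_mat (A # As) $$ (i, j)"
  have A: "dim_col A = ?d" using Cons.prems[of A] by simp
  have "map dim_col As = map dim_row As" using Cons.prems by auto
  then have B: "dim_row ?B = ?e" "dim_col ?B = ?e" by (simp_all only: dim_diag_block_mat)
  have M: "?M i j = (if i < ?d then if j < ?d then A $$ (i, j) else 0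
      else if j < ?d then 0 else ?B $$ (i - ?d, j - ?d))" if "i < ?d + ?e" "j < ?d + ?e" for i j
    using that A B by (auto simp: Let_def)
  have "quad (?d + ?e) ?M x y = quad ?d ?M x y +
      quad ?e (\<lambda>i j. ?M (?d + i) (?d + j)) (\<lambda>i. x (?d + i)) (\<lambda>i. y (?d + i))"
    by (rule quad_block_diagonal) (simp add: M del: diag_block_mat.simps)
  also have "quad ?d ?M x y = quad ?d (\<lambda>i j. A $$ (i, j)) x y"
    by (rule quad_cong) (simp add: M del: diag_block_mat.simps)
  also have "quad ?e (\<lambda>i j. ?M (?d + i) (?d + j)) (\<lambda>i. x (?d + i)) (\<lambda>i. y (?d + i)) =
      quad ?e (\<lambda>i j. ?B $$ (i, j)) (\<lambda>i. x (?d + i)) (\<lambda>i. y (?d + i))"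
    by (rule quad_cong) (simp add: M del: diag_block_mat.simps)
  also have "\<dots> = (\<Sum>k<length As. quad (map dim_row As ! k) (\<lambda>a b. As ! k $$ (a, b))
       (\<lambda>a. x (?d + (block_offset (map dim_row As) k + a))) (\<lambda>a. y (?d + (block_offset (map dim_row As) k + a))))"
    using Cons.prems by (intro Cons.IH) simp
  finally show ?case
    by (simp add: sum.lessThan_Suc_shift add.assoc del: sum.lessThan_Suc diag_block_mat.simps)
qed

lemma sum_swap4:
  fixes t :: "'i \<Rightarrow> 'j \<Rightarrow> 'p \<Rightarrow> 'q \<Rightarrow> 'a::comm_monoid_add"
  shows "(\<Sum>i\<in>I. \<Sum>j\<in>J. \<Sum>p\<in>P. \<Sum>q\<in>Q. t i j p q) = (\<Sum>p\<in>P. \<Sum>q\<in>Q. \<Sum>i\<in>I. \<Sum>j\<in>J. t i j p q)"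
proof -
  have "(\<Sum>i\<in>I. \<Sum>j\<in>J. \<Sum>p\<in>P. \<Sum>q\<in>Q. t i j p q) = (\<Sum>i\<in>I. \<Sum>p\<in>P. \<Sum>j\<in>J. \<Sum>q\<in>Q. t i j p q)"
    by (intro sum.cong refl sum.swap)
  also have "\<dots> = (\<Sum>p\<in>P. \<Sum>i\<in>I. \<Sum>j\<in>J. \<Sum>q\<in>Q. t i j p q)" by (rule sum.swap)
  also have "\<dots> = (\<Sum>p\<in>P. \<Sum>i\<in>I. \<Sum>q\<in>Q. \<Sum>j\<in>J. t i j p q)"
    by (intro sum.cong refl sum.swap)
  also have "\<dots> = (\<Sum>p\<in>P. \<Sum>q\<in>Q. \<Sum>i\<in>I. \<Sum>j\<in>J. t i j p q)"
    by (intro sum.cong refl sum.swap)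
  finally show ?thesis .
qed

lemma conj_index:
  assumes P: "P \<in> carrier_mat n n" and D: "D \<in> carrier_mat n n" and ij: "i < n" "j < n"
  shows "(P * D * mat_adjoint P) $$ (i, j) = (\<Sum>p<n. \<Sum>q<n. P $$ (i, p) * D $$ (p, q) * cnj (P $$ (j, q)))"
proof -
  have "(P * D * mat_adjoint P) $$ (i, j) = (\<Sum>q<n. (P * D) $$ (i, q) * mat_adjoint P $$ (q, j))"
    using P D ij by (intro mult_index[of _ n n _ n]) simp_all
  also have "\<dots> = (\<Sum>q<n. (\<Sum>p<n. P $$ (i, p) * D $$ (p, q)) * cnj (P $$ (j, q)))"
    using P ij by (intro sum.cong refl) (simp add: mult_index[OF P D] del: index_mult_mat(1))
  also have "\<dots> = (\<Sum>q<n. \<Sum>p<n. P $$ (i, p) * D $$ (p, q) * cnj (P $$ (j, q)))"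
    by (simp add: sum_distrib_right)
  also have "\<dots> = (\<Sum>p<n. \<Sum>q<n. P $$ (i, p) * D $$ (p, q) * cnj (P $$ (j, q)))" by (rule sum.swap)
  finally show ?thesis .
qed

lemma quad_conjugate:
  assumes P: "P \<in> carrier_mat n n" and D: "D \<in> carrier_mat n n"
  shows "quad n (\<lambda>i j. (P * D * mat_adjoint P) $$ (i, j)) x y =
    quad n (\<lambda>p q. D $$ (p, q)) (\<lambda>p. \<Sum>i<n. cnj (P $$ (i, p)) * x i) (\<lambda>p. \<Sum>i<n. cnj (P $$ (i, p)) * y i)"
proof -
  have "quad n (\<lambda>i j. (P * D * mat_adjoint P) $$ (i, j)) x y = (\<Sum>i<n. \<Sum>j<n. \<Sum>p<n. \<Sum>q<n.
      cnj (x i) * (P $$ (i, p) * D $$ (p, q) * cnj (P $$ (j, q))) * y j)"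
    unfolding quad_def
    by (intro sum.cong refl) (simp add: conj_index[OF P D] sum_distrib_left sum_distrib_right del: index_mult_mat(1))
  also have "\<dots> = (\<Sum>p<n. \<Sum>q<n. \<Sum>i<n. \<Sum>j<n.
      cnj (x i) * (P $$ (i, p) * D $$ (p, q) * cnj (P $$ (j, q))) * y j)" by (rule sum_swap4)
  also have "\<dots> = (\<Sum>p<n. \<Sum>q<n. cnj (\<Sum>i<n. cnj (P $$ (i, p)) * x i) * D $$ (p, q) * (\<Sum>i<n. cnj (P $$ (i, q)) * y i))"
    by (intro sum.cong refl) (simp add: sum_distrib_left sum_distrib_right sum_product mult_ac)
  finally show ?thesis unfolding quad_def .
qed

section \<open>Classes of irreducible representations and multiplicities\<close>

context factor_system
begin

lemma irreps_carrier: "V \<in> irreps G c \<Longrightarrow> g \<in> carrier G \<Longrightarrow> V g \<in> carrier_mat (rep_dim G V) (rep_dim G V)"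
  using proj_repD(2)[OF irreps_proj_rep(1)] .

lemma irreps_dims:
  assumes "V \<in> irreps G c" "g \<in> carrier G"
  shows "dim_row (V g) = rep_dim G V" "dim_col (V g) = rep_dim G V"
  using irreps_carrier[OF assms] by simp_all

lemma rep_equiv_refl: "V \<in> irreps G c \<Longrightarrow> rep_equiv G V V"
  unfolding rep_equiv_def using similar_mat_wit_refl[OF irreps_carrier] by blast

lemma rep_equiv_sym: "rep_equiv G V W \<Longrightarrow> rep_equiv G W V"
  unfolding rep_equiv_def using similar_mat_wit_sym by blast

lemma rep_equiv_trans: "rep_equiv G V W \<Longrightarrow> rep_equiv G W X \<Longrightarrow> rep_equiv G V X"
  unfolding rep_equiv_def using similar_mat_wit_trans by blast

lemma rep_equiv_dim:
  assumes "rep_equiv G V W"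
  shows "rep_dim G V = rep_dim G W"
proof -
  obtain P Q where "similar_mat_wit (V \<one>) (W \<one>) P Q" using assms one_closed unfolding rep_equiv_def by blast
  from similar_mat_witD(5)[OF refl this] show ?thesis by (simp add: rep_dim_def)
qed

abbreviation "sectors \<equiv> irrep_classes G c"

lemma rep_equiv_equiv:
  "equiv (irreps G c) {(V, W). V \<in> irreps G c \<and> W \<in> irreps G c \<and> rep_equiv G V W}"
  by (rule equivI)
    (auto simp: refl_on_def sym_def trans_def intro: rep_equiv_refl rep_equiv_sym rep_equiv_trans)

text \<open>Orthogonality of matrix entries concerns specific matrices, so every copy of a class in
  a decomposition is brought to this one choice.\<close>

definition class_rep :: "('g \<Rightarrow> complex mat) set \<Rightarrow> 'g \<Rightarrow> complex mat" where
  "class_rep \<sigma> = (SOME V. V \<in> \<sigma>)"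

lemma class_rep_mem:
  assumes "\<sigma> \<in> sectors"
  shows "class_rep \<sigma> \<in> \<sigma>"
  using in_quotient_imp_non_empty[OF rep_equiv_equiv assms[unfolded irrep_classes_def]]
  by (simp add: class_rep_def some_in_eq)

lemma class_mem_irreps:
  assumes "\<sigma> \<in> sectors" "V \<in> \<sigma>"
  shows "V \<in> irreps G c"
  using in_quotient_imp_subset[OF rep_equiv_equiv assms(1)[unfolded irrep_classes_def]] assms(2)
  by (rule subsetD)

lemma class_rep_irrep: "\<sigma> \<in> sectors \<Longrightarrow> class_rep \<sigma> \<in> irreps G c"
  by (rule class_mem_irreps[OF _ class_rep_mem])

lemma class_mem_iff:
  assumes "\<sigma> \<in> sectors" "V \<in> irreps G c"
  shows "V \<in> \<sigma> \<longleftrightarrow> rep_equiv G V (class_rep \<sigma>)"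
proof
  show "rep_equiv G V (class_rep \<sigma>)" if "V \<in> \<sigma>"
    using in_quotient_imp_in_rel[OF rep_equiv_equiv assms(1)[unfolded irrep_classes_def], of V "class_rep \<sigma>"]
      that class_rep_mem[OF assms(1)] by auto
next
  assume "rep_equiv G V (class_rep \<sigma>)"
  then have "(class_rep \<sigma>, V) \<in> {(V, W). V \<in> irreps G c \<and> W \<in> irreps G c \<and> rep_equiv G V W}"
    using assms class_rep_irrep rep_equiv_sym by blast
  then show "V \<in> \<sigma>"
    using in_quotient_imp_closed[OF rep_equiv_equiv assms(1)[unfolded irrep_classes_def] class_rep_mem[OF assms(1)]]
    by blast
qed

lemma class_rep_inj:
  assumes "\<sigma> \<in> sectors" "\<tau> \<in> sectors" "rep_equiv G (class_rep \<sigma>) (class_rep \<tau>)"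
  shows "\<sigma> = \<tau>"
proof -
  have "class_rep \<sigma> \<in> \<tau>" using assms class_mem_iff class_rep_irrep by blast
  then show ?thesis
    using quotient_disj[OF rep_equiv_equiv assms(1,2)[unfolded irrep_classes_def]] class_rep_mem[OF assms(1)]
    by blast
qed

lemma class_exists:
  assumes "V \<in> irreps G c"
  shows "\<exists>\<sigma>\<in>sectors. rep_equiv G V (class_rep \<sigma>)"
proof -
  let ?r = "{(V, W). V \<in> irreps G c \<and> W \<in> irreps G c \<and> rep_equiv G V W}"
  have "?r `` {V} \<in> sectors" unfolding irrep_classes_def using assms by (rule quotientI)
  moreover have "V \<in> ?r `` {V}" using assms rep_equiv_refl by blast
  ultimately show ?thesis using class_mem_iff assms by blast
qed

lemma class_dim_eq:
  assumes "\<sigma> \<in> sectors"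
  shows "class_dim G \<sigma> = rep_dim G (class_rep \<sigma>)"
proof -
  have "rep_dim G V = rep_dim G (class_rep \<sigma>)" if "V \<in> \<sigma>" for V
    using class_mem_iff[OF assms class_mem_irreps[OF assms that]] that rep_equiv_dim by blast
  then have "rep_dim G ` \<sigma> = {rep_dim G (class_rep \<sigma>)}"
    using class_rep_mem[OF assms] by blast
  then show ?thesis by (simp add: class_dim_def)
qed

lemma class_dim_pos: "\<sigma> \<in> sectors \<Longrightarrow> 0 < class_dim G \<sigma>"
  using class_dim_eq irreps_proj_rep(2)[OF class_rep_irrep] by simp

lemma class_rep_carrier:
  "\<sigma> \<in> sectors \<Longrightarrow> g \<in> carrier G \<Longrightarrow> class_rep \<sigma> g \<in> carrier_mat (class_dim G \<sigma>) (class_dim G \<sigma>)"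
  using class_dim_eq irreps_carrier[OF class_rep_irrep] by simp

lemma class_orthogonality:
  assumes "\<sigma> \<in> sectors" "\<tau> \<in> sectors" "i < class_dim G \<sigma>" "j < class_dim G \<sigma>"
    "k < class_dim G \<tau>" "l < class_dim G \<tau>"
  shows "(\<Sum>g\<in>carrier G. class_rep \<sigma> g $$ (i, j) * cnj (class_rep \<tau> g $$ (k, l))) =
    (if \<sigma> = \<tau> \<and> i = k \<and> j = l then of_real (real ord_G / real (class_dim G \<sigma>)) else 0)"
proof (cases "\<sigma> = \<tau>")
  case True
  then show ?thesis
    using schur_orthogonality[OF class_rep_irrep[OF assms(1)], of i j k l] assms by (simp add: class_dim_eq)
next
  case False
  then have "\<not> rep_equiv G (class_rep \<sigma>) (class_rep \<tau>)" using class_rep_inj assms by blast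
  then show ?thesis
    using False schur_orthogonality_inequivalent[OF class_rep_irrep[OF assms(2)] class_rep_irrep[OF assms(1)], of i j k l]
      assms by (simp add: class_dim_eq)
qed

section \<open>Matrix entries as functions on the group; finiteness of the set of classes\<close>

definition class_indices :: "('g \<Rightarrow> complex mat) set set \<Rightarrow> (('g \<Rightarrow> complex mat) set \<times> nat \<times> nat) set" where
  "class_indices S = (SIGMA \<sigma>:S. {..<class_dim G \<sigma>} \<times> {..<class_dim G \<sigma>})"

lemma class_functions_orthogonal:
  assumes "S \<subseteq> sectors" "p \<in> class_indices S" "q \<in> class_indices S"
  shows "inner_on (carrier G) (\<lambda>g. class_rep (fst p) g $$ snd p) (\<lambda>g. class_rep (fst q) g $$ snd q) =
    (if p = q then of_real (real ord_G / real (class_dim G (fst p))) else 0)"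
proof -
  obtain \<sigma> i j \<tau> k l where pq: "p = (\<sigma>, i, j)" "q = (\<tau>, k, l)" by (metis prod.exhaust)
  then have "\<sigma> \<in> sectors" "\<tau> \<in> sectors" "i < class_dim G \<sigma>" "j < class_dim G \<sigma>"
    "k < class_dim G \<tau>" "l < class_dim G \<tau>"
    using assms unfolding class_indices_def by auto
  from class_orthogonality[OF this] show ?thesis
    unfolding pq by (simp add: inner_on_def)
qed

text \<open>The matrix entries of inequivalent irreducibles, scaled by \<open>?w\<close>, are
  orthonormal functions on a set of |G| points. A finite \<open>S\<close> is taken because
  finiteness of the set of all classes is a consequence.\<close>

lemma sum_class_dim_squared_le:
  assumes "finite S" "S \<subseteq> sectors"
  shows "(\<Sum>\<sigma>\<in>S. class_dim G \<sigma> * class_dim G \<sigma>) \<le> ord_G"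
proof -
  let ?w = "\<lambda>p. complex_of_real (sqrt (real (class_dim G (fst p)) / real ord_G))"
  let ?q = "\<lambda>p g. ?w p * class_rep (fst p) g $$ snd p"
  have fin: "finite (class_indices S)" using assms(1) by (auto simp: class_indices_def)
  have "orthonormal_on (carrier G) (class_indices S) ?q"
    unfolding orthonormal_on_def
  proof (intro ballI)
    fix p q assume pq: "p \<in> class_indices S" "q \<in> class_indices S"
    have d: "0 < class_dim G (fst p)" using pq assms(2) class_dim_pos by (auto simp: class_indices_def)
    have "inner_on (carrier G) (?q p) (?q q) = ?w p * (cnj (?w q) *
        (if p = q then of_real (real ord_G / real (class_dim G (fst p))) else 0))"
      by (simp only: inner_on_scale_left inner_on_scale_right class_functions_orthogonal[OF assms(2) pq])
    also have "\<dots> = of_bool (p = q)"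
    proof (cases "p = q")
      case True
      let ?r = "real (class_dim G (fst p)) / real ord_G"
      have "?w p * (cnj (?w p) * of_real (real ord_G / real (class_dim G (fst p)))) =
          of_real (sqrt ?r * (sqrt ?r * (real ord_G / real (class_dim G (fst p)))))"
        by (simp only: complex_cnj_complex_of_real of_real_mult)
      also have "sqrt ?r * (sqrt ?r * (real ord_G / real (class_dim G (fst p)))) =
          ?r * (real ord_G / real (class_dim G (fst p)))"
        by (simp only: mult.assoc[symmetric] real_sqrt_mult_self) simp
      also have "\<dots> = 1" using d ord_G_pos by simp
      finally show ?thesis using True by simp
    qed simp
    finally show "inner_on (carrier G) (?q p) (?q q) = of_bool (p = q)" .
  qed
  from orthonormal_card_le[OF finite_carrier fin this] show ?thesis
    using assms(1) by (simp add: class_indices_def card_SigmaI)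
qed

text \<open>Each class contributes at least 1 to the sum of squared dimensions, so no finite set of
  classes has more than |G| members. Without finiteness the sums in \<open>kappa\<close>,
  \<open>kappa'\<close> and \<open>kappa_A\<close> would be 0 by convention.\<close>

lemma finite_sectors: "finite sectors"
proof -
  have "card S \<le> ord_G" if S: "finite S" "S \<subseteq> sectors" for S
  proof -
    have "1 \<le> class_dim G \<sigma> * class_dim G \<sigma>" if "\<sigma> \<in> S" for \<sigma>
      using class_dim_pos[of \<sigma>] that S(2) by auto
    then have "(\<Sum>\<sigma>\<in>S. 1) \<le> (\<Sum>\<sigma>\<in>S. class_dim G \<sigma> * class_dim G \<sigma>)" by (intro sum_mono)
    then show ?thesis using sum_class_dim_squared_le[OF S] by simp
  qed
  then show ?thesis using finite_if_finite_subsets_card_bdd[of sectors ord_G] by blast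
qed

lemma class_dim_le: "\<sigma> \<in> sectors \<Longrightarrow> class_dim G \<sigma> \<le> ord_G"
proof -
  assume s: "\<sigma> \<in> sectors"
  have "class_dim G \<sigma> \<le> class_dim G \<sigma> * class_dim G \<sigma>" using class_dim_pos[OF s] by simp
  also have "\<dots> \<le> ord_G" using sum_class_dim_squared_le[of "{\<sigma>}"] s by simp
  finally show ?thesis .
qed

section \<open>Characters and multiplicities\<close>

text \<open>Traces are invariant under equivalence, so \<open>V\<close> may be replaced by the
  representative of its class; each of the d diagonal entries then contributes |G| / d.\<close>

lemma character_orthogonality:
  assumes V: "V \<in> irreps G c" and s: "\<sigma> \<in> sectors"
  shows "(\<Sum>g\<in>carrier G. mat_trace (V g) * cnj (mat_trace (class_rep \<sigma> g))) = (if V \<in> \<sigma> then of_nat ord_G else 0)"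
proof -
  obtain \<tau> where t: "\<tau> \<in> sectors" "rep_equiv G V (class_rep \<tau>)" using class_exists[OF V] by blast
  have Vt: "V \<in> \<sigma> \<longleftrightarrow> \<tau> = \<sigma>"
  proof
    assume "V \<in> \<sigma>"
    then have "rep_equiv G V (class_rep \<sigma>)" using class_mem_iff s V by blast
    then show "\<tau> = \<sigma>" using t s class_rep_inj rep_equiv_sym rep_equiv_trans by blast
  next
    assume "\<tau> = \<sigma>"
    then show "V \<in> \<sigma>" using t class_mem_iff s V by blast
  qed
  let ?D = "class_dim G"
  have "mat_trace (V g) = mat_trace (class_rep \<tau> g)" if "g \<in> carrier G" for g
    using t(2) that mat_trace_similar unfolding rep_equiv_def by blast
  then have "(\<Sum>g\<in>carrier G. mat_trace (V g) * cnj (mat_trace (class_rep \<sigma> g))) =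
      (\<Sum>g\<in>carrier G. mat_trace (class_rep \<tau> g) * cnj (mat_trace (class_rep \<sigma> g)))" by simp
  also have "\<dots> = (\<Sum>g\<in>carrier G. \<Sum>i<?D \<tau>. \<Sum>k<?D \<sigma>. class_rep \<tau> g $$ (i, i) * cnj (class_rep \<sigma> g $$ (k, k)))"
    by (intro sum.cong refl)
      (simp add: mat_trace_def sum_product carrier_matD(1)[OF class_rep_carrier[OF t(1)]]
        carrier_matD(1)[OF class_rep_carrier[OF s]])
  also have "\<dots> = (\<Sum>i<?D \<tau>. \<Sum>k<?D \<sigma>. \<Sum>g\<in>carrier G. class_rep \<tau> g $$ (i, i) * cnj (class_rep \<sigma> g $$ (k, k)))"
    by (subst sum.swap, intro sum.cong refl, rule sum.swap)
  also have "\<dots> = (\<Sum>i<?D \<tau>. \<Sum>k<?D \<sigma>. if \<tau> = \<sigma> \<and> i = k then of_real (real ord_G / real (?D \<tau>)) else 0)"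
    by (intro sum.cong refl) (simp add: class_orthogonality[OF t(1) s])
  also have "\<dots> = (if \<tau> = \<sigma> then of_nat ord_G else 0)"
    using class_dim_pos[OF s] by auto
  finally show ?thesis by (simp add: Vt)
qed

lemma direct_sum_character:
  assumes "set Vs \<subseteq> irreps G c" "rep_equiv G U (direct_sum Vs)" "\<sigma> \<in> sectors"
  shows "(\<Sum>g\<in>carrier G. mat_trace (U g) * cnj (mat_trace (class_rep \<sigma> g))) =
    of_nat (ord_G * length (filter (\<lambda>V. V \<in> \<sigma>) Vs))"
proof -
  have "mat_trace (U g) = (\<Sum>V\<leftarrow>Vs. mat_trace (V g))" if g: "g \<in> carrier G" for g
  proof -
    have "mat_trace (U g) = mat_trace (direct_sum Vs g)"
      using assms(2) g mat_trace_similar unfolding rep_equiv_def by blast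
    also have "\<dots> = (\<Sum>V\<leftarrow>Vs. mat_trace (V g))"
      unfolding direct_sum_def
      by (subst mat_trace_diag_block) (use irreps_dims[OF _ g] assms(1) in \<open>auto simp: o_def subset_iff\<close>)
    finally show ?thesis .
  qed
  then have "(\<Sum>g\<in>carrier G. mat_trace (U g) * cnj (mat_trace (class_rep \<sigma> g))) =
      (\<Sum>g\<in>carrier G. (\<Sum>V\<leftarrow>Vs. mat_trace (V g)) * cnj (mat_trace (class_rep \<sigma> g)))" by simp
  also have "\<dots> = of_nat (ord_G * length (filter (\<lambda>V. V \<in> \<sigma>) Vs))"
    using assms(1)
  proof (induction Vs)
    case (Cons V Vs)
    then show ?case
      using character_orthogonality[of V \<sigma>] assms(3) by (auto simp: algebra_simps sum.distrib)
  qed simp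
  finally show ?thesis .
qed

text \<open>The character sum depends on \<open>U\<close> alone, so every decomposition has the same
  number of summands in \<sigma>. This uniqueness is what the definite description in
  \<open>multiplicity_in\<close> requires.\<close>

lemma multiplicity_eq:
  assumes "set Vs \<subseteq> irreps G c" "rep_equiv G U (direct_sum Vs)" "\<sigma> \<in> sectors"
  shows "multiplicity_in G c U \<sigma> = length (filter (\<lambda>V. V \<in> \<sigma>) Vs)"
  unfolding multiplicity_in_def
proof (rule the_equality)
  fix k assume "\<exists>Vs. set Vs \<subseteq> irreps G c \<and> rep_equiv G U (direct_sum Vs) \<and> k = length (filter (\<lambda>V. V \<in> \<sigma>) Vs)"
  then obtain Ws where W: "set Ws \<subseteq> irreps G c" "rep_equiv G U (direct_sum Ws)"
    "k = length (filter (\<lambda>V. V \<in> \<sigma>) Ws)" by blast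
  have "ord_G * k = ord_G * length (filter (\<lambda>V. V \<in> \<sigma>) Vs)"
    using direct_sum_character[OF W(1,2) assms(3)] direct_sum_character[OF assms] W(3)
    by (simp only: of_nat_eq_iff)
  then show "k = length (filter (\<lambda>V. V \<in> \<sigma>) Vs)" using ord_G_pos by simp
qed (use assms in blast)

section \<open>Coordinates adapted to a decomposition\<close>

text \<open>\<open>L\<close> counts the irreducible summands, \<open>cls k\<close> is the class of
  the \<open>k\<close>-th one, and \<open>T x k\<close> is the \<open>k\<close>-th block of
  \<open>mat_adjoint P\<close> applied to \<open>x\<close>. Hiding the unitary change of basis in a
  function \<open>T\<close> keeps block offsets out of all later estimates. The character formula is
  recorded here because it is read off from the same decomposition; it later gives the
  multiplicities in the presence of an ancilla.\<close>

lemma irreducible_coordinates: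
  assumes U: "proj_rep G c n U"
  shows "\<exists>L cls T. (\<forall>k<L. cls k \<in> sectors) \<and>
    (\<forall>\<sigma>\<in>sectors. card {k. k < L \<and> cls k = \<sigma>} = multiplicity_in G c U \<sigma>) \<and>
    (\<forall>\<sigma>\<in>sectors. of_nat (ord_G * multiplicity_in G c U \<sigma>) =
       (\<Sum>g\<in>carrier G. mat_trace (U g) * cnj (mat_trace (class_rep \<sigma> g)))) \<and>
    (\<forall>x y. (\<Sum>i<n. cnj (x i) * y i) =
       (\<Sum>k<(L::nat). \<Sum>a<class_dim G (cls k). cnj (T x k a) * T y k a)) \<and>
    (\<forall>g\<in>carrier G. \<forall>x y. quad n (\<lambda>i j. U g $$ (i, j)) x y =
       (\<Sum>k<L. quad (class_dim G (cls k)) (\<lambda>a b. class_rep (cls k) g $$ (a, b)) (T x k) (T y k))) \<and>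
    (\<forall>z. \<exists>y. \<forall>k<L. \<forall>a<class_dim G (cls k). T y k a = z k a)"
proof -
  have R: "class_rep ` sectors \<subseteq> irreps G c" using class_rep_irrep by blast
  have "\<exists>V\<in>class_rep ` sectors. rep_equiv G X V" if "X \<in> irreps G c" for X
    using class_exists[OF that] by blast
  from unitary_decomposition[OF U R this] obtain Vs P where Vs: "set Vs \<subseteq> class_rep ` sectors"
    and w: "\<And>g. g \<in> carrier G \<Longrightarrow> similar_mat_wit (U g) (direct_sum Vs g) P (mat_adjoint P)" by blast
  have Vi: "set Vs \<subseteq> irreps G c" using Vs R by blast
  have eq: "rep_equiv G U (direct_sum Vs)" unfolding rep_equiv_def using w by blast
  define L where "L = length Vs"
  have "\<exists>\<sigma>\<in>sectors. Vs ! k = class_rep \<sigma>" if "k < L" for k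
    using subsetD[OF Vs nth_mem[of k Vs]] that unfolding L_def by blast
  then obtain cls where cls: "\<And>k. k < L \<Longrightarrow> cls k \<in> sectors" "\<And>k. k < L \<Longrightarrow> Vs ! k = class_rep (cls k)" by metis
  have mem: "Vs ! k \<in> \<sigma> \<longleftrightarrow> cls k = \<sigma>" if "k < L" "\<sigma> \<in> sectors" for k \<sigma>
  proof -
    have "Vs ! k \<in> \<sigma> \<longleftrightarrow> rep_equiv G (class_rep (cls k)) (class_rep \<sigma>)"
      unfolding cls(2)[OF that(1)] by (rule class_mem_iff[OF that(2) class_rep_irrep[OF cls(1)[OF that(1)]]])
    also have "\<dots> \<longleftrightarrow> cls k = \<sigma>"
      using class_rep_inj[OF cls(1)[OF that(1)] that(2)] rep_equiv_refl[OF class_rep_irrep[OF that(2)]] by blast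
    finally show ?thesis .
  qed
  have mult: "card {k. k < L \<and> cls k = \<sigma>} = multiplicity_in G c U \<sigma>" if "\<sigma> \<in> sectors" for \<sigma>
    unfolding multiplicity_eq[OF Vi eq that] length_filter_conv_card
    using mem that by (intro arg_cong[where f = card]) (auto simp: L_def)
  note wd = similar_mat_witD2[OF proj_repD(2)[OF U] w]
  have P: "P \<in> carrier_mat n n" "P * mat_adjoint P = 1\<^sub>m n" "mat_adjoint P * P = 1\<^sub>m n"
    using wd[OF one_closed one_closed] by auto
  define ds where "ds = map (rep_dim G) Vs"
  have dsk: "ds ! k = class_dim G (cls k)" if "k < L" for k
    using that cls[OF that] by (simp add: ds_def L_def class_dim_eq)
  have dr: "map dim_row (map (\<lambda>V. V g) Vs) = ds" if "g \<in> carrier G" for g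
    unfolding ds_def using irreps_dims(1)[OF _ that] Vi by (simp add: subset_iff)
  have n: "sum_list ds = n"
  proof -
    have "direct_sum Vs \<one> \<in> carrier_mat n n" by (rule wd(5)[OF one_closed one_closed])
    then have "dim_row (direct_sum Vs \<one>) = n" by simp
    then show ?thesis by (simp only: direct_sum_def dim_diag_block_mat dr[OF one_closed])
  qed
  define Pa where "Pa x p = (\<Sum>i<n. cnj (P $$ (i, p)) * x i)" for x :: "nat \<Rightarrow> complex" and p
  define T where "T x k a = Pa x (block_offset ds k + a)" for x k a
  have inner: "(\<Sum>i<n. cnj (x i) * y i) = (\<Sum>k<L. \<Sum>a<class_dim G (cls k). cnj (T x k a) * T y k a)" for x y
  proof -
    have q1: "quad n (\<lambda>i j. 1\<^sub>m n $$ (i, j)) x y = (\<Sum>i<n. cnj (x i) * y i)" for x y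
      unfolding quad_def by (intro sum.cong refl) (simp add: if_distrib if_distribR cong: if_cong)
    \<comment> \<open>Written as the form of P 1 P^*, the inner product is transformed by the same
      conjugation rule as the representation.\<close>
    have "(\<Sum>i<n. cnj (x i) * y i) = quad n (\<lambda>i j. (P * 1\<^sub>m n * mat_adjoint P) $$ (i, j)) x y"
      using P by (simp add: q1 right_mult_one_mat[OF P(1)])
    also have "\<dots> = (\<Sum>p<n. cnj (Pa x p) * Pa y p)"
      unfolding quad_conjugate[OF P(1) one_carrier_mat] q1 Pa_def ..
    also have "\<dots> = (\<Sum>k<L. \<Sum>a<ds ! k. cnj (T x k a) * T y k a)"
      unfolding n[symmetric] sum_blocks T_def by (simp add: ds_def L_def)
    also have "\<dots> = (\<Sum>k<L. \<Sum>a<class_dim G (cls k). cnj (T x k a) * T y k a)"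
      using dsk by (intro sum.cong refl) simp
    finally show ?thesis .
  qed
  have form: "quad n (\<lambda>i j. U g $$ (i, j)) x y =
      (\<Sum>k<L. quad (class_dim G (cls k)) (\<lambda>a b. class_rep (cls k) g $$ (a, b)) (T x k) (T y k))"
    if g: "g \<in> carrier G" for g x y
  proof -
    have "quad n (\<lambda>i j. U g $$ (i, j)) x y = quad n (\<lambda>p q. direct_sum Vs g $$ (p, q)) (Pa x) (Pa y)"
      unfolding wd(3)[OF g g] quad_conjugate[OF P(1) wd(5)[OF g g]] Pa_def ..
    also have "\<dots> = (\<Sum>k<L. quad (ds ! k) (\<lambda>a b. (Vs ! k) g $$ (a, b)) (T x k) (T y k))"
    proof -
      have sq: "dim_col A = dim_row A" if "A \<in> set (map (\<lambda>V. V g) Vs)" for A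
        using that irreps_dims[OF _ g] Vi by (auto simp: subset_iff)
      show ?thesis
        using quad_diag_block[of "map (\<lambda>V. V g) Vs" "Pa x" "Pa y", OF sq, unfolded dr[OF g]] unfolding n direct_sum_def T_def
        by (simp add: L_def)
    qed
    also have "\<dots> = (\<Sum>k<L. quad (class_dim G (cls k)) (\<lambda>a b. class_rep (cls k) g $$ (a, b)) (T x k) (T y k))"
      by (intro sum.cong refl) (simp add: dsk cls(2))
    finally show ?thesis .
  qed
  have surj: "\<exists>y. \<forall>k<L. \<forall>a<class_dim G (cls k). T y k a = z k a" for z
  proof -
    obtain v where v: "\<forall>k<length ds. \<forall>a<ds ! k. v (block_offset ds k + a) = z k a"
      using block_function_exists by blast
    define y where "y i = (\<Sum>p<n. P $$ (i, p) * v p)" for i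
    have "Pa y q = v q" if q: "q < n" for q
    proof -
      have "Pa y q = (\<Sum>i<n. \<Sum>p<n. cnj (P $$ (i, q)) * P $$ (i, p) * v p)"
        unfolding Pa_def y_def by (simp add: sum_distrib_left mult.assoc)
      also have "\<dots> = (\<Sum>p<n. \<Sum>i<n. cnj (P $$ (i, q)) * P $$ (i, p) * v p)" by (rule sum.swap)
      also have "\<dots> = (\<Sum>p<n. (mat_adjoint P * P) $$ (q, p) * v p)"
      proof (intro sum.cong refl)
        fix p assume p: "p \<in> {..<n}"
        have "(mat_adjoint P * P) $$ (q, p) = (\<Sum>i<n. mat_adjoint P $$ (q, i) * P $$ (i, p))"
          using P(1) p q by (intro mult_index[of _ n n _ n]) simp_all
        then show "(\<Sum>i<n. cnj (P $$ (i, q)) * P $$ (i, p) * v p) = (mat_adjoint P * P) $$ (q, p) * v p"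
          using P(1) q by (simp add: sum_distrib_right del: index_mult_mat(1))
      qed
      also have "\<dots> = (\<Sum>p<n. if p = q then v p else 0)"
        unfolding P(3) using q by (intro sum.cong refl) auto
      finally show ?thesis using q by simp
    qed
    moreover have "block_offset ds k + a < n" if "k < length ds" "a < ds ! k" for k a
    proof -
      have "n = sum_list (take k ds) + sum_list (drop k ds)"
        unfolding n[symmetric] by (metis append_take_drop_id sum_list_append)
      also have "sum_list (drop k ds) = ds ! k + sum_list (drop (Suc k) ds)"
        using that(1) by (simp add: Cons_nth_drop_Suc[symmetric])
      finally show ?thesis using that(2) by (simp add: block_offset_def)
    qed
    ultimately show ?thesis
      using v dsk by (intro exI[of _ y]) (auto simp: T_def ds_def L_def)
  qed
  have char: "of_nat (ord_G * multiplicity_in G c U \<sigma>) =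
      (\<Sum>g\<in>carrier G. mat_trace (U g) * cnj (mat_trace (class_rep \<sigma> g)))" if "\<sigma> \<in> sectors" for \<sigma>
    unfolding direct_sum_character[OF Vi eq that] multiplicity_eq[OF Vi eq that] ..
  show ?thesis
    by (intro exI[of _ L] exI[of _ cls] exI[of _ T] conjI allI impI ballI)
      (use cls(1) mult char inner form surj in auto)
qed


lemma kappa_eq: "kappa G c U = (\<Sum>\<sigma>\<in>sectors.
    real (min (multiplicity_in G c U \<sigma>) (class_dim G \<sigma>)) * real (class_dim G \<sigma>) / real ord_G)"
  by (simp add: kappa_def)

lemma kappa_nonneg: "0 \<le> kappa G c U"
  unfolding kappa_eq by (intro sum_nonneg) simp

lemma sector_parseval:
  "(\<Sum>g\<in>carrier G. (cmod (\<Sum>\<sigma>\<in>sectors. \<Sum>a<class_dim G \<sigma>. \<Sum>b<class_dim G \<sigma>.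
      M \<sigma> a b * class_rep \<sigma> g $$ (a, b)))\<^sup>2) =
   (\<Sum>\<sigma>\<in>sectors. real ord_G / real (class_dim G \<sigma>) * (\<Sum>a<class_dim G \<sigma>. \<Sum>b<class_dim G \<sigma>. (cmod (M \<sigma> a b))\<^sup>2))"
proof -
  have s: "(\<Sum>p\<in>class_indices sectors. f (fst p) (fst (snd p)) (snd (snd p))) =
      (\<Sum>\<sigma>\<in>sectors. \<Sum>a<class_dim G \<sigma>. \<Sum>b<class_dim G \<sigma>. f \<sigma> a b)"
    for f :: "('g \<Rightarrow> complex mat) set \<Rightarrow> nat \<Rightarrow> nat \<Rightarrow> 'x::comm_monoid_add"
    unfolding class_indices_def
    by (simp add: sum.Sigma sum.cartesian_product case_prod_beta finite_sectors)
  have fin: "finite (class_indices sectors)" by (simp add: class_indices_def finite_sectors)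
  have "(\<Sum>g\<in>carrier G. (cmod (\<Sum>p\<in>class_indices sectors.
        M (fst p) (fst (snd p)) (snd (snd p)) * class_rep (fst p) g $$ snd p))\<^sup>2) =
      (\<Sum>p\<in>class_indices sectors. real ord_G / real (class_dim G (fst p)) *
        (cmod (M (fst p) (fst (snd p)) (snd (snd p))))\<^sup>2)"
    by (rule parseval_orthogonal[OF fin class_functions_orthogonal[OF order.refl]])
  then show ?thesis
    using s[of "\<lambda>\<sigma> a b. M \<sigma> a b * class_rep \<sigma> _ $$ (a, b)"]
      s[of "\<lambda>\<sigma> a b. real ord_G / real (class_dim G \<sigma>) * (cmod (M \<sigma> a b))\<^sup>2"]
    by (simp add: sum_distrib_left)
qed

text \<open>\<open>K \<sigma>\<close> is the set of copies of \<sigma>. These copies share the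
  matrix \<open>class_rep \<sigma> g\<close>, so summing over them first collects all dependence on
  the two vectors into one coefficient matrix per class, to which \<open>sector_parseval\<close>
  applies.\<close>

lemma sector_coordinates:
  assumes U: "proj_rep G c n U"
  shows "\<exists>K T. (\<forall>\<sigma>\<in>sectors. finite (K \<sigma>) \<and> card (K \<sigma>) = multiplicity_in G c U \<sigma>) \<and>
    (\<forall>x y. (\<Sum>i<n. cnj (x i) * y i) =
       (\<Sum>\<sigma>\<in>sectors. \<Sum>a<class_dim G \<sigma>. \<Sum>k\<in>K \<sigma>. cnj (T x k a) * T y k a)) \<and>
    (\<forall>x y. (\<Sum>g\<in>carrier G. (cmod (quad n (\<lambda>i j. U g $$ (i, j)) x y))\<^sup>2) =
       (\<Sum>\<sigma>\<in>sectors. real ord_G / real (class_dim G \<sigma>) *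
          (\<Sum>a<class_dim G \<sigma>. \<Sum>b<class_dim G \<sigma>. (cmod (\<Sum>k\<in>K \<sigma>. cnj (T x k a) * T y k b))\<^sup>2))) \<and>
    (\<forall>z. \<exists>y. \<forall>\<sigma>\<in>sectors. \<forall>k\<in>K \<sigma>. \<forall>a<class_dim G \<sigma>. T y (k::nat) a = z \<sigma> k a)"
proof -
  let ?D = "class_dim G"
  obtain L cls and T :: "(nat \<Rightarrow> complex) \<Rightarrow> nat \<Rightarrow> nat \<Rightarrow> complex" where cls: "\<forall>k<L. cls k \<in> sectors"
    and card: "\<forall>\<sigma>\<in>sectors. card {k. k < L \<and> cls k = \<sigma>} = multiplicity_in G c U \<sigma>"
    and inner: "\<forall>x y. (\<Sum>i<n. cnj (x i) * y i) = (\<Sum>k<(L::nat). \<Sum>a<?D (cls k). cnj (T x k a) * T y k a)"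
    and form: "\<forall>g\<in>carrier G. \<forall>x y. quad n (\<lambda>i j. U g $$ (i, j)) x y =
       (\<Sum>k<L. quad (?D (cls k)) (\<lambda>a b. class_rep (cls k) g $$ (a, b)) (T x k) (T y k))"
    and surj: "\<forall>z. \<exists>y. \<forall>k<L. \<forall>a<?D (cls k). T y k a = z k a"
    using irreducible_coordinates[OF U] by (elim exE conjE) (rule that)
  define K where "K \<sigma> = {k. k < L \<and> cls k = \<sigma>}" for \<sigma>
  have group: "(\<Sum>k<L. f k (cls k)) = (\<Sum>\<sigma>\<in>sectors. \<Sum>k\<in>K \<sigma>. f k \<sigma>)"
    for f :: "nat \<Rightarrow> ('g \<Rightarrow> complex mat) set \<Rightarrow> complex"
  proof -
    have "(\<Sum>k<L. f k (cls k)) = (\<Sum>\<sigma>\<in>sectors. \<Sum>k\<in>{k \<in> {..<L}. cls k = \<sigma>}. f k (cls k))"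
      by (rule sum.group[symmetric]) (use cls finite_sectors in auto)
    also have "\<dots> = (\<Sum>\<sigma>\<in>sectors. \<Sum>k\<in>K \<sigma>. f k \<sigma>)"
      by (intro sum.cong) (auto simp: K_def)
    finally show ?thesis .
  qed
  have A2: "(\<Sum>i<n. cnj (x i) * y i) = (\<Sum>\<sigma>\<in>sectors. \<Sum>a<?D \<sigma>. \<Sum>k\<in>K \<sigma>. cnj (T x k a) * T y k a)" for x y
  proof -
    have "(\<Sum>i<n. cnj (x i) * y i) = (\<Sum>\<sigma>\<in>sectors. \<Sum>k\<in>K \<sigma>. \<Sum>a<?D \<sigma>. cnj (T x k a) * T y k a)"
      using inner group[of "\<lambda>k \<sigma>. \<Sum>a<?D \<sigma>. cnj (T x k a) * T y k a"] by simp
    also have "\<dots> = (\<Sum>\<sigma>\<in>sectors. \<Sum>a<?D \<sigma>. \<Sum>k\<in>K \<sigma>. cnj (T x k a) * T y k a)"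
      by (intro sum.cong refl sum.swap)
    finally show ?thesis .
  qed
  have A3: "(\<Sum>g\<in>carrier G. (cmod (quad n (\<lambda>i j. U g $$ (i, j)) x y))\<^sup>2) =
       (\<Sum>\<sigma>\<in>sectors. real ord_G / real (?D \<sigma>) *
          (\<Sum>a<?D \<sigma>. \<Sum>b<?D \<sigma>. (cmod (\<Sum>k\<in>K \<sigma>. cnj (T x k a) * T y k b))\<^sup>2))" for x y
  proof -
    have "quad n (\<lambda>i j. U g $$ (i, j)) x y = (\<Sum>\<sigma>\<in>sectors. \<Sum>a<?D \<sigma>. \<Sum>b<?D \<sigma>.
        (\<Sum>k\<in>K \<sigma>. cnj (T x k a) * T y k b) * class_rep \<sigma> g $$ (a, b))" if g: "g \<in> carrier G" for g
    proof -
      have "quad n (\<lambda>i j. U g $$ (i, j)) x y =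
          (\<Sum>\<sigma>\<in>sectors. \<Sum>k\<in>K \<sigma>. quad (?D \<sigma>) (\<lambda>a b. class_rep \<sigma> g $$ (a, b)) (T x k) (T y k))"
        using form g group[of "\<lambda>k \<sigma>. quad (?D \<sigma>) (\<lambda>a b. class_rep \<sigma> g $$ (a, b)) (T x k) (T y k)"] by simp
      also have "\<dots> = (\<Sum>\<sigma>\<in>sectors. \<Sum>a<?D \<sigma>. \<Sum>k\<in>K \<sigma>. \<Sum>b<?D \<sigma>.
          cnj (T x k a) * class_rep \<sigma> g $$ (a, b) * T y k b)"
        unfolding quad_def by (intro sum.cong refl sum.swap)
      also have "\<dots> = (\<Sum>\<sigma>\<in>sectors. \<Sum>a<?D \<sigma>. \<Sum>b<?D \<sigma>. \<Sum>k\<in>K \<sigma>.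
          cnj (T x k a) * class_rep \<sigma> g $$ (a, b) * T y k b)"
        by (intro sum.cong refl sum.swap)
      also have "\<dots> = (\<Sum>\<sigma>\<in>sectors. \<Sum>a<?D \<sigma>. \<Sum>b<?D \<sigma>.
          (\<Sum>k\<in>K \<sigma>. cnj (T x k a) * T y k b) * class_rep \<sigma> g $$ (a, b))"
        by (intro sum.cong refl) (simp add: sum_distrib_left sum_distrib_right mult_ac)
      finally show ?thesis .
    qed
    then show ?thesis
      using sector_parseval[of "\<lambda>\<sigma> a b. \<Sum>k\<in>K \<sigma>. cnj (T x k a) * T y k b"] by simp
  qed
  have A4: "\<exists>y. \<forall>\<sigma>\<in>sectors. \<forall>k\<in>K \<sigma>. \<forall>a<?D \<sigma>. T y k a = z \<sigma> k a" for z
  proof -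
    from spec[OF surj, of "\<lambda>k a. z (cls k) k a"]
    obtain y where "\<forall>k<L. \<forall>a<?D (cls k). T y k a = z (cls k) k a" by blast
    then show ?thesis by (intro exI[of _ y]) (auto simp: K_def)
  qed
  have A1: "\<forall>\<sigma>\<in>sectors. finite (K \<sigma>) \<and> card (K \<sigma>) = multiplicity_in G c U \<sigma>"
    using card by (simp add: K_def)
  show ?thesis
  proof (rule exI[of _ K], rule exI[of _ T], intro conjI)
    show "\<forall>z. \<exists>y. \<forall>\<sigma>\<in>sectors. \<forall>k\<in>K \<sigma>. \<forall>a<?D \<sigma>. T y k a = z \<sigma> k a" by (rule allI) (rule A4)
  qed (use A1 A2 A3 in simp_all)
qed

section \<open>The two bounds on the orbit of a vector\<close>

text \<open>Within a class, \<open>trace_rank_bound\<close> bounds the squared trace by min(m, d)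
  times the squared Frobenius norm. Inserting d / |G| and its inverse before Cauchy--Schwarz over
  the classes makes one factor sum to \<kappa> and the other to the orbit sum.\<close>

lemma overlap_le_kappa:
  assumes U: "proj_rep G c n U"
  shows "(cmod (\<Sum>i<n. cnj (x i) * y i))\<^sup>2 \<le>
    kappa G c U * (\<Sum>g\<in>carrier G. (cmod (quad n (\<lambda>i j. U g $$ (i, j)) x y))\<^sup>2)"
proof -
  let ?D = "class_dim G" and ?m = "multiplicity_in G c U"
  obtain K and T :: "(nat \<Rightarrow> complex) \<Rightarrow> nat \<Rightarrow> nat \<Rightarrow> complex"
    where K: "\<forall>\<sigma>\<in>sectors. finite (K \<sigma>) \<and> card (K \<sigma>) = ?m \<sigma>"
    and inner: "\<forall>x y. (\<Sum>i<n. cnj (x i) * y i) =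
       (\<Sum>\<sigma>\<in>sectors. \<Sum>a<?D \<sigma>. \<Sum>k\<in>K \<sigma>. cnj (T x k a) * T y k a)"
    and form: "\<forall>x y. (\<Sum>g\<in>carrier G. (cmod (quad n (\<lambda>i j. U g $$ (i, j)) x y))\<^sup>2) =
       (\<Sum>\<sigma>\<in>sectors. real ord_G / real (?D \<sigma>) *
          (\<Sum>a<?D \<sigma>. \<Sum>b<?D \<sigma>. (cmod (\<Sum>k\<in>K \<sigma>. cnj (T x k a) * T y k b))\<^sup>2))"
    using sector_coordinates[OF U] by (elim exE conjE) (rule that)
  define M where "M \<sigma> a b = (\<Sum>k\<in>K \<sigma>. cnj (T x k a) * T y k b)" for \<sigma> a b
  define s where "s \<sigma> = (\<Sum>a<?D \<sigma>. \<Sum>b<?D \<sigma>. (cmod (M \<sigma> a b))\<^sup>2)" for \<sigma>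
  let ?r = "\<lambda>\<sigma>. real (min (?m \<sigma>) (?D \<sigma>))"
  have s0: "0 \<le> s \<sigma>" for \<sigma> unfolding s_def by (intro sum_nonneg) simp
  have tr: "cmod (\<Sum>a<?D \<sigma>. M \<sigma> a a) \<le>
      sqrt ((?r \<sigma> * real (?D \<sigma>) / real ord_G) * (real ord_G / real (?D \<sigma>) * s \<sigma>))" if "\<sigma> \<in> sectors" for \<sigma>
  proof -
    have "(cmod (\<Sum>a<?D \<sigma>. M \<sigma> a a))\<^sup>2 \<le> ?r \<sigma> * s \<sigma>"
      using trace_rank_bound[of "{..<?D \<sigma>}" "K \<sigma>" "\<lambda>k a. cnj (T x k a)" "\<lambda>k a. T y k a"] K that
      by (simp add: M_def s_def)
    also have "?r \<sigma> * s \<sigma> = (?r \<sigma> * real (?D \<sigma>) / real ord_G) * (real ord_G / real (?D \<sigma>) * s \<sigma>)"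
      using class_dim_pos[OF that] ord_G_pos by simp
    finally show ?thesis by (rule real_le_rsqrt)
  qed
  have "cmod (\<Sum>i<n. cnj (x i) * y i) = cmod (\<Sum>\<sigma>\<in>sectors. \<Sum>a<?D \<sigma>. M \<sigma> a a)"
    using inner by (simp add: M_def)
  also have "\<dots> \<le> (\<Sum>\<sigma>\<in>sectors. sqrt ((?r \<sigma> * real (?D \<sigma>) / real ord_G) * (real ord_G / real (?D \<sigma>) * s \<sigma>)))"
    by (rule order.trans[OF norm_sum]) (intro sum_mono tr)
  finally have "(cmod (\<Sum>i<n. cnj (x i) * y i))\<^sup>2 \<le>
      (\<Sum>\<sigma>\<in>sectors. sqrt ((?r \<sigma> * real (?D \<sigma>) / real ord_G) * (real ord_G / real (?D \<sigma>) * s \<sigma>)))\<^sup>2"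
    by (rule power_mono) simp
  also have "\<dots> \<le> (\<Sum>\<sigma>\<in>sectors. ?r \<sigma> * real (?D \<sigma>) / real ord_G) *
      (\<Sum>\<sigma>\<in>sectors. real ord_G / real (?D \<sigma>) * s \<sigma>)"
    using s0 by (intro cauchy_schwarz_sum) simp_all
  also have "\<dots> = kappa G c U * (\<Sum>g\<in>carrier G. (cmod (quad n (\<lambda>i j. U g $$ (i, j)) x y))\<^sup>2)"
    using form by (simp add: kappa_eq s_def M_def)
  finally show ?thesis .
qed

text \<open>In a class of dimension \<open>d\<close> and multiplicity \<open>m\<close> the optimal vector is spread over
  \<open>min m d\<close> copies, with a different basis vector in each copy and squared weight proportional
  to \<open>d\<close> on each.\<close>

lemma optimal_vector_exists:
  assumes U: "proj_rep G c n U" and n: "0 < n"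
  shows "\<exists>y. (\<Sum>i<n. (cmod (y i))\<^sup>2) = 1 \<and> (\<forall>x.
    kappa G c U * (\<Sum>g\<in>carrier G. (cmod (quad n (\<lambda>i j. U g $$ (i, j)) x y))\<^sup>2) \<le> (\<Sum>i<n. (cmod (x i))\<^sup>2))"
proof -
  let ?D = "class_dim G" and ?m = "multiplicity_in G c U" and ?k = "kappa G c U"
  obtain K and T :: "(nat \<Rightarrow> complex) \<Rightarrow> nat \<Rightarrow> nat \<Rightarrow> complex"
    where K: "\<forall>\<sigma>\<in>sectors. finite (K \<sigma>) \<and> card (K \<sigma>) = ?m \<sigma>"
    and inner: "\<forall>x y. (\<Sum>i<n. cnj (x i) * y i) =
       (\<Sum>\<sigma>\<in>sectors. \<Sum>a<?D \<sigma>. \<Sum>k\<in>K \<sigma>. cnj (T x k a) * T y k a)"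
    and form: "\<forall>x y. (\<Sum>g\<in>carrier G. (cmod (quad n (\<lambda>i j. U g $$ (i, j)) x y))\<^sup>2) =
       (\<Sum>\<sigma>\<in>sectors. real ord_G / real (?D \<sigma>) *
          (\<Sum>a<?D \<sigma>. \<Sum>b<?D \<sigma>. (cmod (\<Sum>k\<in>K \<sigma>. cnj (T x k a) * T y k b))\<^sup>2))"
    and surj: "\<forall>z. \<exists>y. \<forall>\<sigma>\<in>sectors. \<forall>k\<in>K \<sigma>. \<forall>a<?D \<sigma>. T y k a = z \<sigma> k a"
    using sector_coordinates[OF U] by (elim exE conjE) (rule that)
  have norm: "(\<Sum>i<n. (cmod (x i))\<^sup>2) = (\<Sum>\<sigma>\<in>sectors. \<Sum>a<?D \<sigma>. \<Sum>k\<in>K \<sigma>. (cmod (T x k a))\<^sup>2)" for x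
  proof -
    have "complex_of_real (\<Sum>i<n. (cmod (x i))\<^sup>2) = (\<Sum>i<n. cnj (x i) * x i)"
      by (simp add: complex_norm_square mult.commute del: of_real_power)
    also have "\<dots> = complex_of_real (\<Sum>\<sigma>\<in>sectors. \<Sum>a<?D \<sigma>. \<Sum>k\<in>K \<sigma>. (cmod (T x k a))\<^sup>2)"
      unfolding inner[rule_format] by (simp add: complex_norm_square mult.commute del: of_real_power)
    finally show ?thesis by (simp only: of_real_eq_iff)
  qed
  \<comment> \<open>The upper bound itself excludes \<kappa> = 0: the overlap of the all-ones vector
    with itself is \<open>n\<close>.\<close>
  have kpos: "0 < ?k"
  proof (rule ccontr)
    assume "\<not> 0 < ?k"
    then have "?k = 0" using kappa_nonneg[of U] by simp
    moreover have "(cmod (\<Sum>i<n. cnj 1 * 1))\<^sup>2 \<le>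
        ?k * (\<Sum>g\<in>carrier G. (cmod (quad n (\<lambda>i j. U g $$ (i, j)) (\<lambda>_. 1) (\<lambda>_. 1)))\<^sup>2)"
      using overlap_le_kappa[OF U, of "\<lambda>_. 1" "\<lambda>_. 1"] .
    ultimately show False using n by simp
  qed
  have "\<exists>e. bij_betw e {0..<card (K \<sigma>)} (K \<sigma>)" if "\<sigma> \<in> sectors" for \<sigma>
    using ex_bij_betw_nat_finite K that by blast
  then obtain e where e: "\<And>\<sigma>. \<sigma> \<in> sectors \<Longrightarrow> bij_betw (e \<sigma>) {0..<card (K \<sigma>)} (K \<sigma>)" by metis
  have eK: "e \<sigma> b \<in> K \<sigma>" if "\<sigma> \<in> sectors" "b < ?m \<sigma>" for \<sigma> b
    using bij_betw_apply[OF e[OF that(1)], of b] K that by simp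
  \<comment> \<open>This modulus serves twice: the min(m, d) occupied places of every class add up
    to norm 1, and in the orbit sum it cancels |G| / d and leaves 1 / \<kappa>.\<close>
  define \<beta> where "\<beta> \<sigma> = complex_of_real (sqrt (real (?D \<sigma>) / (?k * real ord_G)))" for \<sigma>
  have \<beta>: "(cmod (\<beta> \<sigma>))\<^sup>2 = real (?D \<sigma>) / (?k * real ord_G)" for \<sigma>
    using kpos by (simp add: \<beta>_def)
  \<comment> \<open>Basis vector \<open>a\<close> is placed in copy \<open>e \<sigma> a\<close>. The
    guard \<open>a < ?m \<sigma>\<close> is essential, because beyond the multiplicity
    \<open>e \<sigma> a\<close> is an unspecified number that could be an index already in
    use.\<close>
  from spec[OF surj, of "\<lambda>\<sigma> k a. if k = e \<sigma> a then if a < ?m \<sigma> then \<beta> \<sigma> else 0 else 0"]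
  obtain y where y: "\<forall>\<sigma>\<in>sectors. \<forall>k\<in>K \<sigma>. \<forall>a<?D \<sigma>.
      T y k a = (if k = e \<sigma> a then if a < ?m \<sigma> then \<beta> \<sigma> else 0 else 0)"
    by blast
  have y1: "(\<Sum>i<n. (cmod (y i))\<^sup>2) = 1"
  proof -
    have "(\<Sum>i<n. (cmod (y i))\<^sup>2) = (\<Sum>\<sigma>\<in>sectors. \<Sum>a<?D \<sigma>. if a < ?m \<sigma> then (cmod (\<beta> \<sigma>))\<^sup>2 else 0)"
      unfolding norm
    proof (intro sum.cong refl)
      fix \<sigma> a assume s: "\<sigma> \<in> sectors" and a: "a \<in> {..<?D \<sigma>}"
      have "(\<Sum>k\<in>K \<sigma>. (cmod (T y k a))\<^sup>2) =
          (\<Sum>k\<in>K \<sigma>. if k = e \<sigma> a then if a < ?m \<sigma> then (cmod (\<beta> \<sigma>))\<^sup>2 else 0 else 0)"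
        using y s a by (intro sum.cong refl) simp
      also have "\<dots> = (if a < ?m \<sigma> then (cmod (\<beta> \<sigma>))\<^sup>2 else 0)"
        using K s eK[OF s, of a] by (simp add: sum.delta)
      finally show "(\<Sum>k\<in>K \<sigma>. (cmod (T y k a))\<^sup>2) = (if a < ?m \<sigma> then (cmod (\<beta> \<sigma>))\<^sup>2 else 0)" .
    qed
    also have "\<dots> = (\<Sum>\<sigma>\<in>sectors. real (min (?m \<sigma>) (?D \<sigma>)) * (real (?D \<sigma>) / (?k * real ord_G)))"
    proof (intro sum.cong refl)
      fix \<sigma>
      have "{..<?D \<sigma>} \<inter> {a. a < ?m \<sigma>} = {..<min (?m \<sigma>) (?D \<sigma>)}" by auto
      then show "(\<Sum>a<?D \<sigma>. if a < ?m \<sigma> then (cmod (\<beta> \<sigma>))\<^sup>2 else 0) =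
          real (min (?m \<sigma>) (?D \<sigma>)) * (real (?D \<sigma>) / (?k * real ord_G))"
        by (simp add: sum.If_cases \<beta>)
    qed
    also have "\<dots> = ?k / ?k"
      unfolding kappa_eq sum_divide_distrib by (intro sum.cong refl) (simp add: mult.commute)
    finally show ?thesis using kpos by simp
  qed
  have bound: "?k * (\<Sum>g\<in>carrier G. (cmod (quad n (\<lambda>i j. U g $$ (i, j)) x y))\<^sup>2) \<le> (\<Sum>i<n. (cmod (x i))\<^sup>2)" for x
  proof -
    have "(\<Sum>b<?D \<sigma>. (cmod (\<Sum>k\<in>K \<sigma>. cnj (T x k a) * T y k b))\<^sup>2) \<le>
        real (?D \<sigma>) / (?k * real ord_G) * (\<Sum>k\<in>K \<sigma>. (cmod (T x k a))\<^sup>2)"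
      if s: "\<sigma> \<in> sectors" for \<sigma> a
    proof -
      have "(\<Sum>b<?D \<sigma>. (cmod (\<Sum>k\<in>K \<sigma>. cnj (T x k a) * T y k b))\<^sup>2) =
          (\<Sum>b<?D \<sigma>. if b < ?m \<sigma> then (cmod (\<beta> \<sigma>))\<^sup>2 * (cmod (T x (e \<sigma> b) a))\<^sup>2 else 0)"
      proof (intro sum.cong refl)
        fix b assume b: "b \<in> {..<?D \<sigma>}"
        have "(\<Sum>k\<in>K \<sigma>. cnj (T x k a) * T y k b) =
            (\<Sum>k\<in>K \<sigma>. if k = e \<sigma> b then if b < ?m \<sigma> then cnj (T x k a) * \<beta> \<sigma> else 0 else 0)"
          using y s b by (intro sum.cong refl) simp
        also have "\<dots> = (if b < ?m \<sigma> then cnj (T x (e \<sigma> b) a) * \<beta> \<sigma> else 0)"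
          using K s eK[OF s, of b] by (simp add: sum.delta)
        finally show "(cmod (\<Sum>k\<in>K \<sigma>. cnj (T x k a) * T y k b))\<^sup>2 =
            (if b < ?m \<sigma> then (cmod (\<beta> \<sigma>))\<^sup>2 * (cmod (T x (e \<sigma> b) a))\<^sup>2 else 0)"
          by (simp add: norm_mult power_mult_distrib)
      qed
      also have "\<dots> = (\<Sum>b\<in>{..<?D \<sigma>} \<inter> {b. b < ?m \<sigma>}. (cmod (\<beta> \<sigma>))\<^sup>2 * (cmod (T x (e \<sigma> b) a))\<^sup>2)"
        by (simp add: sum.If_cases)
      \<comment> \<open>Enlarging the sum to all copies discards only a nonnegative amount: the part
        of \<open>x\<close> in copies that \<open>y\<close> leaves empty.\<close>
      also have "\<dots> \<le> (\<Sum>b\<in>{0..<card (K \<sigma>)}. (cmod (\<beta> \<sigma>))\<^sup>2 * (cmod (T x (e \<sigma> b) a))\<^sup>2)"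
        using K s by (intro sum_mono2) auto
      also have "\<dots> = (\<Sum>k\<in>K \<sigma>. (cmod (\<beta> \<sigma>))\<^sup>2 * (cmod (T x k a))\<^sup>2)"
        by (rule sum.reindex_bij_betw[OF e[OF s]])
      finally show ?thesis by (simp add: \<beta> sum_distrib_left)
    qed
    then have "(\<Sum>g\<in>carrier G. (cmod (quad n (\<lambda>i j. U g $$ (i, j)) x y))\<^sup>2) \<le>
        (\<Sum>\<sigma>\<in>sectors. real ord_G / real (?D \<sigma>) * (\<Sum>a<?D \<sigma>.
          real (?D \<sigma>) / (?k * real ord_G) * (\<Sum>k\<in>K \<sigma>. (cmod (T x k a))\<^sup>2)))"
      unfolding form[rule_format] by (intro sum_mono mult_left_mono) auto
    also have "\<dots> = (\<Sum>\<sigma>\<in>sectors. (\<Sum>a<?D \<sigma>. \<Sum>k\<in>K \<sigma>. (cmod (T x k a))\<^sup>2) / ?k)"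
    proof (intro sum.cong refl)
      fix \<sigma> assume s: "\<sigma> \<in> sectors"
      show "real ord_G / real (?D \<sigma>) * (\<Sum>a<?D \<sigma>.
          real (?D \<sigma>) / (?k * real ord_G) * (\<Sum>k\<in>K \<sigma>. (cmod (T x k a))\<^sup>2)) =
          (\<Sum>a<?D \<sigma>. \<Sum>k\<in>K \<sigma>. (cmod (T x k a))\<^sup>2) / ?k"
        unfolding sum_distrib_left[symmetric] using class_dim_pos[OF s] ord_G_pos kpos by simp
    qed
    also have "\<dots> = (\<Sum>i<n. (cmod (x i))\<^sup>2) / ?k"
      unfolding norm sum_divide_distrib ..
    finally show ?thesis using kpos by (simp add: field_simps)
  qed
  show ?thesis using y1 bound by blast
qed

end

section \<open>Traces of positive semidefinite operators\<close>

lemma mult_mat_vec_inner: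
  assumes "A \<in> carrier_mat n n" "v \<in> carrier_vec n"
  shows "(A *\<^sub>v v) \<bullet>c v = quad n (\<lambda>i j. A $$ (i, j)) (\<lambda>i. v $ i) (\<lambda>i. v $ i)"
proof -
  have "(A *\<^sub>v v) \<bullet>c v = (\<Sum>i<n. (\<Sum>j<n. A $$ (i, j) * v $ j) * cnj (v $ i))"
    using assms by (simp add: scalar_prod_def lessThan_atLeast0)
  then show ?thesis by (simp add: quad_def sum_distrib_left sum_distrib_right mult_ac)
qed

lemma psd_iff_quad:
  "psd n A \<longleftrightarrow> A \<in> carrier_mat n n \<and> (\<forall>x. 0 \<le> quad n (\<lambda>i j. A $$ (i, j)) x x)"
proof (intro iffI conjI allI)
  fix x assume A: "psd n A"
  then have "0 \<le> (A *\<^sub>v vec n x) \<bullet>c vec n x" by (simp add: psd_def)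
  also have "\<dots> = quad n (\<lambda>i j. A $$ (i, j)) (\<lambda>i. vec n x $ i) (\<lambda>i. vec n x $ i)"
    using A by (intro mult_mat_vec_inner) (simp_all add: psd_def)
  also have "\<dots> = quad n (\<lambda>i j. A $$ (i, j)) x x" unfolding quad_def by (intro sum.cong refl) simp
  finally show "0 \<le> quad n (\<lambda>i j. A $$ (i, j)) x x" .
next
  assume "A \<in> carrier_mat n n \<and> (\<forall>x. 0 \<le> quad n (\<lambda>i j. A $$ (i, j)) x x)"
  then show "psd n A" unfolding psd_def using mult_mat_vec_inner by metis
qed (simp add: psd_def)

lemma psd_rank_one_sum:
  assumes "psd n A"
  shows "\<exists>m v. \<forall>i<n. \<forall>j<n. A $$ (i, j) = (\<Sum>k<(m::nat). v k i * cnj (v k j))"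
  using psd_kernel_rank_one_sum[of n "\<lambda>i j. A $$ (i, j)"] assms by (simp add: psd_iff_quad)

definition act :: "nat \<Rightarrow> complex mat \<Rightarrow> (nat \<Rightarrow> complex) \<Rightarrow> nat \<Rightarrow> complex" where
  "act n A y i = (\<Sum>j<n. A $$ (i, j) * y j)"

lemma quad_act: "quad n (\<lambda>i j. A $$ (i, j)) x y = (\<Sum>i<n. cnj (x i) * act n A y i)"
  by (simp add: quad_def act_def sum_distrib_left mult.assoc)

lemma quad_act_mult:
  assumes "A \<in> carrier_mat n n" "B \<in> carrier_mat n n"
  shows "quad n (\<lambda>i j. A $$ (i, j)) x (act n B y) = quad n (\<lambda>i j. (A * B) $$ (i, j)) x y"
proof -
  have "act n A (act n B y) i = act n (A * B) y i" if i: "i < n" for i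
  proof -
    have "act n A (act n B y) i = (\<Sum>k<n. \<Sum>j<n. A $$ (i, k) * B $$ (k, j) * y j)"
      by (simp add: act_def sum_distrib_left mult.assoc)
    also have "\<dots> = (\<Sum>j<n. \<Sum>k<n. A $$ (i, k) * B $$ (k, j) * y j)" by (rule sum.swap)
    also have "\<dots> = act n (A * B) y i"
      unfolding act_def using i
      by (intro sum.cong refl) (simp add: mult_index[OF assms] sum_distrib_right del: index_mult_mat(1))
    finally show ?thesis .
  qed
  then show ?thesis unfolding quad_act by simp
qed

lemma norm_act_unitary:
  assumes "unitary_mat n V"
  shows "(\<Sum>i<n. (cmod (act n V y i))\<^sup>2) = (\<Sum>i<n. (cmod (y i))\<^sup>2)"
proof -
  note V = unitary_matD[OF assms]
  have "complex_of_real (\<Sum>i<n. (cmod (act n V y i))\<^sup>2) = (\<Sum>i<n. cnj (act n V y i) * act n V y i)"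
    by (simp add: complex_norm_square mult.commute del: of_real_power)
  also have "\<dots> = (\<Sum>i<n. \<Sum>p<n. cnj (V $$ (i, p)) * cnj (y p) * act n V y i)"
    unfolding sum_distrib_right[symmetric]
    by (intro sum.cong refl arg_cong2[where f = "(*)"]) (simp add: act_def)
  also have "\<dots> = (\<Sum>p<n. \<Sum>i<n. cnj (V $$ (i, p)) * cnj (y p) * act n V y i)" by (rule sum.swap)
  also have "\<dots> = quad n (\<lambda>i j. mat_adjoint V $$ (i, j)) y (act n V y)"
    unfolding quad_def using V(1) by (intro sum.cong refl) simp
  also have "\<dots> = quad n (\<lambda>i j. 1\<^sub>m n $$ (i, j)) y y"
    using quad_act_mult[of "mat_adjoint V" n V] V by simp
  also have "\<dots> = (\<Sum>i<n. \<Sum>j<n. if j = i then cnj (y i) * y j else 0)"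
    unfolding quad_def by (intro sum.cong refl) simp
  also have "\<dots> = complex_of_real (\<Sum>i<n. (cmod (y i))\<^sup>2)"
    by (simp add: complex_norm_square mult.commute del: of_real_power)
  finally show ?thesis by (simp only: of_real_eq_iff)
qed

text \<open>Each pair of rank-one parts of the effect and of the state contributes the squared
  modulus of one matrix element of \<open>V\<close>. Inequalities for pairs of vectors thereby
  extend termwise to mixed states and effects of arbitrary rank.\<close>

lemma trace_rank_one_sums:
  assumes E: "E \<in> carrier_mat n n" and V: "V \<in> carrier_mat n n" and R: "R \<in> carrier_mat n n"
    and e: "\<And>i j. i < n \<Longrightarrow> j < n \<Longrightarrow> E $$ (i, j) = (\<Sum>a<(m::nat). u a i * cnj (u a j))"
    and r: "\<And>i j. i < n \<Longrightarrow> j < n \<Longrightarrow> R $$ (i, j) = (\<Sum>b<(l::nat). w b i * cnj (w b j))"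
  shows "mat_trace (E * V * R * mat_adjoint V) =
    of_real (\<Sum>a<m. \<Sum>b<l. (cmod (quad n (\<lambda>i j. V $$ (i, j)) (u a) (w b)))\<^sup>2)"
proof -
  have X: "V * R * mat_adjoint V \<in> carrier_mat n n" using V R by simp
  have VRV: "(V * R * mat_adjoint V) $$ (j, i) = (\<Sum>b<l. act n V (w b) j * cnj (act n V (w b) i))"
    if "i < n" "j < n" for i j
  proof -
    have "(V * R * mat_adjoint V) $$ (j, i) =
        (\<Sum>p<n. \<Sum>q<n. \<Sum>b<l. V $$ (j, p) * (w b p * cnj (w b q)) * cnj (V $$ (i, q)))"
      unfolding conj_index[OF V R that(2,1)]
      by (intro sum.cong refl) (simp add: r sum_distrib_left sum_distrib_right)
    also have "\<dots> = (\<Sum>p<n. \<Sum>b<l. \<Sum>q<n. V $$ (j, p) * (w b p * cnj (w b q)) * cnj (V $$ (i, q)))"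
      by (intro sum.cong refl sum.swap)
    also have "\<dots> = (\<Sum>b<l. \<Sum>p<n. \<Sum>q<n. V $$ (j, p) * (w b p * cnj (w b q)) * cnj (V $$ (i, q)))"
      by (rule sum.swap)
    also have "\<dots> = (\<Sum>b<l. act n V (w b) j * cnj (act n V (w b) i))"
      unfolding act_def cnj_sum sum_product by (intro sum.cong refl) (simp add: mult_ac)
    finally show ?thesis .
  qed
  have "E * V * R * mat_adjoint V = E * (V * R * mat_adjoint V)"
    using E V R by (simp add: assoc_mult_mat[of _ n n _ n _ n] mult_carrier_mat[of _ n n _ n])
  then have "mat_trace (E * V * R * mat_adjoint V) = (\<Sum>i<n. \<Sum>j<n. E $$ (i, j) * (V * R * mat_adjoint V) $$ (j, i))"
    using mat_trace_mult[OF E X] by simp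
  also have "\<dots> = (\<Sum>i<n. \<Sum>j<n. \<Sum>a<m. \<Sum>b<l.
      (cnj (u a j) * act n V (w b) j) * (u a i * cnj (act n V (w b) i)))"
    unfolding sum_product
    by (intro sum.cong refl) (simp add: e VRV sum_product mult_ac del: index_mult_mat(1))
  also have "\<dots> = (\<Sum>a<m. \<Sum>b<l. \<Sum>i<n. \<Sum>j<n.
      (cnj (u a j) * act n V (w b) j) * (u a i * cnj (act n V (w b) i)))" by (rule sum_swap4)
  also have "\<dots> = (\<Sum>a<m. \<Sum>b<l. quad n (\<lambda>i j. V $$ (i, j)) (u a) (w b) * cnj (quad n (\<lambda>i j. V $$ (i, j)) (u a) (w b)))"
  proof (intro sum.cong refl)
    fix a b
    let ?q = "quad n (\<lambda>i j. V $$ (i, j)) (u a) (w b)"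
    have "?q * cnj ?q = cnj ?q * ?q" by (rule mult.commute)
    also have "\<dots> = (\<Sum>i<n. \<Sum>j<n. (u a i * cnj (act n V (w b) i)) * (cnj (u a j) * act n V (w b) j))"
      unfolding quad_act cnj_sum sum_product by simp
    finally show "(\<Sum>i<n. \<Sum>j<n. (cnj (u a j) * act n V (w b) j) * (u a i * cnj (act n V (w b) i))) = ?q * cnj ?q"
      by (simp add: mult.commute)
  qed
  finally show ?thesis by (simp add: complex_norm_square del: of_real_power)
qed

lemma trace_psd_nonneg:
  assumes "psd n E" "psd n R" "V \<in> carrier_mat n n"
  shows "0 \<le> Re (mat_trace (E * V * R * mat_adjoint V))"
proof -
  obtain m u where u: "\<forall>i<n. \<forall>j<n. E $$ (i, j) = (\<Sum>k<(m::nat). u k i * cnj (u k j))"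
    using psd_rank_one_sum[OF assms(1)] by blast
  obtain l w where w: "\<forall>i<n. \<forall>j<n. R $$ (i, j) = (\<Sum>k<(l::nat). w k i * cnj (w k j))"
    using psd_rank_one_sum[OF assms(2)] by blast
  have c: "E \<in> carrier_mat n n" "R \<in> carrier_mat n n" using assms by (simp_all add: psd_def)
  have "mat_trace (E * V * R * mat_adjoint V) =
      of_real (\<Sum>a<m. \<Sum>b<l. (cmod (quad n (\<lambda>i j. V $$ (i, j)) (u a) (w b)))\<^sup>2)"
    by (rule trace_rank_one_sums[OF c(1) assms(3) c(2)]) (use u w in simp_all)
  then show ?thesis by (simp add: sum_nonneg)
qed

lemma finsum_mat_index:
  assumes "finite S" "\<And>g. g \<in> S \<Longrightarrow> E g \<in> carrier_mat n n"
  shows "finsum (module_mat TYPE(complex) n n) E S \<in> carrier_mat n n \<and>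
    (\<forall>i<n. \<forall>j<n. finsum (module_mat TYPE(complex) n n) E S $$ (i, j) = (\<Sum>g\<in>S. E g $$ (i, j)))"
proof -
  interpret M: abelian_group "module_mat TYPE(complex) n n" by (rule abelian_group_mat)
  show ?thesis
    using assms
  proof (induction S rule: finite_induct)
    case empty
    show ?case by (simp add: module_mat_simps)
  next
    case (insert g S)
    then have "finsum (module_mat TYPE(complex) n n) E (insert g S) =
        E g + finsum (module_mat TYPE(complex) n n) E S"
      by (subst M.finsum_insert) (auto simp: module_mat_simps)
    then show ?case using insert by auto
  qed
qed

context factor_system
begin

section \<open>Upper bound on the success probability\<close>

lemma povm_resolution:
  assumes "povm G n E0 E" "i < n" "j < n"
  shows "E0 $$ (i, j) + (\<Sum>g\<in>carrier G. E g $$ (i, j)) = (if i = j then 1 else 0)"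
proof -
  let ?S = "finsum (module_mat TYPE(complex) n n) E (carrier G)"
  have c: "?S \<in> carrier_mat n n" "?S $$ (i, j) = (\<Sum>g\<in>carrier G. E g $$ (i, j))"
    using finsum_mat_index[OF finite_carrier, of E n] assms by (auto simp: povm_def psd_def)
  have "(E0 + ?S) $$ (i, j) = (if i = j then 1 else 0)"
    using assms by (simp add: povm_def)
  then show ?thesis using c assms by simp
qed

text \<open>With the inconclusive outcome included the traces add up to that of the transformed
  state, which is 1; the inconclusive one is nonnegative and is dropped.\<close>

lemma povm_trace_sum_le:
  assumes E: "povm G n E0 E" and R: "density_op n R" and V: "unitary_mat n V"
  shows "(\<Sum>g\<in>carrier G. Re (mat_trace (E g * V * R * mat_adjoint V))) \<le> 1"
proof -
  note v = unitary_matD[OF V]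
  have Ec: "\<And>g. g \<in> carrier G \<Longrightarrow> E g \<in> carrier_mat n n" "E0 \<in> carrier_mat n n" and Rc: "R \<in> carrier_mat n n"
    using E R by (auto simp: povm_def psd_def density_op_def)
  let ?X = "V * R * mat_adjoint V"
  have X: "?X \<in> carrier_mat n n" using v(1) Rc by simp
  have tr: "mat_trace (A * V * R * mat_adjoint V) = (\<Sum>i<n. \<Sum>j<n. A $$ (i, j) * ?X $$ (j, i))"
    if A: "A \<in> carrier_mat n n" for A
  proof -
    have "A * V * R * mat_adjoint V = A * ?X"
      using A v(1) Rc by (simp add: assoc_mult_mat[of _ n n _ n _ n] mult_carrier_mat[of _ n n _ n])
    then show ?thesis using mat_trace_mult[OF A X] by simp
  qed
  have "mat_trace (E0 * V * R * mat_adjoint V) + (\<Sum>g\<in>carrier G. mat_trace (E g * V * R * mat_adjoint V)) =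
      (\<Sum>i<n. \<Sum>j<n. E0 $$ (i, j) * ?X $$ (j, i)) + (\<Sum>g\<in>carrier G. \<Sum>i<n. \<Sum>j<n. E g $$ (i, j) * ?X $$ (j, i))"
    by (simp add: tr Ec del: index_mult_mat(1))
  also have "(\<Sum>g\<in>carrier G. \<Sum>i<n. \<Sum>j<n. E g $$ (i, j) * ?X $$ (j, i)) =
      (\<Sum>i<n. \<Sum>g\<in>carrier G. \<Sum>j<n. E g $$ (i, j) * ?X $$ (j, i))" by (rule sum.swap)
  also have "\<dots> = (\<Sum>i<n. \<Sum>j<n. \<Sum>g\<in>carrier G. E g $$ (i, j) * ?X $$ (j, i))"
    by (intro sum.cong refl sum.swap)
  also have "(\<Sum>i<n. \<Sum>j<n. E0 $$ (i, j) * ?X $$ (j, i)) + \<dots> =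
      (\<Sum>i<n. \<Sum>j<n. (E0 $$ (i, j) + (\<Sum>g\<in>carrier G. E g $$ (i, j))) * ?X $$ (j, i))"
    by (simp add: sum.distrib distrib_right sum_distrib_right del: index_mult_mat(1))
  also have "\<dots> = (\<Sum>i<n. \<Sum>j<n. if j = i then ?X $$ (j, i) else 0)"
    by (intro sum.cong refl) (simp add: povm_resolution[OF E] del: index_mult_mat(1))
  also have "\<dots> = mat_trace ?X"
    unfolding mat_trace_def carrier_matD(1)[OF X] by (simp del: index_mult_mat(1))
  also have "\<dots> = mat_trace (mat_adjoint V * (V * R))"
    using v(1) Rc by (intro mat_trace_commute[of _ n n]) simp_all
  also have "mat_adjoint V * (V * R) = mat_adjoint V * V * R"
    using v(1) Rc by (intro assoc_mult_mat[symmetric, of _ n n _ n _ n]) simp_all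
  also have "\<dots> = R" using v Rc by simp
  also have "mat_trace R = 1" using R by (simp add: density_op_def)
  finally have "Re (mat_trace (E0 * V * R * mat_adjoint V) +
      (\<Sum>g\<in>carrier G. mat_trace (E g * V * R * mat_adjoint V))) = 1" by simp
  moreover have "0 \<le> Re (mat_trace (E0 * V * R * mat_adjoint V))"
    using E R v(1) by (intro trace_psd_nonneg[of n]) (simp_all add: povm_def density_op_def)
  ultimately show ?thesis by simp
qed

lemma success_plus_error:
  "success_prob G V R E + error_prob G V R E =
    1 / real ord_G * (\<Sum>g\<in>carrier G. \<Sum>h\<in>carrier G. Re (mat_trace (E g * V h * R * mat_adjoint (V h))))"
proof -
  have "(\<Sum>h\<in>carrier G. Re (mat_trace (E g * V h * R * mat_adjoint (V h)))) =
      Re (mat_trace (E g * V g * R * mat_adjoint (V g))) +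
      (\<Sum>h\<in>carrier G - {g}. Re (mat_trace (E g * V h * R * mat_adjoint (V h))))" if "g \<in> carrier G" for g
    by (rule sum.remove[OF finite_carrier that])
  then show ?thesis
    unfolding success_prob_def error_prob_def by (simp add: sum.distrib distrib_left)
qed

lemma success_plus_error_le:
  assumes V: "proj_rep G c n V" and E: "povm G n E0 E" and R: "density_op n R"
  shows "success_prob G V R E + error_prob G V R E \<le> 1"
proof -
  have "(\<Sum>g\<in>carrier G. \<Sum>h\<in>carrier G. Re (mat_trace (E g * V h * R * mat_adjoint (V h)))) =
      (\<Sum>h\<in>carrier G. \<Sum>g\<in>carrier G. Re (mat_trace (E g * V h * R * mat_adjoint (V h))))" by (rule sum.swap)
  also have "\<dots> \<le> (\<Sum>h\<in>carrier G. 1)"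
    by (intro sum_mono povm_trace_sum_le[OF E R] proj_repD(1)[OF V])
  finally show ?thesis unfolding success_plus_error using ord_G_pos by (simp add: field_simps)
qed

text \<open>\<open>overlap_le_kappa\<close> at the vector \<open>act n (V g) y\<close>: right
  translation permutes the orbit, and the phases \<open>c h g\<close> disappear under the
  modulus.\<close>

lemma overlap_orbit:
  assumes V: "proj_rep G c n V" and g: "g \<in> carrier G"
  shows "(cmod (quad n (\<lambda>i j. V g $$ (i, j)) x y))\<^sup>2 \<le>
    kappa G c V * (\<Sum>h\<in>carrier G. (cmod (quad n (\<lambda>i j. V h $$ (i, j)) x y))\<^sup>2)"
proof -
  note v = proj_repD[OF V]
  have "(cmod (quad n (\<lambda>i j. V g $$ (i, j)) x y))\<^sup>2 = (cmod (\<Sum>i<n. cnj (x i) * act n (V g) y i))\<^sup>2"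
    by (simp only: quad_act)
  also have "\<dots> \<le> kappa G c V * (\<Sum>h\<in>carrier G. (cmod (quad n (\<lambda>i j. V h $$ (i, j)) x (act n (V g) y)))\<^sup>2)"
    by (rule overlap_le_kappa[OF V])
  also have "(\<Sum>h\<in>carrier G. (cmod (quad n (\<lambda>i j. V h $$ (i, j)) x (act n (V g) y)))\<^sup>2) =
      (\<Sum>h\<in>carrier G. (cmod (quad n (\<lambda>i j. V (h \<otimes> g) $$ (i, j)) x y))\<^sup>2)"
  proof (intro sum.cong refl)
    fix h assume h: "h \<in> carrier G"
    have "quad n (\<lambda>i j. V h $$ (i, j)) x (act n (V g) y) = quad n (\<lambda>i j. (V h * V g) $$ (i, j)) x y"
      by (rule quad_act_mult[OF v(2)[OF h] v(2)[OF g]])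
    also have "\<dots> = quad n (\<lambda>i j. c h g * V (h \<otimes> g) $$ (i, j)) x y"
      unfolding v(3)[OF h g] using v(2)[OF m_closed[OF h g]] by (intro quad_cong) simp
    also have "\<dots> = c h g * quad n (\<lambda>i j. V (h \<otimes> g) $$ (i, j)) x y"
      by (simp add: quad_def sum_distrib_left mult_ac)
    finally show "(cmod (quad n (\<lambda>i j. V h $$ (i, j)) x (act n (V g) y)))\<^sup>2 =
        (cmod (quad n (\<lambda>i j. V (h \<otimes> g) $$ (i, j)) x y))\<^sup>2"
      using v(4)[OF h g] by (simp add: norm_mult)
  qed
  also have "\<dots> = (\<Sum>h\<in>carrier G. (cmod (quad n (\<lambda>i j. V h $$ (i, j)) x y))\<^sup>2)"
    by (rule sum_right_translate[OF g, of "\<lambda>g. (cmod (quad n (\<lambda>i j. V g $$ (i, j)) x y))\<^sup>2"])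
  finally show ?thesis .
qed

text \<open>The orbit inequality is summed over the rank-one parts of \<open>E g\<close> and of the
  input state. Its left side keeps only the correct hypothesis, while its right side runs over all
  hypotheses and so collects success and error together.\<close>

lemma success_le_kappa:
  assumes V: "proj_rep G c n V" and E: "povm G n E0 E" and R: "density_op n R"
  shows "success_prob G V R E \<le> kappa G c V * (success_prob G V R E + error_prob G V R E)"
proof -
  note v = proj_repD(2)[OF V]
  have Rp: "psd n R" "R \<in> carrier_mat n n" using R by (simp_all add: density_op_def psd_def)
  obtain l w where w: "\<forall>i<n. \<forall>j<n. R $$ (i, j) = (\<Sum>k<(l::nat). w k i * cnj (w k j))"
    using psd_rank_one_sum[OF Rp(1)] by blast
  have "Re (mat_trace (E g * V g * R * mat_adjoint (V g))) \<le>
      kappa G c V * (\<Sum>h\<in>carrier G. Re (mat_trace (E g * V h * R * mat_adjoint (V h))))"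
    if g: "g \<in> carrier G" for g
  proof -
    have Ep: "psd n (E g)" "E g \<in> carrier_mat n n" using E g by (simp_all add: povm_def psd_def)
    obtain m u where u: "\<forall>i<n. \<forall>j<n. E g $$ (i, j) = (\<Sum>k<(m::nat). u k i * cnj (u k j))"
      using psd_rank_one_sum[OF Ep(1)] by blast
    have tr: "Re (mat_trace (E g * V h * R * mat_adjoint (V h))) =
        (\<Sum>a<m. \<Sum>b<l. (cmod (quad n (\<lambda>i j. V h $$ (i, j)) (u a) (w b)))\<^sup>2)" if h: "h \<in> carrier G" for h
    proof -
      have "mat_trace (E g * V h * R * mat_adjoint (V h)) =
          of_real (\<Sum>a<m. \<Sum>b<l. (cmod (quad n (\<lambda>i j. V h $$ (i, j)) (u a) (w b)))\<^sup>2)"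
        by (rule trace_rank_one_sums[OF Ep(2) v[OF h] Rp(2)]) (use u w in simp_all)
      then show ?thesis by simp
    qed
    have "(\<Sum>a<m. \<Sum>b<l. (cmod (quad n (\<lambda>i j. V g $$ (i, j)) (u a) (w b)))\<^sup>2) \<le>
        (\<Sum>a<m. \<Sum>b<l. kappa G c V * (\<Sum>h\<in>carrier G. (cmod (quad n (\<lambda>i j. V h $$ (i, j)) (u a) (w b)))\<^sup>2))"
      by (intro sum_mono overlap_orbit[OF V g])
    also have "\<dots> = kappa G c V * (\<Sum>a<m. \<Sum>b<l. \<Sum>h\<in>carrier G. (cmod (quad n (\<lambda>i j. V h $$ (i, j)) (u a) (w b)))\<^sup>2)"
      by (simp add: sum_distrib_left)
    also have "(\<Sum>a<m. \<Sum>b<l. \<Sum>h\<in>carrier G. (cmod (quad n (\<lambda>i j. V h $$ (i, j)) (u a) (w b)))\<^sup>2) =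
        (\<Sum>a<m. \<Sum>h\<in>carrier G. \<Sum>b<l. (cmod (quad n (\<lambda>i j. V h $$ (i, j)) (u a) (w b)))\<^sup>2)"
      by (intro sum.cong refl sum.swap)
    also have "\<dots> = (\<Sum>h\<in>carrier G. \<Sum>a<m. \<Sum>b<l. (cmod (quad n (\<lambda>i j. V h $$ (i, j)) (u a) (w b)))\<^sup>2)"
      by (rule sum.swap)
    finally show ?thesis by (simp add: tr g)
  qed
  then have "(\<Sum>g\<in>carrier G. Re (mat_trace (E g * V g * R * mat_adjoint (V g)))) \<le>
      (\<Sum>g\<in>carrier G. kappa G c V * (\<Sum>h\<in>carrier G. Re (mat_trace (E g * V h * R * mat_adjoint (V h)))))"
    by (intro sum_mono)
  also have "\<dots> = kappa G c V * (\<Sum>g\<in>carrier G. \<Sum>h\<in>carrier G. Re (mat_trace (E g * V h * R * mat_adjoint (V h))))"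
    by (simp add: sum_distrib_left)
  finally have "success_prob G V R E \<le> 1 / real ord_G *
      (kappa G c V * (\<Sum>g\<in>carrier G. \<Sum>h\<in>carrier G. Re (mat_trace (E g * V h * R * mat_adjoint (V h)))))"
    unfolding success_prob_def by (rule mult_left_mono) simp
  then show ?thesis unfolding success_plus_error by (simp add: mult_ac)
qed

section \<open>An optimal strategy\<close>

text \<open>The input is the pure state of the optimal vector \<open>y\<close>, and the defining
  inequality of \<open>y\<close> is used twice: for arbitrary x it makes \<open>E0\<close> positive,
  and for \<open>x = act n (V h) y\<close> it bounds the conclusive probability under hypothesis
  \<open>h\<close> by \<open>t\<close>. Since the success probability is known exactly, this bound
  on the total already controls the error.\<close>

lemma strategy_exists:
  assumes V: "proj_rep G c n V" and n: "0 < n" and t: "0 \<le> t" "t \<le> 1"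
  shows "\<exists>R E0 E. density_op n R \<and> povm G n E0 E \<and>
    success_prob G V R E = t * kappa G c V \<and> error_prob G V R E \<le> t * (1 - kappa G c V)"
proof -
  let ?k = "kappa G c V"
  note v = proj_repD[OF V]
  obtain y where y1: "(\<Sum>i<n. (cmod (y i))\<^sup>2) = 1"
    and y: "\<And>x. ?k * (\<Sum>g\<in>carrier G. (cmod (quad n (\<lambda>i j. V g $$ (i, j)) x y))\<^sup>2) \<le> (\<Sum>i<n. (cmod (x i))\<^sup>2)"
    using optimal_vector_exists[OF V n] by blast
  \<comment> \<open>The scale t \<kappa> is absorbed into the vectors \<open>u g\<close>, so that
    every effect has the form u u^* required by \<open>trace_rank_one_sums\<close>.\<close>
  define s where "s = complex_of_real (sqrt (t * ?k))"
  have s: "s * cnj s = of_real (t * ?k)" "(cmod s)\<^sup>2 = t * ?k"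
    using t(1) kappa_nonneg[of V] by (simp_all add: s_def flip: of_real_mult)
  define u where "u g i = s * act n (V g) y i" for g i
  define R where "R = mat n n (\<lambda>(i, j). y i * cnj (y j))"
  define E where "E g = mat n n (\<lambda>(i, j). u g i * cnj (u g j))" for g
  define E0 where "E0 = mat n n (\<lambda>(i, j). (if i = j then 1 else 0) - (\<Sum>g\<in>carrier G. u g i * cnj (u g j)))"
  have rank1: "quad n (\<lambda>i j. z i * cnj (z j)) x x = of_real ((cmod (\<Sum>i<n. cnj (x i) * z i))\<^sup>2)" for x z
  proof -
    let ?c = "\<Sum>i<n. cnj (x i) * z i"
    have "of_real ((cmod ?c)\<^sup>2) = ?c * cnj ?c" by (rule complex_norm_square)
    also have "\<dots> = quad n (\<lambda>i j. z i * cnj (z j)) x x"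
      unfolding cnj_sum sum_product quad_def by (simp add: mult_ac)
    finally show ?thesis by simp
  qed
  have psd1: "psd n (mat n n (\<lambda>(i, j). z i * cnj (z j)))" for z
  proof -
    have "quad n (\<lambda>i j. mat n n (\<lambda>(i, j). z i * cnj (z j)) $$ (i, j)) x x = of_real ((cmod (\<Sum>i<n. cnj (x i) * z i))\<^sup>2)" for x
      unfolding rank1[symmetric] by (rule quad_cong) simp
    then show ?thesis by (simp add: psd_iff_quad less_eq_complex_def)
  qed
  have qu: "(\<Sum>i<n. cnj (x i) * u g i) = s * quad n (\<lambda>i j. V g $$ (i, j)) x y" for x g
    by (simp add: u_def quad_act sum_distrib_left mult_ac)
  have "mat_trace R = of_real (\<Sum>i<n. (cmod (y i))\<^sup>2)"
    by (simp add: R_def mat_trace_def complex_norm_square del: of_real_power)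
  then have R: "density_op n R" using psd1[of y] y1 by (simp add: density_op_def R_def)
  have E0: "psd n E0"
  proof -
    have "0 \<le> quad n (\<lambda>i j. E0 $$ (i, j)) x x" for x
    proof -
      have "quad n (\<lambda>i j. E0 $$ (i, j)) x x =
          quad n (\<lambda>i j. (if i = j then 1 else 0) - (\<Sum>g\<in>carrier G. u g i * cnj (u g j))) x x"
        by (rule quad_cong) (simp add: E0_def)
      also have "\<dots> = quad n (\<lambda>i j. if i = j then 1 else 0) x x - quad n (\<lambda>i j. \<Sum>g\<in>carrier G. u g i * cnj (u g j)) x x"
        by (simp add: quad_def algebra_simps sum_subtractf)
      also have "quad n (\<lambda>i j. if i = j then 1 else 0) x x = (\<Sum>i<n. \<Sum>j<n. if j = i then cnj (x i) * x j else 0)"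
        unfolding quad_def by (intro sum.cong refl) simp
      also have "\<dots> = of_real (\<Sum>i<n. (cmod (x i))\<^sup>2)"
        by (simp add: complex_norm_square mult.commute del: of_real_power)
      also have "quad n (\<lambda>i j. \<Sum>g\<in>carrier G. u g i * cnj (u g j)) x x =
          (\<Sum>i<n. \<Sum>j<n. \<Sum>g\<in>carrier G. cnj (x i) * (u g i * cnj (u g j)) * x j)"
        by (simp add: quad_def sum_distrib_left sum_distrib_right)
      also have "\<dots> = (\<Sum>i<n. \<Sum>g\<in>carrier G. \<Sum>j<n. cnj (x i) * (u g i * cnj (u g j)) * x j)"
        by (intro sum.cong refl sum.swap)
      also have "\<dots> = (\<Sum>g\<in>carrier G. quad n (\<lambda>i j. u g i * cnj (u g j)) x x)"
        unfolding quad_def by (rule sum.swap)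
      also have "\<dots> = of_real (t * (?k * (\<Sum>g\<in>carrier G. (cmod (quad n (\<lambda>i j. V g $$ (i, j)) x y))\<^sup>2)))"
        unfolding rank1 qu norm_mult power_mult_distrib s(2) by (simp add: sum_distrib_left mult.assoc)
      finally have e: "quad n (\<lambda>i j. E0 $$ (i, j)) x x = of_real ((\<Sum>i<n. (cmod (x i))\<^sup>2) -
          t * (?k * (\<Sum>g\<in>carrier G. (cmod (quad n (\<lambda>i j. V g $$ (i, j)) x y))\<^sup>2)))" by simp
      let ?F = "?k * (\<Sum>g\<in>carrier G. (cmod (quad n (\<lambda>i j. V g $$ (i, j)) x y))\<^sup>2)"
      have "0 \<le> ?F" using kappa_nonneg[of V] by (intro mult_nonneg_nonneg sum_nonneg) simp_all
      then have "t * ?F \<le> 1 * ?F" using t by (intro mult_right_mono) simp_all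
      then show ?thesis using y[of x] unfolding e by (simp add: less_eq_complex_def)
    qed
    then show ?thesis by (simp add: psd_iff_quad E0_def)
  qed
  have Ec: "E g \<in> carrier_mat n n" for g by (simp add: E_def)
  have Rc: "R \<in> carrier_mat n n" by (simp add: R_def)
  let ?S = "finsum (module_mat TYPE(complex) n n) E (carrier G)"
  have S: "?S \<in> carrier_mat n n" "\<forall>i<n. \<forall>j<n. ?S $$ (i, j) = (\<Sum>g\<in>carrier G. E g $$ (i, j))"
    by (rule finsum_mat_index[OF finite_carrier Ec, THEN conjunct1],
        rule finsum_mat_index[OF finite_carrier Ec, THEN conjunct2])
  have "E0 + ?S = 1\<^sub>m n"
  proof (rule eq_matI)
    fix i j assume "i < dim_row (1\<^sub>m n :: complex mat)" "j < dim_col (1\<^sub>m n :: complex mat)"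
    then have "i < n" "j < n" by simp_all
    then show "(E0 + ?S) $$ (i, j) = 1\<^sub>m n $$ (i, j)"
      using S by (simp add: E0_def E_def)
  qed (use S(1) in \<open>simp_all add: E0_def\<close>)
  then have povm: "povm G n E0 E"
    using E0 psd1 by (simp add: povm_def E_def[abs_def])
  have tr: "Re (mat_trace (E g * V h * R * mat_adjoint (V h))) =
      t * ?k * (cmod (quad n (\<lambda>i j. V g $$ (i, j)) (act n (V h) y) y))\<^sup>2" if h: "h \<in> carrier G" for g h
  proof -
    have "mat_trace (E g * V h * R * mat_adjoint (V h)) =
        of_real (\<Sum>a<(1::nat). \<Sum>b<(1::nat). (cmod (quad n (\<lambda>i j. V h $$ (i, j)) (u g) y))\<^sup>2)"
      by (rule trace_rank_one_sums[OF Ec v(2)[OF h] Rc]) (simp_all add: E_def R_def)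
    then have "Re (mat_trace (E g * V h * R * mat_adjoint (V h))) = (cmod (quad n (\<lambda>i j. V h $$ (i, j)) (u g) y))\<^sup>2"
      by simp
    also have "quad n (\<lambda>i j. V h $$ (i, j)) (u g) y = cnj (\<Sum>i<n. cnj (act n (V h) y i) * u g i)"
      by (simp add: quad_act mult.commute)
    also have "\<dots> = cnj (s * quad n (\<lambda>i j. V g $$ (i, j)) (act n (V h) y) y)"
      by (simp only: qu)
    finally show ?thesis by (simp add: norm_mult power_mult_distrib s(2))
  qed
  have diag: "(cmod (quad n (\<lambda>i j. V g $$ (i, j)) (act n (V g) y) y))\<^sup>2 = 1" if g: "g \<in> carrier G" for g
  proof -
    have "quad n (\<lambda>i j. V g $$ (i, j)) (act n (V g) y) y = of_real (\<Sum>i<n. (cmod (act n (V g) y i))\<^sup>2)"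
      by (simp add: quad_act complex_norm_square mult.commute del: of_real_power)
    then show ?thesis by (simp add: norm_act_unitary[OF v(1)[OF g]] y1)
  qed
  have success: "success_prob G V R E = t * ?k"
    using ord_G_pos unfolding success_prob_def by (simp add: tr diag)
  have "success_prob G V R E + error_prob G V R E =
      1 / real ord_G * (\<Sum>h\<in>carrier G. t * (?k * (\<Sum>g\<in>carrier G. (cmod (quad n (\<lambda>i j. V g $$ (i, j)) (act n (V h) y) y))\<^sup>2)))"
    unfolding success_plus_error
    by (subst sum.swap) (simp add: tr sum_distrib_left mult.assoc)
  also have "\<dots> \<le> 1 / real ord_G * (\<Sum>h\<in>carrier G. t * 1)"
  proof (intro mult_left_mono sum_mono)
    fix h assume h: "h \<in> carrier G"
    show "?k * (\<Sum>g\<in>carrier G. (cmod (quad n (\<lambda>i j. V g $$ (i, j)) (act n (V h) y) y))\<^sup>2) \<le> 1"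
      using y[of "act n (V h) y"] norm_act_unitary[OF v(1)[OF h], of y] y1 by simp
  qed (use t in simp_all)
  also have "\<dots> = t" using ord_G_pos by simp
  finally have "error_prob G V R E \<le> t * (1 - ?k)" using success by (simp add: algebra_simps)
  then show ?thesis using R povm success by blast
qed

lemma is_P_max_kappa:
  assumes V: "proj_rep G c n V" and n: "0 < n" and m: "0 \<le> m"
  shows "is_P_max G n V m
    (if 1 - kappa G c V \<le> m then kappa G c V else kappa G c V / (1 - kappa G c V) * m)"
proof -
  let ?k = "kappa G c V"
  \<comment> \<open>The optimal measurement is weakened until its error bound
    \<open>t * (1 - ?k)\<close> fits the margin. The quotient is used only when
    \<open>m < 1 - ?k\<close>, where \<open>0 \<le> m\<close> makes the denominator
    positive.\<close>
  define t where "t = (if 1 - ?k \<le> m then 1 else m / (1 - ?k))"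
  have t: "0 \<le> t" "t \<le> 1" using m by (auto simp: t_def field_simps)
  have val: "(if 1 - ?k \<le> m then ?k else ?k / (1 - ?k) * m) = t * ?k" by (simp add: t_def)
  have err: "t * (1 - ?k) \<le> m" using m by (auto simp: t_def)
  obtain R E0 E where R: "density_op n R" "povm G n E0 E" and p: "success_prob G V R E = t * ?k"
    and e: "error_prob G V R E \<le> t * (1 - ?k)"
    using strategy_exists[OF V n t] by (elim exE conjE) (rule that)
  have "error_prob G V R E \<le> m" using e err by simp
  then have "t * ?k \<in> achievable_probs G n V m"
    unfolding achievable_probs_def mem_Collect_eq using R p[symmetric]
    by (intro exI[of _ R] exI[of _ E0] exI[of _ E] conjI)
  moreover have "q \<le> t * ?k" if mem: "q \<in> achievable_probs G n V m" for q
  proof -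
    obtain R E0 E where R: "density_op n R" and E: "povm G n E0 E" and q: "q = success_prob G V R E"
      and e: "error_prob G V R E \<le> m"
      using mem unfolding achievable_probs_def mem_Collect_eq by (elim exE conjE) (rule that)
    have up: "q \<le> ?k * (q + error_prob G V R E)" unfolding q by (rule success_le_kappa[OF V E R])
    show ?thesis
    proof (cases "1 - ?k \<le> m")
      case True
      have "?k * (q + error_prob G V R E) \<le> ?k * 1"
        using success_plus_error_le[OF V E R] kappa_nonneg[of V] unfolding q by (intro mult_left_mono)
      then show ?thesis using up True by (simp add: t_def)
    next
      case False
      then have "0 < 1 - ?k" using m by simp
      have "(1 - ?k) * q \<le> ?k * error_prob G V R E" using up by (simp add: algebra_simps)
      also have "\<dots> \<le> ?k * m" using e kappa_nonneg[of V] by (intro mult_left_mono)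
      finally have "q \<le> ?k * m / (1 - ?k)"
        using \<open>0 < 1 - ?k\<close> by (simp add: pos_le_divide_eq mult.commute)
      then show ?thesis using False by (simp add: t_def mult.commute)
    qed
  qed
  ultimately show ?thesis unfolding is_P_max_def val by blast
qed

end

section \<open>Ancillas\<close>

lemma sum_lessThan_mult:
  fixes f :: "nat \<Rightarrow> 'a::comm_monoid_add"
  shows "(\<Sum>s<n * r. f s) = (\<Sum>a<n. \<Sum>b<r. f (a * r + b))"
proof (induction n)
  case (Suc n)
  have "(\<Sum>s<Suc n * r. f s) = (\<Sum>s<n * r + r. f s)" by (simp add: add.commute)
  also have "\<dots> = (\<Sum>s<n * r. f s) + (\<Sum>b<r. f (n * r + b))" by (rule sum_lessThan_add)
  finally show ?case using Suc by simp
qed simp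

lemma tensor_one_carrier: "A \<in> carrier_mat n n \<Longrightarrow> tensor_mat A (1\<^sub>m r) \<in> carrier_mat (n * r) (n * r)"
  by (intro carrier_matI) (simp_all add: tensor_mat_def)

lemma tensor_one_index:
  assumes "A \<in> carrier_mat n n" "p < n * r" "q < n * r"
  shows "tensor_mat A (1\<^sub>m r) $$ (p, q) = A $$ (p div r, q div r) * of_bool (p mod r = q mod r)"
proof -
  have "0 < r" using assms(2) by (cases r) auto
  then show ?thesis using assms by (simp add: tensor_mat_def)
qed

lemma tensor_one_mult:
  assumes A: "A \<in> carrier_mat n n" and B: "B \<in> carrier_mat n n"
  shows "tensor_mat A (1\<^sub>m r) * tensor_mat B (1\<^sub>m r) = tensor_mat (A * B) (1\<^sub>m r)"
proof (rule eq_matI)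
  have AB: "A * B \<in> carrier_mat n n" using A B by simp
  note tc = tensor_one_carrier[OF A, of r] tensor_one_carrier[OF B, of r] tensor_one_carrier[OF AB, of r]
  fix p q assume "p < dim_row (tensor_mat (A * B) (1\<^sub>m r))" "q < dim_col (tensor_mat (A * B) (1\<^sub>m r))"
  then have pq: "p < n * r" "q < n * r" using tc by auto
  then have r: "0 < r" by (cases r) auto
  have d: "p div r < n" "q div r < n" using pq by (simp_all add: less_mult_imp_div_less)
  have "(tensor_mat A (1\<^sub>m r) * tensor_mat B (1\<^sub>m r)) $$ (p, q) =
      (\<Sum>s<n * r. tensor_mat A (1\<^sub>m r) $$ (p, s) * tensor_mat B (1\<^sub>m r) $$ (s, q))"
    by (rule mult_index[OF tc(1,2) pq])
  also have "\<dots> = (\<Sum>s<n * r. A $$ (p div r, s div r) * of_bool (p mod r = s mod r) *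
      (B $$ (s div r, q div r) * of_bool (s mod r = q mod r)))"
    using pq by (intro sum.cong refl) (simp add: tensor_one_index[OF A] tensor_one_index[OF B])
  also have "\<dots> = (\<Sum>a<n. \<Sum>b<r. if b = p mod r
      then A $$ (p div r, a) * B $$ (a, q div r) * of_bool (p mod r = q mod r) else 0)"
    unfolding sum_lessThan_mult using r by (intro sum.cong refl) auto
  also have "\<dots> = (\<Sum>a<n. A $$ (p div r, a) * B $$ (a, q div r)) * of_bool (p mod r = q mod r)"
    using r by (simp add: sum_distrib_right)
  also have "\<dots> = tensor_mat (A * B) (1\<^sub>m r) $$ (p, q)"
    unfolding tensor_one_index[OF AB pq] mult_index[OF A B d] ..
  finally show "(tensor_mat A (1\<^sub>m r) * tensor_mat B (1\<^sub>m r)) $$ (p, q) = tensor_mat (A * B) (1\<^sub>m r) $$ (p, q)" .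
qed (use A B in \<open>simp_all add: tensor_mat_def\<close>)

lemma tensor_one_adjoint:
  assumes A: "A \<in> carrier_mat n n"
  shows "mat_adjoint (tensor_mat A (1\<^sub>m r)) = tensor_mat (mat_adjoint A) (1\<^sub>m r)"
proof (rule eq_matI)
  have A': "mat_adjoint A \<in> carrier_mat n n" using A by simp
  note tc = tensor_one_carrier[OF A, of r] tensor_one_carrier[OF A', of r]
  fix p q assume "p < dim_row (tensor_mat (mat_adjoint A) (1\<^sub>m r))" "q < dim_col (tensor_mat (mat_adjoint A) (1\<^sub>m r))"
  then have pq: "p < n * r" "q < n * r" using tc by auto
  have d: "p div r < n" "q div r < n" using pq by (simp_all add: less_mult_imp_div_less)
  show "mat_adjoint (tensor_mat A (1\<^sub>m r)) $$ (p, q) = tensor_mat (mat_adjoint A) (1\<^sub>m r) $$ (p, q)"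
    unfolding tensor_one_index[OF A' pq]
    using pq d A tc(1) by (simp add: tensor_one_index[OF A pq(2,1)])
qed (use A in \<open>simp_all add: tensor_mat_def\<close>)

lemma tensor_one_one: "tensor_mat (1\<^sub>m n) (1\<^sub>m r) = (1\<^sub>m (n * r) :: complex mat)"
proof (rule eq_matI)
  fix p q assume "p < dim_row (1\<^sub>m (n * r) :: complex mat)" "q < dim_col (1\<^sub>m (n * r) :: complex mat)"
  then have pq: "p < n * r" "q < n * r" by auto
  have d: "p div r < n" "q div r < n" using pq by (simp_all add: less_mult_imp_div_less)
  have "p = q" if "p div r = q div r" "p mod r = q mod r"
    using that by (metis div_mult_mod_eq)
  then show "tensor_mat (1\<^sub>m n) (1\<^sub>m r) $$ (p, q) = (1\<^sub>m (n * r) :: complex mat) $$ (p, q)"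
    using pq d by (subst tensor_one_index[OF one_carrier_mat pq]) auto
qed (simp_all add: tensor_mat_def)

lemma tensor_one_smult:
  assumes A: "A \<in> carrier_mat n n"
  shows "tensor_mat (k \<cdot>\<^sub>m A) (1\<^sub>m r) = k \<cdot>\<^sub>m tensor_mat A (1\<^sub>m r)"
proof (rule eq_matI)
  have kA: "k \<cdot>\<^sub>m A \<in> carrier_mat n n" using A by simp
  note tc = tensor_one_carrier[OF A, of r]
  fix p q assume "p < dim_row (k \<cdot>\<^sub>m tensor_mat A (1\<^sub>m r))" "q < dim_col (k \<cdot>\<^sub>m tensor_mat A (1\<^sub>m r))"
  then have pq: "p < n * r" "q < n * r" using tc by auto
  have d: "p div r < n" "q div r < n" using pq by (simp_all add: less_mult_imp_div_less)
  show "tensor_mat (k \<cdot>\<^sub>m A) (1\<^sub>m r) $$ (p, q) = (k \<cdot>\<^sub>m tensor_mat A (1\<^sub>m r)) $$ (p, q)"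
    unfolding tensor_one_index[OF kA pq]
    using pq d A tc by (simp add: tensor_one_index[OF A pq])
qed (use A in \<open>simp_all add: tensor_mat_def\<close>)

lemma tensor_one_trace:
  assumes A: "A \<in> carrier_mat n n"
  shows "mat_trace (tensor_mat A (1\<^sub>m r)) = of_nat r * mat_trace A"
proof -
  have "mat_trace (tensor_mat A (1\<^sub>m r)) = (\<Sum>p<n * r. A $$ (p div r, p div r))"
    unfolding mat_trace_def using tensor_one_carrier[OF A, of r]
    by (intro sum.cong) (auto simp: tensor_one_index[OF A])
  also have "\<dots> = (\<Sum>a<n. \<Sum>b<r. A $$ (a, a))"
    unfolding sum_lessThan_mult by (intro sum.cong refl) auto
  also have "\<dots> = of_nat r * mat_trace A"
    using A by (simp add: mat_trace_def sum_distrib_left)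
  finally show ?thesis .
qed

context factor_system
begin

lemma proj_rep_with_ancilla:
  assumes "proj_rep G c n U"
  shows "proj_rep G c (n * r) (with_ancilla U r)"
proof -
  note u = unitary_matD[OF proj_repD(1)[OF assms]] and p = proj_repD[OF assms]
  have "unitary_mat (n * r) (with_ancilla U r g)" if g: "g \<in> carrier G" for g
  proof -
    have ua: "mat_adjoint (U g) \<in> carrier_mat n n" using u(1)[OF g] by simp
    show ?thesis
      unfolding unitary_mat_def with_ancilla_def tensor_one_adjoint[OF u(1)[OF g]]
        tensor_one_mult[OF u(1)[OF g] ua] tensor_one_mult[OF ua u(1)[OF g]]
      using tensor_one_carrier[OF u(1)[OF g]] u(2,3)[OF g] by (simp add: tensor_one_one)
  qed
  moreover have "with_ancilla U r g * with_ancilla U r h = c g h \<cdot>\<^sub>m with_ancilla U r (g \<otimes> h)"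
    if "g \<in> carrier G" "h \<in> carrier G" for g h
    unfolding with_ancilla_def tensor_one_mult[OF p(2) p(2), OF that] p(3)[OF that]
    by (rule tensor_one_smult[OF p(2)[OF m_closed[OF that]]])
  ultimately show ?thesis using p(4) unfolding proj_rep_def by blast
qed

lemma multiplicity_character:
  assumes "proj_rep G c n U" "\<sigma> \<in> sectors"
  shows "of_nat (ord_G * multiplicity_in G c U \<sigma>) =
    (\<Sum>g\<in>carrier G. mat_trace (U g) * cnj (mat_trace (class_rep \<sigma> g)))"
  using irreducible_coordinates[OF assms(1)] assms(2) by blast

lemma multiplicity_with_ancilla:
  assumes U: "proj_rep G c n U" and s: "\<sigma> \<in> sectors"
  shows "multiplicity_in G c (with_ancilla U r) \<sigma> = multiplicity_in G c U \<sigma> * r"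
proof -
  have "(of_nat (ord_G * multiplicity_in G c (with_ancilla U r) \<sigma>) :: complex) =
      (\<Sum>g\<in>carrier G. of_nat r * (mat_trace (U g) * cnj (mat_trace (class_rep \<sigma> g))))"
    unfolding multiplicity_character[OF proj_rep_with_ancilla[OF U] s]
    by (intro sum.cong refl) (simp add: with_ancilla_def tensor_one_trace[OF proj_repD(2)[OF U]])
  also have "\<dots> = of_nat r * of_nat (ord_G * multiplicity_in G c U \<sigma>)"
    by (simp only: sum_distrib_left multiplicity_character[OF U s])
  finally have "ord_G * multiplicity_in G c (with_ancilla U r) \<sigma> = r * (ord_G * multiplicity_in G c U \<sigma>)"
    by (simp only: of_nat_mult[symmetric] of_nat_eq_iff)
  then show ?thesis using ord_G_pos by (simp add: mult_ac)
qed

text \<open>Reduces discrimination with an ancilla to the general result for projective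
  representations.\<close>

lemma kappa_with_ancilla:
  assumes "proj_rep G c n U"
  shows "kappa G c (with_ancilla U r) = kappa' G c U r"
  unfolding kappa_def kappa'_def
  by (intro sum.cong refl) (simp add: multiplicity_with_ancilla[OF assms])

text \<open>Extends the sum to all classes by an indicator, so that the three constants can be
  compared term by term.\<close>

lemma kappa_A_eq:
  "kappa_A G c U = (\<Sum>\<sigma>\<in>sectors.
     real (of_bool (1 \<le> multiplicity_in G c U \<sigma>) * class_dim G \<sigma> * class_dim G \<sigma>) / real ord_G)"
  unfolding kappa_A_def using finite_sectors
  by (simp add: sum.inter_filter of_bool_def power2_eq_square if_distrib if_distribR cong: if_cong)

text \<open>The threshold |G| bounds every class dimension: a class that occurs has multiplicity at
  least 1, so its minimum is saturated, and a class that does not occur contributes 0 on both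
  sides.\<close>

lemma kappa'_eq_kappa_A:
  assumes "ord_G \<le> r"
  shows "kappa' G c U r = kappa_A G c U"
  unfolding kappa'_def kappa_A_eq
proof (intro sum.cong refl)
  fix \<sigma> assume s: "\<sigma> \<in> sectors"
  have "min (multiplicity_in G c U \<sigma> * r) (class_dim G \<sigma>) =
      of_bool (1 \<le> multiplicity_in G c U \<sigma>) * class_dim G \<sigma>"
  proof (cases "multiplicity_in G c U \<sigma>")
    case (Suc k)
    have "class_dim G \<sigma> \<le> Suc k * r" using class_dim_le[OF s] assms by simp
    then show ?thesis using Suc by (simp add: min_absorb2 del: mult_Suc)
  qed simp
  then show "real (min (multiplicity_in G c U \<sigma> * r) (class_dim G \<sigma>) * class_dim G \<sigma>) / real ord_G =
      real (of_bool (1 \<le> multiplicity_in G c U \<sigma>) * class_dim G \<sigma> * class_dim G \<sigma>) / real ord_G"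
    by (simp only:)
qed

lemma kappa_le_kappa':
  assumes "1 \<le> r"
  shows "kappa G c U \<le> kappa' G c U r"
  unfolding kappa_def kappa'_def
proof (intro sum_mono divide_right_mono of_nat_mono mult_right_mono)
  fix \<sigma>
  have "multiplicity_in G c U \<sigma> \<le> multiplicity_in G c U \<sigma> * r" using assms by simp
  then show "min (multiplicity_in G c U \<sigma>) (class_dim G \<sigma>) \<le> min (multiplicity_in G c U \<sigma> * r) (class_dim G \<sigma>)"
    by linarith
qed simp_all

lemma kappa'_le_kappa_A: "kappa' G c U r \<le> kappa_A G c U"
  unfolding kappa'_def kappa_A_eq
proof (intro sum_mono divide_right_mono of_nat_mono mult_right_mono)
  fix \<sigma>
  show "min (multiplicity_in G c U \<sigma> * r) (class_dim G \<sigma>) \<le>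
      of_bool (1 \<le> multiplicity_in G c U \<sigma>) * class_dim G \<sigma>"
    by (cases "multiplicity_in G c U \<sigma>") auto
qed simp_all

lemma kappa_eq_kappa_A:
  assumes "\<forall>\<sigma>\<in>sectors. class_dim G \<sigma> = 1"
  shows "kappa G c U = kappa_A G c U"
  unfolding kappa_def kappa_A_eq
proof (intro sum.cong refl)
  fix \<sigma> assume s: "\<sigma> \<in> sectors"
  show "real (min (multiplicity_in G c U \<sigma>) (class_dim G \<sigma>) * class_dim G \<sigma>) / real ord_G =
      real (of_bool (1 \<le> multiplicity_in G c U \<sigma>) * class_dim G \<sigma> * class_dim G \<sigma>) / real ord_G"
    using assms s by (cases "multiplicity_in G c U \<sigma>") auto
qed

end

text \<open>Uniqueness of the maximum turns equality of two optimal values into the equivalence by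
  which the theorem expresses that an ancilla brings no improvement.\<close>

lemma is_P_max_unique: "is_P_max G n V m p \<Longrightarrow> is_P_max G n V m q \<longleftrightarrow> q = p"
  unfolding is_P_max_def by (auto intro: antisym)

theorem mainTheorem5:
  fixes G :: "('g, 'b) monoid_scheme"
    and c :: "'g \<Rightarrow> 'g \<Rightarrow> complex"
    and U :: "'g \<Rightarrow> complex mat"
    and n :: nat
  assumes "group G" and "finite (carrier G)"
    and "n \<ge> 1" and "proj_rep G c n U"
  shows "(\<forall>r\<ge>1. \<forall>m\<in>{0..1}. is_P_max G (n * r) (with_ancilla U r) m
            (if 1 - kappa' G c U r \<le> m then kappa' G c U r
             else kappa' G c U r / (1 - kappa' G c U r) * m))
    \<and> (\<exists>r0. \<forall>r\<ge>r0. kappa' G c U r = kappa_A G c U)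
    \<and> (\<forall>r\<ge>1. kappa G c U \<le> kappa' G c U r \<and> kappa' G c U r \<le> kappa_A G c U)
    \<and> ((\<forall>\<sigma>\<in>irrep_classes G c. class_dim G \<sigma> = 1) \<longrightarrow>
         kappa G c U = kappa_A G c U
         \<and> (\<forall>r\<ge>1. \<forall>m\<in>{0..1}. \<forall>p.
              is_P_max G (n * r) (with_ancilla U r) m p \<longleftrightarrow> is_P_max G n U m p))"
proof -
  interpret factor_system G c
    using assms(1,2) by (intro factor_system.intro factor_system_axioms.intro)
  have anc: "is_P_max G (n * r) (with_ancilla U r) m
      (if 1 - kappa' G c U r \<le> m then kappa' G c U r else kappa' G c U r / (1 - kappa' G c U r) * m)"
    if "1 \<le> r" "m \<in> {0..1}" for r m
    by (rule is_P_max_kappa[OF proj_rep_with_ancilla[OF assms(4)],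
          unfolded kappa_with_ancilla[OF assms(4)]]) (use that assms(3) in simp_all)
  have no_anc: "is_P_max G n U m
      (if 1 - kappa G c U \<le> m then kappa G c U else kappa G c U / (1 - kappa G c U) * m)"
    if "m \<in> {0..1}" for m
    by (rule is_P_max_kappa[OF assms(4)]) (use that assms(3) in simp_all)
  have abelian: "is_P_max G (n * r) (with_ancilla U r) m p \<longleftrightarrow> is_P_max G n U m p"
    if one: "\<forall>\<sigma>\<in>irrep_classes G c. class_dim G \<sigma> = 1" and r: "1 \<le> r" and m: "m \<in> {0..1}" for r m p
  proof -
    \<comment> \<open>\<open>kappa'\<close> lies between \<open>kappa\<close> and
      \<open>kappa_A\<close>, which coincide when all classes are one-dimensional.\<close>
    have "kappa' G c U r = kappa G c U"
      using kappa_eq_kappa_A[OF one, of U] kappa_le_kappa'[OF r, of U] kappa'_le_kappa_A[of U r] by simp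
    then show ?thesis
      using is_P_max_unique[OF anc[OF r m], of p] is_P_max_unique[OF no_anc[OF m], of p] by simp
  qed
  show ?thesis
    using anc abelian kappa'_eq_kappa_A[of _ U] kappa_le_kappa'[of _ U] kappa'_le_kappa_A[of U] kappa_eq_kappa_A[of U]
    by blast
qed

end
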